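(* Let $(\mathcal{G},\mu)$ be a discrete measured groupoid such that $\mathcal{G}=\mathrm{Iso}(\mathcal{G})$. Then $\mathcal{G}$ is a measurable field of countable discrete groups $\mathcal{G}=\bigsqcup_{x\in\mathcal{G}^{(0)}}\Gamma_x$, where $\Gamma_x=\{g\in\mathcal{G}: s(g)=t(g)=x\}$, and $\mathcal{Z}(L(\mathcal{G}))=L^\infty(\mathcal{G}^{(0)},\mu)$ if and only if $\Gamma_x$ is icc for a.e. $x\in\mathcal{G}^{(0)}$.
   Context: A discrete Borel groupoid is a groupoid $\mathcal{G}$ that is also a standard Borel space, such that the unit space $\mathcal{G}^{(0)}$ is a Borel subset, the source and target maps $s,t:\mathcal{G}\to\mathcal{G}^{(0)}$ are countable-to-one Borel maps, and composition $(g,h)\mapsto gh$ (defined when $s(g)=t(h)$) and inversion are Borel. A discrete measured groupoid $(\mathcal{G},\mu)$ is a discrete Borel groupoid with a probability measure $\mu$ on $\mathcal{G}^{(0)}$ such that the $\sigma$-finite measures $\mu_s(A)=\int_{\mathcal{G}^{(0)}}|\{g\in A: s(g)=x\}|\,d\mu(x)$ and $\mu_t(A)=\int_{\mathcal{G}^{(0)}}|\{g\in A: t(g)=x\}|\,d\mu(x)$ on $\mathcal{G}$ are equivalent. $\mathrm{Iso}(\mathcal{G})=\{g\in\mathcal{G}: s(g)=t(g)\}$. For $A,B\subset\mathcal{G}$, $A\cdot B=\{gh: g\in A,h\in B,s(g)=t(h)\}$. A bisection is a subset on which $s$ and $t$ are injective. For a Borel bisection $A$, $\lambda_A\in B(L^2(\mathcal{G},\mu_s))$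 is determined by $\lambda_A1_E=1_{A\cdot E}$ for Borel $E$ with $\mu_s(E)<\infty$. $L(\mathcal{G})=\{\lambda_A: A\subset\mathcal{G}\text{ Borel bisection}\}''$, which contains $L^\infty(\mathcal{G}^{(0)},\mu)$ via $1_Y\mapsto\lambda_Y$, $Y\subset\mathcal{G}^{(0)}$ Borel. A discrete group is icc if every element other than the identity has an infinite conjugacy class (so the trivial group is icc). *)

theory Defs
  imports "HOL-Probability.Probability_Measure" "HOL-Algebra.Group"
begin

section \<open>Standard Borel spaces and discrete measured groupoids\<close>

text \<open>
  A standard Borel space is given by a \<^typ>\<open>'a measure\<close> of which only the underlying set and the
  \<open>\<sigma>\<close>-algebra matter.
\<close>

definition standard_borel :: "'a measure \<Rightarrow> bool" where
  "standard_borel M \<longleftrightarrow>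
     (\<exists>X. completely_metrizable_space X \<and> second_countable X \<and>
          topspace X = space M \<and> sets M = sigma_sets (topspace X) {U. openin X U})"

text \<open>
  The set of arrows is \<open>space (gborel G)\<close>; the operations are total functions of which only the
  values on the arrows (for \<open>gmult\<close>: on the composable pairs) matter.
\<close>

record 'g groupoid =
  gborel :: "'g measure"
  units :: "'g set"
  src :: "'g \<Rightarrow> 'g"
  tgt :: "'g \<Rightarrow> 'g"
  gmult :: "'g \<Rightarrow> 'g \<Rightarrow> 'g"
  ginv :: "'g \<Rightarrow> 'g"

abbreviation arrows :: "'g groupoid \<Rightarrow> 'g set" where
  "arrows G \<equiv> space (gborel G)"

definition composable :: "'g groupoid \<Rightarrow> ('g \<times> 'g) set" where
  "composable G = {(g, h). g \<in> arrows G \<and> h \<in> arrows G \<and> src G g = tgt G h}"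

definition unit_space :: "'g groupoid \<Rightarrow> 'g measure" where
  "unit_space G = restrict_space (gborel G) (units G)"

locale groupoid =
  fixes G :: "'g groupoid"
  assumes units_subset: "units G \<subseteq> arrows G"
    and src_in_units: "g \<in> arrows G \<Longrightarrow> src G g \<in> units G"
    and tgt_in_units: "g \<in> arrows G \<Longrightarrow> tgt G g \<in> units G"
    and src_unit: "x \<in> units G \<Longrightarrow> src G x = x"
    and tgt_unit: "x \<in> units G \<Longrightarrow> tgt G x = x"
    and mult_in_arrows: "(g, h) \<in> composable G \<Longrightarrow> gmult G g h \<in> arrows G"
    and src_mult: "(g, h) \<in> composable G \<Longrightarrow> src G (gmult G g h) = src G h"
    and tgt_mult: "(g, h) \<in> composable G \<Longrightarrow> tgt G (gmult G g h) = tgt G g"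
    and mult_assoc: "(g, h) \<in> composable G \<Longrightarrow> (h, k) \<in> composable G \<Longrightarrow>
           gmult G (gmult G g h) k = gmult G g (gmult G h k)"
    and mult_unit_left: "g \<in> arrows G \<Longrightarrow> gmult G (tgt G g) g = g"
    and mult_unit_right: "g \<in> arrows G \<Longrightarrow> gmult G g (src G g) = g"
    and inv_in_arrows: "g \<in> arrows G \<Longrightarrow> ginv G g \<in> arrows G"
    and src_inv: "g \<in> arrows G \<Longrightarrow> src G (ginv G g) = tgt G g"
    and tgt_inv: "g \<in> arrows G \<Longrightarrow> tgt G (ginv G g) = src G g"
    and inv_mult_left: "g \<in> arrows G \<Longrightarrow> gmult G (ginv G g) g = src G g"
    and inv_mult_right: "g \<in> arrows G \<Longrightarrow> gmult G g (ginv G g) = tgt G g"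

locale discrete_borel_groupoid = groupoid G for G :: "'g groupoid" +
  assumes standard_borel_arrows: "standard_borel (gborel G)"
    and units_borel: "units G \<in> sets (gborel G)"
    and src_borel: "src G \<in> gborel G \<rightarrow>\<^sub>M unit_space G"
    and tgt_borel: "tgt G \<in> gborel G \<rightarrow>\<^sub>M unit_space G"
    and src_countable_to_one: "x \<in> units G \<Longrightarrow> countable {g \<in> arrows G. src G g = x}"
    and tgt_countable_to_one: "x \<in> units G \<Longrightarrow> countable {g \<in> arrows G. tgt G g = x}"
    and mult_borel: "(\<lambda>(g, h). gmult G g h)
           \<in> restrict_space (gborel G \<Otimes>\<^sub>M gborel G) (composable G) \<rightarrow>\<^sub>M gborel G"
    and inv_borel: "ginv G \<in> gborel G \<rightarrow>\<^sub>M gborel G"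

definition mu_src :: "'g groupoid \<Rightarrow> 'g measure \<Rightarrow> 'g measure" where
  "mu_src G \<mu> = measure_of (arrows G) (sets (gborel G))
     (\<lambda>A. \<integral>\<^sup>+ x. emeasure (count_space UNIV) {g \<in> A. src G g = x} \<partial>\<mu>)"

definition mu_tgt :: "'g groupoid \<Rightarrow> 'g measure \<Rightarrow> 'g measure" where
  "mu_tgt G \<mu> = measure_of (arrows G) (sets (gborel G))
     (\<lambda>A. \<integral>\<^sup>+ x. emeasure (count_space UNIV) {g \<in> A. tgt G g = x} \<partial>\<mu>)"

text \<open>
  That the two set functions are \<open>\<sigma>\<close>-finite measures is a consequence of the axioms of a discrete
  Borel groupoid (Lusin--Novikov), hence not assumed.
\<close>

locale discrete_measured_groupoid =
  discrete_borel_groupoid G + prob_space \<mu> for G :: "'g groupoid" and \<mu> :: "'g measure" +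
  assumes sets_mu: "sets \<mu> = sets (unit_space G)"
    and mu_src_mu_tgt: "absolutely_continuous (mu_src G \<mu>) (mu_tgt G \<mu>)"
    and mu_tgt_mu_src: "absolutely_continuous (mu_tgt G \<mu>) (mu_src G \<mu>)"

definition Iso :: "'g groupoid \<Rightarrow> 'g set" where
  "Iso G = {g \<in> arrows G. src G g = tgt G g}"

definition isotropy_group :: "'g groupoid \<Rightarrow> 'g \<Rightarrow> 'g monoid" where
  "isotropy_group G x =
     \<lparr>carrier = {g \<in> arrows G. src G g = x \<and> tgt G g = x}, mult = gmult G, one = x\<rparr>"

definition icc :: "('a, 'b) monoid_scheme \<Rightarrow> bool" where
  "icc H \<longleftrightarrow> (\<forall>g\<in>carrier H. g \<noteq> \<one>\<^bsub>H\<^esub> \<longrightarrow>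
     infinite {h \<otimes>\<^bsub>H\<^esub> g \<otimes>\<^bsub>H\<^esub> inv\<^bsub>H\<^esub> h | h. h \<in> carrier H})"


section \<open>Measurable fields of countable groups\<close>

definition field_proj :: "'x measure \<Rightarrow> ('x \<Rightarrow> ('a, 'b) monoid_scheme) \<Rightarrow> 'a \<Rightarrow> 'x" where
  "field_proj X \<Gamma> g = (THE x. x \<in> space X \<and> g \<in> carrier (\<Gamma> x))"

text \<open>
  The total space \<open>M\<close> is the disjoint union of the groups \<open>\<Gamma> x\<close> with a standard Borel structure for
  which the projection, the fibrewise group operations and the identity section are Borel. The
  last condition is the fundamental sequence of Borel sections.
\<close>

definition measurable_field_of_countable_groups ::
    "'x measure \<Rightarrow> 'a measure \<Rightarrow> ('x \<Rightarrow> ('a, 'b) monoid_scheme) \<Rightarrow> bool" where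
  "measurable_field_of_countable_groups X M \<Gamma> \<longleftrightarrow>
     standard_borel X \<and> standard_borel M \<and>
     (\<forall>x\<in>space X. group (\<Gamma> x) \<and> countable (carrier (\<Gamma> x))) \<and>
     disjoint_family_on (\<lambda>x. carrier (\<Gamma> x)) (space X) \<and>
     space M = (\<Union>x\<in>space X. carrier (\<Gamma> x)) \<and>
     field_proj X \<Gamma> \<in> M \<rightarrow>\<^sub>M X \<and>
     (\<lambda>(g, h). g \<otimes>\<^bsub>\<Gamma> (field_proj X \<Gamma> g)\<^esub> h)
       \<in> restrict_space (M \<Otimes>\<^sub>M M) (\<Union>x\<in>space X. carrier (\<Gamma> x) \<times> carrier (\<Gamma> x)) \<rightarrow>\<^sub>M M \<and>
     (\<lambda>g. inv\<^bsub>\<Gamma> (field_proj X \<Gamma> g)\<^esub> g) \<in> M \<rightarrow>\<^sub>M M \<and>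
     (\<lambda>x. \<one>\<^bsub>\<Gamma> x\<^esub>) \<in> X \<rightarrow>\<^sub>M M \<and>
     (\<exists>e :: nat \<Rightarrow> 'x \<Rightarrow> 'a. (\<forall>n. e n \<in> X \<rightarrow>\<^sub>M M) \<and>
        (\<forall>x\<in>space X. carrier (\<Gamma> x) = range (\<lambda>n. e n x)))"


section \<open>The Hilbert space of square integrable functions and its bounded operators\<close>

definition square_integrable :: "'a measure \<Rightarrow> ('a \<Rightarrow> complex) set" where
  "square_integrable M =
     {f \<in> borel_measurable M. integrable M (\<lambda>x. (cmod (f x))\<^sup>2)}"

text \<open>
  Vectors of \<open>L\<^sup>2\<close> are the almost-everywhere equivalence classes; \<open>L2_rep\<close> chooses representatives.
\<close>

definition L2_class :: "'a measure \<Rightarrow> ('a \<Rightarrow> complex) \<Rightarrow> ('a \<Rightarrow> complex) set" where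
  "L2_class M f = {g \<in> square_integrable M. AE x in M. g x = f x}"

definition L2 :: "'a measure \<Rightarrow> ('a \<Rightarrow> complex) set set" where
  "L2 M = L2_class M ` square_integrable M"

definition L2_rep :: "('a \<Rightarrow> complex) set \<Rightarrow> 'a \<Rightarrow> complex" where
  "L2_rep \<xi> = (SOME f. f \<in> \<xi>)"

definition L2_add ::
    "'a measure \<Rightarrow> ('a \<Rightarrow> complex) set \<Rightarrow> ('a \<Rightarrow> complex) set \<Rightarrow> ('a \<Rightarrow> complex) set" where
  "L2_add M \<xi> \<eta> = L2_class M (\<lambda>x. L2_rep \<xi> x + L2_rep \<eta> x)"

definition L2_scale ::
    "'a measure \<Rightarrow> complex \<Rightarrow> ('a \<Rightarrow> complex) set \<Rightarrow> ('a \<Rightarrow> complex) set" where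
  "L2_scale M c \<xi> = L2_class M (\<lambda>x. c * L2_rep \<xi> x)"

definition L2_norm :: "'a measure \<Rightarrow> ('a \<Rightarrow> complex) set \<Rightarrow> real" where
  "L2_norm M \<xi> = sqrt (\<integral>x. (cmod (L2_rep \<xi> x))\<^sup>2 \<partial>M)"

type_synonym 'a L2_operator = "('a \<Rightarrow> complex) set \<Rightarrow> ('a \<Rightarrow> complex) set"

text \<open>
  Operators are extensional (\<open>undefined\<close> outside \<open>L2 M\<close>), so that equality in HOL is equality of
  operators on \<open>L\<^sup>2\<close>.
\<close>

definition bounded_operators :: "'a measure \<Rightarrow> 'a L2_operator set" where
  "bounded_operators M =
     {T \<in> L2 M \<rightarrow>\<^sub>E L2 M.
        (\<forall>\<xi>\<in>L2 M. \<forall>\<eta>\<in>L2 M. T (L2_add M \<xi> \<eta>) = L2_add M (T \<xi>) (T \<eta>)) \<and>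
        (\<forall>c. \<forall>\<xi>\<in>L2 M. T (L2_scale M c \<xi>) = L2_scale M c (T \<xi>)) \<and>
        (\<exists>K. \<forall>\<xi>\<in>L2 M. L2_norm M (T \<xi>) \<le> K * L2_norm M \<xi>)}"

definition commutant :: "'a measure \<Rightarrow> 'a L2_operator set \<Rightarrow> 'a L2_operator set" where
  "commutant M S =
     {T \<in> bounded_operators M. \<forall>A\<in>S. \<forall>\<xi>\<in>L2 M. T (A \<xi>) = A (T \<xi>)}"

definition center :: "'a measure \<Rightarrow> 'a L2_operator set \<Rightarrow> 'a L2_operator set" where
  "center M N = N \<inter> commutant M N"

definition mult_operator :: "'a measure \<Rightarrow> ('a \<Rightarrow> complex) \<Rightarrow> 'a L2_operator" where
  "mult_operator M \<phi> = restrict (\<lambda>\<xi>. L2_class M (\<lambda>x. \<phi> x * L2_rep \<xi> x)) (L2 M)"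


lemma L2_class_eqI:
  assumes "AE x in M. f x = g x"
  shows "L2_class M f = L2_class M g"
  unfolding L2_class_def using assms by (auto elim: AE_mp)

lemma L2_class_AE:
  assumes "L2_class M f = L2_class M g" "f \<in> square_integrable M"
  shows "AE x in M. f x = g x"
  using assms by (force simp: L2_class_def)

lemma L2_rep:
  assumes "\<xi> \<in> L2 M"
  shows "L2_rep \<xi> \<in> square_integrable M" "L2_class M (L2_rep \<xi>) = \<xi>"
proof -
  obtain f where f: "f \<in> square_integrable M" "\<xi> = L2_class M f"
    using assms by (auto simp: L2_def)
  have "f \<in> \<xi>" using f by (simp add: L2_class_def)
  hence *: "L2_rep \<xi> \<in> \<xi>" unfolding L2_rep_def by (rule someI[where P="\<lambda>f. f \<in> \<xi>"])
  thus "L2_rep \<xi> \<in> square_integrable M" using f by (simp add: L2_class_def)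
  show "L2_class M (L2_rep \<xi>) = \<xi>" using * f by (auto simp: L2_class_def intro!: L2_class_eqI[unfolded L2_class_def])
qed

lemma L2_rep_class:
  assumes "f \<in> square_integrable M"
  shows "AE x in M. L2_rep (L2_class M f) x = f x"
proof -
  have "L2_class M f \<in> L2 M" using assms by (simp add: L2_def)
  from L2_rep[OF this] show ?thesis by (intro L2_class_AE) auto
qed

lemma L2_class_in_L2: "f \<in> square_integrable M \<Longrightarrow> L2_class M f \<in> L2 M"
  by (simp add: L2_def)

lemma square_integrable_mult:
  assumes "f \<in> square_integrable M" "\<phi> \<in> borel_measurable M" "AE x in M. cmod (\<phi> x) \<le> C"
  shows "(\<lambda>x. \<phi> x * f x) \<in> square_integrable M"
proof -
  have m: "f \<in> borel_measurable M" and i: "integrable M (\<lambda>x. (cmod (f x))\<^sup>2)"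
    using assms by (auto simp: square_integrable_def)
  have "integrable M (\<lambda>x. (cmod (\<phi> x * f x))\<^sup>2)"
  proof (rule Bochner_Integration.integrable_bound[where f="\<lambda>x. C\<^sup>2 * (cmod (f x))\<^sup>2"])
    show "integrable M (\<lambda>x. C\<^sup>2 * (cmod (f x))\<^sup>2)" using i by simp
    show "(\<lambda>x. (cmod (\<phi> x * f x))\<^sup>2) \<in> borel_measurable M" using m assms(2) by measurable
    show "AE x in M. norm ((cmod (\<phi> x * f x))\<^sup>2) \<le> norm (C\<^sup>2 * (cmod (f x))\<^sup>2)"
      using assms(3)
    proof eventually_elim
      case (elim x)
      have "(cmod (\<phi> x))\<^sup>2 \<le> C\<^sup>2" using elim by (intro power_mono) auto
      thus ?case by (simp add: norm_mult power_mult_distrib mult_right_mono)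
    qed
  qed
  thus ?thesis using m assms(2) by (simp add: square_integrable_def)
qed

lemma square_integrable_scale:
  "f \<in> square_integrable M \<Longrightarrow> (\<lambda>x. c * f x) \<in> square_integrable M"
  by (rule square_integrable_mult[where C="cmod c"]) auto

lemma cmod_add_square: "(cmod (a + b))\<^sup>2 \<le> 2 * (cmod a)\<^sup>2 + 2 * (cmod b)\<^sup>2"
proof -
  have "(cmod (a + b))\<^sup>2 \<le> (cmod a + cmod b)\<^sup>2" by (intro power_mono norm_triangle_ineq) auto
  also have "\<dots> \<le> 2 * (cmod a)\<^sup>2 + 2 * (cmod b)\<^sup>2"
    using zero_le_power2[of "cmod a - cmod b"] by (simp add: power2_eq_square algebra_simps)
  finally show ?thesis .
qed

lemma square_integrable_add:
  assumes "f \<in> square_integrable M" "g \<in> square_integrable M"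
  shows "(\<lambda>x. f x + g x) \<in> square_integrable M"
proof -
  have m: "f \<in> borel_measurable M" "g \<in> borel_measurable M"
    and i: "integrable M (\<lambda>x. (cmod (f x))\<^sup>2)" "integrable M (\<lambda>x. (cmod (g x))\<^sup>2)"
    using assms by (auto simp: square_integrable_def)
  have "integrable M (\<lambda>x. (cmod (f x + g x))\<^sup>2)"
  proof (rule Bochner_Integration.integrable_bound)
    show "integrable M (\<lambda>x. 2 * (cmod (f x))\<^sup>2 + 2 * (cmod (g x))\<^sup>2)" using i by simp
    show "(\<lambda>x. (cmod (f x + g x))\<^sup>2) \<in> borel_measurable M" using m by measurable
    show "AE x in M. norm ((cmod (f x + g x))\<^sup>2) \<le> norm (2 * (cmod (f x))\<^sup>2 + 2 * (cmod (g x))\<^sup>2)"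
      using cmod_add_square by (intro AE_I2) simp
  qed
  thus ?thesis using m by (simp add: square_integrable_def)
qed

lemma square_integrable_diff:
  assumes "f \<in> square_integrable M" "g \<in> square_integrable M"
  shows "(\<lambda>x. f x - g x) \<in> square_integrable M"
  using square_integrable_add[OF assms(1) square_integrable_scale[OF assms(2), of "-1"]] by simp

lemma L2_add_class:
  assumes "f \<in> square_integrable M" "g \<in> square_integrable M"
  shows "L2_add M (L2_class M f) (L2_class M g) = L2_class M (\<lambda>x. f x + g x)"
  unfolding L2_add_def
  by (rule L2_class_eqI) (use L2_rep_class[OF assms(1)] L2_rep_class[OF assms(2)] in eventually_elim, simp)

lemma L2_scale_class:
  assumes "f \<in> square_integrable M"
  shows "L2_scale M c (L2_class M f) = L2_class M (\<lambda>x. c * f x)"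
  unfolding L2_scale_def
  by (rule L2_class_eqI) (use L2_rep_class[OF assms(1)] in eventually_elim, simp)

lemma L2_norm_class:
  assumes "f \<in> square_integrable M"
  shows "L2_norm M (L2_class M f) = sqrt (\<integral>x. (cmod (f x))\<^sup>2 \<partial>M)"
proof -
  have r: "L2_rep (L2_class M f) \<in> square_integrable M" 
    using L2_rep(1)[OF L2_class_in_L2[OF assms]] .
  have [measurable]: "f \<in> borel_measurable M" "L2_rep (L2_class M f) \<in> borel_measurable M"
    using assms r by (auto simp: square_integrable_def)
  have "(\<integral>x. (cmod (L2_rep (L2_class M f) x))\<^sup>2 \<partial>M) = (\<integral>x. (cmod (f x))\<^sup>2 \<partial>M)"
    by (rule integral_cong_AE) (measurable, use L2_rep_class[OF assms] in eventually_elim, simp)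
  thus ?thesis by (simp add: L2_norm_def)
qed

lemma mult_operator_class:
  assumes "f \<in> square_integrable M"
  shows "mult_operator M \<phi> (L2_class M f) = L2_class M (\<lambda>x. \<phi> x * f x)"
proof -
  have "L2_class M f \<in> L2 M" using assms by (rule L2_class_in_L2)
  moreover have "L2_class M (\<lambda>x. \<phi> x * L2_rep (L2_class M f) x) = L2_class M (\<lambda>x. \<phi> x * f x)"
    by (rule L2_class_eqI) (use L2_rep_class[OF assms(1)] in eventually_elim, simp)
  ultimately show ?thesis by (simp add: mult_operator_def)
qed

lemma mult_operator_bounded:
  assumes "\<phi> \<in> borel_measurable M" "AE x in M. cmod (\<phi> x) \<le> C"
  shows "mult_operator M \<phi> \<in> bounded_operators M"
proof -
  have sq: "(\<lambda>x. \<phi> x * f x) \<in> square_integrable M" if "f \<in> square_integrable M" for f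
    using square_integrable_mult[OF that assms] .
  have "mult_operator M \<phi> \<in> L2 M \<rightarrow>\<^sub>E L2 M"
  proof (rule PiE_I)
    fix \<xi> assume "\<xi> \<in> L2 M"
    thus "mult_operator M \<phi> \<xi> \<in> L2 M"
      by (auto simp: L2_def mult_operator_class sq)
  qed (simp add: mult_operator_def)
  moreover have "\<forall>\<xi>\<in>L2 M. \<forall>\<eta>\<in>L2 M. mult_operator M \<phi> (L2_add M \<xi> \<eta>) =
      L2_add M (mult_operator M \<phi> \<xi>) (mult_operator M \<phi> \<eta>)"
    by (simp add: L2_def L2_add_class mult_operator_class sq square_integrable_add distrib_left)
  moreover have "\<forall>c. \<forall>\<xi>\<in>L2 M. mult_operator M \<phi> (L2_scale M c \<xi>) =
      L2_scale M c (mult_operator M \<phi> \<xi>)"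
    by (simp add: L2_def L2_scale_class mult_operator_class sq square_integrable_scale mult.left_commute)
  moreover have "L2_norm M (mult_operator M \<phi> \<xi>) \<le> \<bar>C\<bar> * L2_norm M \<xi>" if \<xi>: "\<xi> \<in> L2 M" for \<xi>
  proof -
    obtain f where f: "f \<in> square_integrable M" "\<xi> = L2_class M f" using \<xi> by (auto simp: L2_def)
    have i: "integrable M (\<lambda>x. (cmod (f x))\<^sup>2)" "integrable M (\<lambda>x. (cmod (\<phi> x * f x))\<^sup>2)"
      using f(1) sq[OF f(1)] by (auto simp: square_integrable_def)
    have "(\<integral>x. (cmod (\<phi> x * f x))\<^sup>2 \<partial>M) \<le> (\<integral>x. C\<^sup>2 * (cmod (f x))\<^sup>2 \<partial>M)"
    proof (rule integral_mono_AE)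
      show "AE x in M. (cmod (\<phi> x * f x))\<^sup>2 \<le> C\<^sup>2 * (cmod (f x))\<^sup>2"
        using assms(2)
      proof eventually_elim
        case (elim x)
        have "(cmod (\<phi> x))\<^sup>2 \<le> C\<^sup>2" using elim by (intro power_mono) auto
        thus ?case by (simp add: norm_mult power_mult_distrib mult_right_mono)
      qed
    qed (use i in auto)
    hence "sqrt (\<integral>x. (cmod (\<phi> x * f x))\<^sup>2 \<partial>M) \<le> sqrt (C\<^sup>2 * (\<integral>x. (cmod (f x))\<^sup>2 \<partial>M))"
      by simp
    thus ?thesis using f sq[OF f(1)] by (simp add: mult_operator_class L2_norm_class real_sqrt_mult)
  qed
  ultimately show ?thesis unfolding bounded_operators_def by blast
qed

lemma indicator_square_integrable:
  assumes "E \<in> sets M" "emeasure M E < \<infinity>"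
  shows "(indicator E :: 'a \<Rightarrow> complex) \<in> square_integrable M"
proof -
  have "(\<lambda>x. (cmod (indicator E x :: complex))\<^sup>2) = (indicator E :: 'a \<Rightarrow> real)"
    by (auto simp: indicator_def fun_eq_iff)
  thus ?thesis using assms by (simp add: square_integrable_def integrable_indicator_iff)
qed

text \<open>Operators are determined by their values on indicators of sets of finite measure.\<close>

lemma bounded_operators_eqI:
  assumes S: "S \<in> bounded_operators M" and T: "T \<in> bounded_operators M"
    and eq: "\<And>E. E \<in> sets M \<Longrightarrow> emeasure M E < \<infinity> \<Longrightarrow>
      S (L2_class M (indicator E)) = T (L2_class M (indicator E))"
  shows "S = T"
proof -
  note add = square_integrable_add and scale = square_integrable_scale
  have lin: "R (L2_class M (\<lambda>x. f x + g x)) = L2_add M (R (L2_class M f)) (R (L2_class M g))"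
     "R (L2_class M (\<lambda>x. c * f x)) = L2_scale M c (R (L2_class M f))"
    if "R \<in> bounded_operators M" "f \<in> square_integrable M" "g \<in> square_integrable M" for R f g c
    using that by (simp_all add: bounded_operators_def flip: L2_add_class L2_scale_class)
      (simp_all add: L2_class_in_L2)
  have closed: "R \<xi> \<in> L2 M" if "R \<in> bounded_operators M" "\<xi> \<in> L2 M" for R \<xi>
    using that by (auto simp: bounded_operators_def)
  have sum: "(\<lambda>x. \<Sum>y\<in>F. y * indicator (E y) x) \<in> square_integrable M \<and>
      S (L2_class M (\<lambda>x. \<Sum>y\<in>F. y * indicator (E y) x)) = T (L2_class M (\<lambda>x. \<Sum>y\<in>F. y * indicator (E y) x))"
    if "finite F" "\<And>y. y \<in> F \<Longrightarrow> E y \<in> sets M" "\<And>y. y \<in> F \<Longrightarrow> emeasure M (E y) < \<infinity>"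
    for F :: "complex set" and E
    using that
  proof (induction F rule: finite_induct)
    case empty
    have e: "(indicator {} :: 'a \<Rightarrow> complex) = (\<lambda>x. 0)" by (simp add: fun_eq_iff)
    show ?case using eq[of "{}"] by (simp add: square_integrable_def e)
  next
    case (insert y F)
    have i: "indicator (E y) \<in> square_integrable M" 
      using insert by (intro indicator_square_integrable) auto
    have F: "(\<lambda>x. \<Sum>y\<in>F. y * indicator (E y) x) \<in> square_integrable M"
      "S (L2_class M (\<lambda>x. \<Sum>y\<in>F. y * indicator (E y) x)) = T (L2_class M (\<lambda>x. \<Sum>y\<in>F. y * indicator (E y) x))"
      using insert by auto
    have "S (L2_class M (\<lambda>x. y * indicator (E y) x)) = T (L2_class M (\<lambda>x. y * indicator (E y) x))"
      using lin(2)[OF S i i] lin(2)[OF T i i] eq[of "E y"] insert by simp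
    thus ?case using lin(1)[OF S scale[OF i] F(1)] lin(1)[OF T scale[OF i] F(1)] F insert(1,2)
        add[OF scale[OF i] F(1)]
      by (simp del: sum_mult_indicator)
  qed
  have main: "S (L2_class M f) = T (L2_class M f)" if f: "f \<in> square_integrable M" for f
  proof -
    have fm[measurable]: "f \<in> borel_measurable M" and fi: "integrable M (\<lambda>x. (cmod (f x))\<^sup>2)"
      using f by (auto simp: square_integrable_def)
    obtain s where s: "\<And>i. simple_function M (s i)" "\<And>x. x \<in> space M \<Longrightarrow> (\<lambda>i. s i x) \<longlonglongrightarrow> f x"
      "\<And>i x. x \<in> space M \<Longrightarrow> norm (s i x) \<le> 2 * norm (f x)"
      using borel_measurable_implies_sequence_metric[OF fm, of 0] that by (simp add: dist_norm) blast
    have sm[measurable]: "s i \<in> borel_measurable M" for i using s(1) by (rule borel_measurable_simple_function)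
    have si: "s i \<in> square_integrable M" for i
    proof -
      have "integrable M (\<lambda>x. (cmod (s i x))\<^sup>2)"
      proof (rule Bochner_Integration.integrable_bound)
        show "integrable M (\<lambda>x. 4 * (cmod (f x))\<^sup>2)" using fi by simp
        show "AE x in M. norm ((cmod (s i x))\<^sup>2) \<le> norm (4 * (cmod (f x))\<^sup>2)"
          using power_mono[OF s(3), of _ i 2] by (intro AE_I2) (simp add: power_mult_distrib)
      qed measurable
      thus ?thesis by (simp add: square_integrable_def)
    qed
    have eqs: "S (L2_class M (s i)) = T (L2_class M (s i))" for i
    proof -
      let ?F = "s i ` space M - {0}" and ?E = "\<lambda>y. s i -` {y} \<inter> space M"
      have fin: "finite ?F" using s(1)[of i] by (auto simp: simple_function_def)
      have E: "?E y \<in> sets M" for y by measurable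
      have Efin: "emeasure M (?E y) < \<infinity>" if "y \<in> ?F" for y
      proof -
        have "integrable M (\<lambda>x. (1 / (cmod y)\<^sup>2) * (cmod (s i x))\<^sup>2)"
          using si[of i] by (auto simp: square_integrable_def)
        hence "integrable M (indicator (?E y) :: 'a \<Rightarrow> real)"
          by (rule Bochner_Integration.integrable_bound)
            (use E that in \<open>auto simp: indicator_def\<close>)
        thus ?thesis using E by (simp add: integrable_indicator_iff)
      qed
      have *: "S (L2_class M (\<lambda>x. \<Sum>y\<in>?F. y * indicator (?E y) x)) = T (L2_class M (\<lambda>x. \<Sum>y\<in>?F. y * indicator (?E y) x))"
        using sum[of ?F ?E] fin E Efin by blast
      have "s i x = (\<Sum>y\<in>?F. y * indicator (?E y) x)" if "x \<in> space M" for x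
      proof -
        have "(\<Sum>y\<in>?F. y * indicator (?E y) x) = (\<Sum>y\<in>?F. if y = s i x then y else 0)"
          using that by (intro sum.cong) (auto simp: indicator_def)
        also have "\<dots> = s i x" using fin that by simp
        finally show ?thesis ..
      qed
      hence "L2_class M (s i) = L2_class M (\<lambda>x. \<Sum>y\<in>?F. y * indicator (?E y) x)"
        by (intro L2_class_eqI AE_I2)
      thus ?thesis using * by simp
    qed
    define d where "d i x = f x - s i x" for i x
    have di: "d i \<in> square_integrable M" for i
      unfolding d_def using f si by (rule square_integrable_diff)
    have dlim: "(\<lambda>i. \<integral>x. (cmod (d i x))\<^sup>2 \<partial>M) \<longlonglongrightarrow> (\<integral>x. 0 \<partial>M)"
    proof (rule integral_dominated_convergence[where w="\<lambda>x. 9 * (cmod (f x))\<^sup>2"])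
      show "integrable M (\<lambda>x. 9 * (cmod (f x))\<^sup>2)" using fi by simp
      show "(\<lambda>x. (cmod (d i x))\<^sup>2) \<in> borel_measurable M" for i unfolding d_def by measurable
      show "AE x in M. (\<lambda>i. (cmod (d i x))\<^sup>2) \<longlonglongrightarrow> 0"
      proof (rule AE_I2)
        fix x assume "x \<in> space M"
        from s(2)[OF this] have "(\<lambda>i. (cmod (f x - s i x))\<^sup>2) \<longlonglongrightarrow> (cmod (f x - f x))\<^sup>2"
          by (intro tendsto_intros)
        thus "(\<lambda>i. (cmod (d i x))\<^sup>2) \<longlonglongrightarrow> 0" by (simp add: d_def)
      qed
      show "AE x in M. norm ((cmod (d i x))\<^sup>2) \<le> 9 * (cmod (f x))\<^sup>2" for i
      proof (rule AE_I2)
        fix x assume "x \<in> space M"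
        from s(3)[OF this, of i] have "cmod (d i x) \<le> 3 * cmod (f x)"
          using norm_triangle_ineq4[of "f x" "s i x"] by (simp add: d_def)
        from power_mono[OF this, of 2] show "norm ((cmod (d i x))\<^sup>2) \<le> 9 * (cmod (f x))\<^sup>2"
          by (simp add: power_mult_distrib)
      qed
    qed simp
    obtain K L where K: "\<And>\<xi>. \<xi> \<in> L2 M \<Longrightarrow> L2_norm M (S \<xi>) \<le> K * L2_norm M \<xi>"
      and L: "\<And>\<xi>. \<xi> \<in> L2 M \<Longrightarrow> L2_norm M (T \<xi>) \<le> L * L2_norm M \<xi>"
    proof -
      have "\<exists>K. \<forall>\<xi>\<in>L2 M. L2_norm M (S \<xi>) \<le> K * L2_norm M \<xi>"
        "\<exists>L. \<forall>\<xi>\<in>L2 M. L2_norm M (T \<xi>) \<le> L * L2_norm M \<xi>"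
        using S T by (simp_all add: bounded_operators_def)
      thus ?thesis using that by blast
    qed
    let ?a = "L2_rep (S (L2_class M f))" and ?b = "L2_rep (T (L2_class M f))"
    have ab: "?a \<in> square_integrable M" "?b \<in> square_integrable M"
      using L2_rep(1) closed S T L2_class_in_L2[OF f] by blast+
    have sqb: "(\<integral>x. (cmod (L2_rep (R (L2_class M (d i))) x))\<^sup>2 \<partial>M) \<le> C\<^sup>2 * (\<integral>x. (cmod (d i x))\<^sup>2 \<partial>M)"
      if "\<And>\<xi>. \<xi> \<in> L2 M \<Longrightarrow> L2_norm M (R \<xi>) \<le> C * L2_norm M \<xi>" for R C i
    proof -
      have "(L2_norm M (R (L2_class M (d i))))\<^sup>2 \<le> (C * L2_norm M (L2_class M (d i)))\<^sup>2"
        by (intro power_mono that L2_class_in_L2 di) (simp add: L2_norm_def)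
      thus ?thesis unfolding L2_norm_class[OF di] by (simp add: L2_norm_def power_mult_distrib)
    qed
    have bound: "(\<integral>x. (cmod (?a x - ?b x))\<^sup>2 \<partial>M) \<le> (2 * K\<^sup>2 + 2 * L\<^sup>2) * (\<integral>x. (cmod (d i x))\<^sup>2 \<partial>M)" for i
    proof -
      let ?c = "L2_rep (S (L2_class M (d i)))" and ?e = "L2_rep (T (L2_class M (d i)))"
        and ?z = "L2_rep (S (L2_class M (s i)))"
      have ce: "?c \<in> square_integrable M" "?e \<in> square_integrable M" "?z \<in> square_integrable M"
        using L2_rep(1) closed S T L2_class_in_L2[OF di] L2_class_in_L2[OF si] by blast+
      have split: "L2_class M f = L2_class M (\<lambda>x. d i x + s i x)" by (simp add: d_def)
      have "S (L2_class M f) = L2_class M (\<lambda>x. ?c x + ?z x)"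
        unfolding split lin(1)[OF S di si] by (simp add: L2_add_def)
      hence a: "AE x in M. ?a x = ?c x + ?z x"
        using L2_rep_class[OF add[OF ce(1,3)]] by simp
      have "T (L2_class M f) = L2_class M (\<lambda>x. ?e x + ?z x)"
        unfolding split lin(1)[OF T di si] by (simp add: L2_add_def eqs)
      hence b: "AE x in M. ?b x = ?e x + ?z x"
        using L2_rep_class[OF add[OF ce(2,3)]] by simp
      have i: "integrable M (\<lambda>x. (cmod (?c x))\<^sup>2)" "integrable M (\<lambda>x. (cmod (?e x))\<^sup>2)"
        "integrable M (\<lambda>x. (cmod (?a x - ?b x))\<^sup>2)"
        using ce square_integrable_diff[OF ab] by (auto simp: square_integrable_def)
      have "(\<integral>x. (cmod (?a x - ?b x))\<^sup>2 \<partial>M) \<le> (\<integral>x. 2 * (cmod (?c x))\<^sup>2 + 2 * (cmod (?e x))\<^sup>2 \<partial>M)"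
      proof (rule integral_mono_AE)
        show "AE x in M. (cmod (?a x - ?b x))\<^sup>2 \<le> 2 * (cmod (?c x))\<^sup>2 + 2 * (cmod (?e x))\<^sup>2"
          using a b
        proof eventually_elim
          case (elim x)
          thus ?case using cmod_add_square[of "?c x" "- ?e x"] by simp
        qed
      qed (use i in auto)
      also have "\<dots> = 2 * (\<integral>x. (cmod (?c x))\<^sup>2 \<partial>M) + 2 * (\<integral>x. (cmod (?e x))\<^sup>2 \<partial>M)"
        using i by simp
      also have "\<dots> \<le> (2 * K\<^sup>2 + 2 * L\<^sup>2) * (\<integral>x. (cmod (d i x))\<^sup>2 \<partial>M)"
        using sqb[of S K i, OF K] sqb[of T L i, OF L] by (simp add: algebra_simps)
      finally show ?thesis .
    qed
    have "(\<lambda>i. (2 * K\<^sup>2 + 2 * L\<^sup>2) * (\<integral>x. (cmod (d i x))\<^sup>2 \<partial>M)) \<longlonglongrightarrow> (2 * K\<^sup>2 + 2 * L\<^sup>2) * 0"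
      using dlim by (intro tendsto_intros) simp
    from LIMSEQ_le_const[OF this] bound
    have "(\<integral>x. (cmod (?a x - ?b x))\<^sup>2 \<partial>M) \<le> 0" by auto
    moreover have "integrable M (\<lambda>x. (cmod (?a x - ?b x))\<^sup>2)"
      using square_integrable_diff[OF ab] by (auto simp: square_integrable_def)
    ultimately have "AE x in M. (cmod (?a x - ?b x))\<^sup>2 = 0"
      using integral_nonneg_eq_0_iff_AE[of M "\<lambda>x. (cmod (?a x - ?b x))\<^sup>2"]
      by (simp add: order_antisym integral_nonneg_AE)
    hence "AE x in M. ?a x = ?b x" by simp
    hence "L2_class M ?a = L2_class M ?b" by (rule L2_class_eqI)
    thus ?thesis using L2_rep(2) closed S T L2_class_in_L2[OF f] by metis
  qed
  show ?thesis
  proof (rule PiE_ext)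
    show "S \<in> L2 M \<rightarrow>\<^sub>E L2 M" "T \<in> L2 M \<rightarrow>\<^sub>E L2 M" using S T by (auto simp: bounded_operators_def)
    show "S \<xi> = T \<xi>" if "\<xi> \<in> L2 M" for \<xi> using that main by (auto simp: L2_def)
  qed
qed


section \<open>The von Neumann algebra of a discrete measured groupoid\<close>

definition set_mult :: "'g groupoid \<Rightarrow> 'g set \<Rightarrow> 'g set \<Rightarrow> 'g set" where
  "set_mult G A B = {gmult G g h | g h. g \<in> A \<and> h \<in> B \<and> src G g = tgt G h}"

definition borel_bisection :: "'g groupoid \<Rightarrow> 'g set \<Rightarrow> bool" where
  "borel_bisection G A \<longleftrightarrow>
     A \<in> sets (gborel G) \<and> inj_on (src G) A \<and> inj_on (tgt G) A"

definition lambda_op :: "'g groupoid \<Rightarrow> 'g measure \<Rightarrow> 'g set \<Rightarrow> 'g L2_operator" where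
  "lambda_op G \<mu> A =
     (THE T. T \<in> bounded_operators (mu_src G \<mu>) \<and>
        (\<forall>E\<in>sets (gborel G). emeasure (mu_src G \<mu>) E < \<infinity> \<longrightarrow>
           T (L2_class (mu_src G \<mu>) (indicator E)) =
           L2_class (mu_src G \<mu>) (indicator (set_mult G A E))))"

definition groupoid_vN :: "'g groupoid \<Rightarrow> 'g measure \<Rightarrow> 'g L2_operator set" where
  "groupoid_vN G \<mu> =
     commutant (mu_src G \<mu>) (commutant (mu_src G \<mu>)
       {lambda_op G \<mu> A | A. borel_bisection G A})"

text \<open>
  The copy of \<open>L\<^sup>\<infinity>(G\<^sup>(\<^sup>0\<^sup>), \<mu>)\<close> inside the algebra: since \<open>Y \<cdot> E = {g \<in> E. tgt g \<in> Y}\<close> for a set of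
  units \<open>Y\<close>, the operator \<open>\<lambda>\<^sub>Y\<close> is multiplication by \<open>1\<^sub>Y \<circ> tgt\<close>, so \<open>f\<close> acts as multiplication by
  \<open>f \<circ> tgt\<close> (lemma \<open>lambda_op_units\<close> below).
\<close>

definition Linf_units :: "'g groupoid \<Rightarrow> 'g measure \<Rightarrow> 'g L2_operator set" where
  "Linf_units G \<mu> =
     {mult_operator (mu_src G \<mu>) (\<lambda>g. f (tgt G g)) | f.
        f \<in> borel_measurable \<mu> \<and> (\<exists>C. AE x in \<mu>. cmod (f x) \<le> C)}"

lemma (in discrete_borel_groupoid) lambda_op_units:
  assumes Y: "Y \<in> sets (unit_space G)"
  shows "lambda_op G \<mu> Y = mult_operator (mu_src G \<mu>) (\<lambda>g. indicator Y (tgt G g))"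
proof -
  let ?M = "mu_src G \<mu>" and ?\<phi> = "\<lambda>g. indicator Y (tgt G g) :: complex"
  have sets_M: "sets ?M = sets (gborel G)"
    unfolding mu_src_def by (simp add: sets.space_closed sets.sigma_sets_eq)
  have "?\<phi> \<in> borel_measurable (gborel G)"
    using tgt_borel Y by (auto intro: measurable_compose borel_measurable_indicator)
  hence "?\<phi> \<in> borel_measurable ?M" using sets_M measurable_cong_sets by blast
  hence bd: "mult_operator ?M ?\<phi> \<in> bounded_operators ?M"
    by (rule mult_operator_bounded[where C=1]) (auto simp: indicator_def)
  have Y_units: "Y \<subseteq> units G" using sets.sets_into_space[OF Y] by (auto simp: unit_space_def space_restrict_space)
  have mult: "mult_operator ?M ?\<phi> (L2_class ?M (indicator E)) = L2_class ?M (indicator (set_mult G Y E))"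
    if E: "E \<in> sets (gborel G)" "emeasure ?M E < \<infinity>" for E
  proof -
    have sub: "E \<subseteq> arrows G" using sets.sets_into_space E(1) by blast
    have "set_mult G Y E = {g \<in> E. tgt G g \<in> Y}"
    proof (intro equalityI subsetI)
      fix k assume "k \<in> set_mult G Y E"
      then obtain y h where k: "k = gmult G y h" "y \<in> Y" "h \<in> E" "src G y = tgt G h"
        by (auto simp: set_mult_def)
      have "y \<in> units G" "h \<in> arrows G" using k Y_units sub by auto
      hence "tgt G h = y" "k = h" using k(1,4) src_unit[of y] mult_unit_left[of h] by auto
      thus "k \<in> {g \<in> E. tgt G g \<in> Y}" using k by simp
    next
      fix k assume k: "k \<in> {g \<in> E. tgt G g \<in> Y}"
      hence "k = gmult G (tgt G k) k" "src G (tgt G k) = tgt G k"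
        using src_unit[of "tgt G k"] mult_unit_left[of k] Y_units sub by auto
      thus "k \<in> set_mult G Y E" using k unfolding set_mult_def by blast
    qed
    hence "(\<lambda>g. ?\<phi> g * indicator E g) = indicator (set_mult G Y E)"
      by (auto simp: fun_eq_iff indicator_def)
    moreover have "indicator E \<in> square_integrable ?M"
      using E sets_M by (intro indicator_square_integrable) auto
    ultimately show ?thesis by (simp add: mult_operator_class)
  qed
  show ?thesis unfolding lambda_op_def
  proof (rule the_equality)
    fix T assume T: "T \<in> bounded_operators ?M \<and> (\<forall>E\<in>sets (gborel G). emeasure ?M E < \<infinity> \<longrightarrow>
      T (L2_class ?M (indicator E)) = L2_class ?M (indicator (set_mult G Y E)))"
    thus "T = mult_operator ?M ?\<phi>"
      using bd mult sets_M by (intro bounded_operators_eqI[of T ?M]) auto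
  qed (use bd mult in auto)
qed

end

theory Submission
  imports Defs
begin

text \<open>
  Since source and target agree, the groupoid is a bundle of countable groups. A Borel map with
  countable fibres on a standard Borel space decomposes the space into countably many Borel sets on
  which it is injective and maps Borel sets to Borel sets (Lusin--Novikov, Lusin--Souslin). This
  provides the Borel sections of the field, a description of \<open>\<mu>\<^sub>s\<close> by counting on the fibres, and
  left and right translations by sections as operators on \<open>L\<^sup>2\<close>.

  A central operator \<open>Z\<close> commutes with left and right translations, so \<open>Z 1\<^sub>U\<close>, where \<open>U\<close> is the set of
  units, is almost everywhere constant on conjugacy classes and square summable on the fibres. If
  almost all groups are icc, it therefore lives on the units and \<open>Z\<close> is the multiplication by a function
  on the unit space. Conversely, the nontrivial elements whose conjugacy class lies in the first \<open>N\<close>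
  pieces of the decomposition form a set \<open>T\<close> which is a finite union of bisections, so convolution with
  \<open>1\<^sub>T\<close> is a central operator; it maps \<open>1\<^sub>U\<close> to \<open>1\<^sub>T\<close> and can be a multiplication only if \<open>T\<close> is null.
\<close>

section \<open>Complete codings\<close>

text \<open>Fibre counts, sections and translations become measurable through two facts: bisections
  have Borel images, and countably many of them partition the arrows. Codings serve to prove both,
  because a point can be built coordinate by coordinate, with consistency of the finite prefixes as
  the only condition. On the operator side, right translations commute with the generators, so they
  belong to the commutant, and an element of the bicommutant commutes with them; this is how a
  central operator sees both sides of a conjugation. Right translates of \<open>1_U\<close> are the
  indicators of bisections, whose finite sums approximate indicators of sets of finite measure, so
  \<open>Z\<close> is determined by its value on \<open>1_U\<close>. In the converse direction, the
  indicator of all elements with finite class need not be square integrable, and convolution with it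
  need not be bounded. The cutoff at \<open>N\<close> pieces makes the convolution a finite sum of
  generators, hence bounded and inside the algebra; imposing it on the whole class keeps the set
  conjugation invariant, hence the operator central.\<close>

text \<open>
  A complete coding identifies \<open>M\<close> with a closed subset of \<open>\<nat>\<^sup>\<nat>\<close>: the last clause says that a
  sequence all of whose prefixes occur is itself a code. Sets decided by a single coordinate become
  clopen, so passing to a finer coding amounts to refining a Polish topology.
\<close>

definition complete_coding :: "'a measure \<Rightarrow> (nat \<Rightarrow> 'a \<Rightarrow> nat) \<Rightarrow> bool" where
  "complete_coding M c \<longleftrightarrow>
     (\<forall>n. c n \<in> M \<rightarrow>\<^sub>M count_space UNIV) \<and>
     (\<forall>x\<in>space M. \<forall>y\<in>space M. (\<forall>n. c n x = c n y) \<longrightarrow> x = y) \<and>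
     (\<forall>a. (\<forall>n. \<exists>x\<in>space M. \<forall>i<n. c i x = a i) \<longrightarrow> (\<exists>x\<in>space M. \<forall>i. c i x = a i))"

text \<open>Coordinates of the coarser coding may reappear in any position, so that both
  interleaving codings and inserting a new coordinate are refinements.\<close>

definition finer :: "(nat \<Rightarrow> 'a \<Rightarrow> nat) \<Rightarrow> (nat \<Rightarrow> 'a \<Rightarrow> nat) \<Rightarrow> bool" where
  "finer c' c \<longleftrightarrow> range c \<subseteq> range c'"

definition decides :: "'a measure \<Rightarrow> (nat \<Rightarrow> 'a \<Rightarrow> nat) \<Rightarrow> 'a set \<Rightarrow> bool" where
  "decides M c D \<longleftrightarrow> (\<exists>n K. D = {x \<in> space M. c n x \<in> K})"

lemma complete_codingD:
  assumes "complete_coding M c"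
  shows "c n \<in> M \<rightarrow>\<^sub>M count_space UNIV"
    and "x \<in> space M \<Longrightarrow> y \<in> space M \<Longrightarrow> (\<And>n. c n x = c n y) \<Longrightarrow> x = y"
    and "(\<And>n. \<exists>x\<in>space M. \<forall>i<n. c i x = a i) \<Longrightarrow> \<exists>x\<in>space M. \<forall>i. c i x = a i"
  using assms unfolding complete_coding_def by blast+

lemma finer_trans: "finer c'' c' \<Longrightarrow> finer c' c \<Longrightarrow> finer c'' c"
  by (auto simp: finer_def)

lemma finer_ex:
  assumes "finer c' c" shows "\<exists>m. c' m = c n"
proof -
  have "c n \<in> range c'" using assms by (auto simp: finer_def)
  thus ?thesis by auto
qed

lemma decides_finer:
  assumes "decides M c D" "finer c' c" shows "decides M c' D"
proof -
  obtain n K where D: "D = {x \<in> space M. c n x \<in> K}" using assms(1) by (auto simp: decides_def)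
  obtain m where "c' m = c n" using finer_ex[OF assms(2)] by blast
  thus ?thesis using D unfolding decides_def by metis
qed

lemma sets_coordinate:
  assumes "complete_coding M c" shows "{x \<in> space M. c n x \<in> K} \<in> sets M"
proof -
  have "c n -` K \<inter> space M \<in> sets M" using complete_codingD(1)[OF assms] by (rule measurable_sets) simp
  thus ?thesis by (simp add: vimage_def Int_def conj_commute)
qed

lemma decides_sets:
  assumes "complete_coding M c" "decides M c D" shows "D \<in> sets M"
  using assms sets_coordinate[OF assms(1)] by (auto simp: decides_def)

text \<open>The codings \<open>e i\<close> are interleaved. A sequence with consistent prefixes
  yields one point for each \<open>e i\<close>; the coordinates of the common coarser coding
  \<open>c\<close> force all these points to coincide.\<close>

lemma complete_coding_merge:
  assumes c: "complete_coding M c"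
    and e: "\<And>i::nat. complete_coding M (e i)" "\<And>i. finer (e i) c"
  shows "\<exists>c'. complete_coding M c' \<and> (\<forall>i. finer c' (e i)) \<and> finer c' c"
proof -
  define c' where "c' k = e (fst (prod_decode k)) (snd (prod_decode k))" for k
  have enc: "c' (prod_encode (i, n)) = e i n" for i n by (simp add: c'_def)
  have r: "finer c' (e i)" for i
    unfolding finer_def using enc by (metis image_subsetI rangeI)
  have rc: "finer c' c" using finer_trans[OF r e(2)] .
  have "complete_coding M c'" unfolding complete_coding_def
  proof (intro conjI allI ballI impI)
    show "c' n \<in> M \<rightarrow>\<^sub>M count_space UNIV" for n
      unfolding c'_def using complete_codingD(1)[OF e(1)] .
  next
    fix x y assume xy: "x \<in> space M" "y \<in> space M" "\<forall>n. c' n x = c' n y"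
    have "c n x = c n y" for n using finer_ex[OF rc, of n] xy(3) by metis
    thus "x = y" using complete_codingD(2)[OF c] xy by blast
  next
    fix a :: "nat \<Rightarrow> nat" assume fin: "\<forall>n. \<exists>x\<in>space M. \<forall>i<n. c' i x = a i"
    have "\<exists>x\<in>space M. \<forall>n. e i n x = a (prod_encode (i, n))" for i
    proof (rule complete_codingD(3)[OF e(1)])
      fix n
      obtain N where N: "\<forall>j\<in>{..<n}. prod_encode (i, j) < N"
        using finite_nat_set_iff_bounded[of "(\<lambda>j. prod_encode (i, j)) ` {..<n}"] by auto
      obtain x where "x \<in> space M" "\<forall>k<N. c' k x = a k" using fin by blast
      thus "\<exists>x\<in>space M. \<forall>j<n. e i j x = a (prod_encode (i, j))"
        using N enc by (auto intro!: bexI[of _ x])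
    qed
    then obtain x where x: "\<And>i. x i \<in> space M" "\<And>i n. e i n (x i) = a (prod_encode (i, n))"
      by metis
    have eq: "x i = x 0" for i
    proof (rule complete_codingD(2)[OF c x(1) x(1)])
      fix n
      obtain m m' where m: "e i m = c n" "e 0 m' = c n"
        using finer_ex[OF e(2), of i n] finer_ex[OF e(2), of 0 n] by blast
      obtain y where y: "\<forall>k < Suc (max (prod_encode (i, m)) (prod_encode (0, m'))). c' k y = a k"
        using fin by blast
      have "a (prod_encode (i, m)) = c n y" 
        using y[rule_format, of "prod_encode (i, m)"] enc[of i m] m by simp
      moreover have "a (prod_encode (0, m')) = c n y" 
        using y[rule_format, of "prod_encode (0, m')"] enc[of 0 m'] m by simp
      ultimately show "c n (x i) = c n (x 0)" using x(2)[of i m] x(2)[of 0 m'] m by simp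
    qed
    have "c' k (x 0) = a k" for k
      using x(2)[of "fst (prod_decode k)" "snd (prod_decode k)"] by (simp add: c'_def eq[of "fst (prod_decode k)"])
    thus "\<exists>x\<in>space M. \<forall>i. c' i x = a i" using x(1) by blast
  qed
  thus ?thesis by (intro exI[of _ c'] conjI allI r rc)
qed

text \<open>A coordinate for mere membership in the union could break completeness, since the union
  is open but in general not closed. Recording the first index as a witness repairs this: each value
  \<open>Suc k\<close> is determined by finitely many \<open>D i\<close>, and the value 0 describes
  an intersection of clopen complements.\<close>

lemma complete_coding_Union:
  assumes c: "complete_coding M c" and D: "\<And>k::nat. decides M c (D k)"
  obtains c' where "complete_coding M c'" "finer c' c" "decides M c' (\<Union>k. D k)"
proof -
  define m where "m x = (if x \<in> (\<Union>k. D k) then Suc (LEAST k. x \<in> D k) else 0)" for x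
  define c' where "c' n = (case n of 0 \<Rightarrow> m | Suc k \<Rightarrow> c k)" for n
  have c'[simp]: "c' 0 = m" "c' (Suc k) = c k" for k by (auto simp: c'_def)
  have rc: "finer c' c" unfolding finer_def using c'(2) by (metis image_subsetI rangeI)
  have Ds[measurable]: "D k \<in> sets M" for k using decides_sets[OF c D] .
  have DsM: "D k \<subseteq> space M" for k using sets.sets_into_space[OF Ds] .
  have "complete_coding M c'" unfolding complete_coding_def
  proof (intro conjI allI ballI impI)
    have "m \<in> M \<rightarrow>\<^sub>M count_space UNIV" unfolding m_def by measurable
    thus "c' n \<in> M \<rightarrow>\<^sub>M count_space UNIV" for n
      using complete_codingD(1)[OF c] by (cases n) auto
  next
    fix x y assume xy: "x \<in> space M" "y \<in> space M" "\<forall>n. c' n x = c' n y"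
    have "c n x = c n y" for n using spec[OF xy(3), of "Suc n"] by simp
    thus "x = y" using complete_codingD(2)[OF c] xy by blast
  next
    fix a :: "nat \<Rightarrow> nat" assume fin: "\<forall>n. \<exists>x\<in>space M. \<forall>i<n. c' i x = a i"
    have "\<exists>x\<in>space M. \<forall>n. c n x = a (Suc n)"
    proof (rule complete_codingD(3)[OF c])
      fix n
      obtain x where x: "x \<in> space M" "\<forall>k<Suc n. c' k x = a k" using fin by blast
      have "\<forall>k<n. c k x = a (Suc k)" using x(2) by fastforce
      thus "\<exists>x\<in>space M. \<forall>i<n. c i x = a (Suc i)" using x by blast
    qed
    then obtain x where x: "x \<in> space M" "\<And>n. c n x = a (Suc n)" by blast
    \<comment> \<open>The point \<open>x\<close> realizes the old coordinates only. It is compared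
      with points \<open>y\<close> that realize a longer prefix of \<open>a\<close> including the
      new coordinate, long enough to decide the first \<open>n + 1\<close> sets.\<close>
    have agree: "\<exists>y\<in>space M. m y = a 0 \<and> (\<forall>k\<le>n. y \<in> D k \<longleftrightarrow> x \<in> D k)" for n
    proof -
      obtain j K where jK: "\<And>k. D k = {x \<in> space M. c (j k) x \<in> K k}"
        using D unfolding decides_def by metis
      obtain N where N: "\<forall>k\<in>{..n}. j k < N"
        using finite_nat_set_iff_bounded[of "j ` {..n}"] by auto
      obtain y where y: "y \<in> space M" "\<forall>k<Suc N. c' k y = a k" using fin by blast
      have "c (j k) y = c (j k) x" if "k \<le> n" for k
        using y(2)[rule_format, of "Suc (j k)"] N that x(2) by auto
      hence "\<forall>k\<le>n. y \<in> D k \<longleftrightarrow> x \<in> D k" using jK x(1) y(1) by auto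
      moreover have "m y = a 0" using y(2) by (metis c'(1) zero_less_Suc)
      ultimately show ?thesis using y(1) by blast
    qed
    have "m x = a 0"
    proof (cases "a 0")
      case 0
      have "x \<notin> D k" for k
      proof -
        obtain y where "m y = 0" "y \<in> D k \<longleftrightarrow> x \<in> D k" using agree[of k] 0 by auto
        thus ?thesis by (auto simp: m_def split: if_splits)
      qed
      thus ?thesis using 0 by (simp add: m_def)
    next
      case (Suc k)
      obtain y where y: "m y = Suc k" "\<forall>i\<le>k. y \<in> D i \<longleftrightarrow> x \<in> D i" using agree[of k] Suc by auto
      have ex: "\<exists>i. y \<in> D i" and k: "k = (LEAST i. y \<in> D i)"
        using y(1) by (auto simp: m_def split: if_splits)
      have "y \<in> D k" unfolding k using ex by (rule LeastI_ex)
      moreover have "y \<notin> D i" if "i < k" for i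
        using not_less_Least[of i "\<lambda>i. y \<in> D i"] that k by blast
      ultimately have "x \<in> D k" "\<And>i. x \<in> D i \<Longrightarrow> k \<le> i"
        using y(2) by (force simp: not_less[symmetric])+
      hence "(LEAST i. x \<in> D i) = k" by (intro Least_equality) auto
      thus ?thesis using Suc \<open>x \<in> D k\<close> by (auto simp: m_def)
    qed
    hence "c' i x = a i" for i using x(2) by (cases i) auto
    thus "\<exists>x\<in>space M. \<forall>i. c' i x = a i" using x(1) by blast
  qed
  moreover have "(\<Union>k. D k) = {x \<in> space M. c' 0 x \<in> {0<..}}" using DsM by (auto simp: m_def)
  hence "decides M c' (\<Union>k. D k)" unfolding decides_def by blast
  ultimately show ?thesis using that rc by blast
qed

definition generates :: "(nat \<Rightarrow> 'a \<Rightarrow> nat) \<Rightarrow> 'a measure \<Rightarrow> bool" where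
  "generates c M \<longleftrightarrow> sets M = sigma_sets (space M) {c n -` {k} \<inter> space M | n k. True}"

text \<open>Every Borel set is clopen in some finer coding: by induction over the generated
  \<sigma>-algebra, where complements use the same coding and countable unions are handled by
  merging and then adding one coordinate.\<close>

lemma complete_coding_refine1:
  assumes c: "complete_coding M c" and gen: "generates c M" and D: "D \<in> sets M"
  shows "\<exists>c'. complete_coding M c' \<and> finer c' c \<and> decides M c' D"
proof -
  have "D \<in> sigma_sets (space M) {c n -` {k} \<inter> space M | n k. True}"
    using D gen unfolding generates_def by blast
  thus ?thesis
  proof induction
    case (Basic A)
    then obtain n k where "A = c n -` {k} \<inter> space M" by blast
    hence "A = {x \<in> space M. c n x \<in> {k}}" by auto
    hence "decides M c A" unfolding decides_def by blast
    thus ?case using c by (auto simp: finer_def)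
  next
    case Empty
    have "{} = {x \<in> space M. c 0 x \<in> {}}" by simp
    hence "decides M c {}" unfolding decides_def by metis
    thus ?case using c by (auto simp: finer_def)
  next
    case (Compl A)
    then obtain c' where c': "complete_coding M c'" "finer c' c" "decides M c' A" by blast
    then obtain n K where "A = {x \<in> space M. c' n x \<in> K}" by (auto simp: decides_def)
    hence "space M - A = {x \<in> space M. c' n x \<in> - K}" by auto
    hence "decides M c' (space M - A)" unfolding decides_def by metis
    thus ?case using c' by blast
  next
    case (Union A)
    hence "\<forall>i. \<exists>e. complete_coding M e \<and> finer e c \<and> decides M e (A i)" by blast
    from choice[OF this] obtain e
      where e: "\<And>i. complete_coding M (e i)" "\<And>i. finer (e i) c" "\<And>i. decides M (e i) (A i)"
      by blast
    obtain c' where c': "complete_coding M c'" "\<And>i. finer c' (e i)" "finer c' c"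
      using complete_coding_merge[of M c e, OF c e(1,2)] by blast
    obtain c'' where "complete_coding M c''" "finer c'' c'" "decides M c'' (\<Union>i. A i)"
      by (rule complete_coding_Union[OF c'(1) decides_finer[OF e(3) c'(2)]])
    thus ?case using c'(3) finer_trans[of c'' c' c] by blast
  qed
qed

lemma complete_coding_refine:
  assumes c: "complete_coding M c" and gen: "generates c M" and D: "\<And>k::nat. D k \<in> sets M"
  obtains c' where "complete_coding M c'" "finer c' c" "\<And>k. decides M c' (D k)"
proof -
  obtain e where e: "\<And>i. complete_coding M (e i)" "\<And>i. finer (e i) c" "\<And>i. decides M (e i) (D i)"
    using choice[of "\<lambda>i e. complete_coding M e \<and> finer e c \<and> decides M e (D i)"]
      complete_coding_refine1[OF c gen D] by blast
  obtain c' where c': "complete_coding M c'" "\<And>i. finer c' (e i)" "finer c' c"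
    using complete_coding_merge[of M c e, OF c e(1,2)] by blast
  show ?thesis using c' by (intro that[of c'] decides_finer[OF e(3) c'(2)])
qed

section \<open>Codings of Polish spaces\<close>

definition side :: "bool \<Rightarrow> real" where "side b = (if b then 1 else -1)"

text \<open>On the side \<open>True\<close>, code 0 means q \<le> t; otherwise the code names the
  first rational s with t \<le> s < q. The witness s turns the open condition t < q into a closed
  one, so that codes can survive limits. The side \<open>False\<close> is the mirror image under
  negation.\<close>

definition rat_code :: "rat \<times> bool \<Rightarrow> real \<Rightarrow> nat" where
  "rat_code p t = (let \<sigma> = side (snd p); q = real_of_rat (fst p) in
     if \<sigma> * q \<le> \<sigma> * t then 0
     else Suc (LEAST j. \<sigma> * real_of_rat (from_nat j) < \<sigma> * q \<and> \<sigma> * t \<le> \<sigma> * real_of_rat (from_nat j)))"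

lemma side_not: "side (\<not> b) = - side b"
  by (simp add: side_def)

lemma rat_code_eq_0_iff: "rat_code (q, b) t = 0 \<longleftrightarrow> side b * real_of_rat q \<le> side b * t"
  by (simp add: rat_code_def Let_def)

lemma rat_code_witness_ex:
  assumes "side b * t < side b * real_of_rat q"
  shows "\<exists>j. side b * real_of_rat (from_nat j) < side b * real_of_rat q \<and>
             side b * t \<le> side b * real_of_rat (from_nat j)"
proof -
  have "\<exists>r. side b * real_of_rat r < side b * real_of_rat q \<and> side b * t \<le> side b * real_of_rat r"
  proof (cases b)
    case True
    then obtain r where "t < real_of_rat r" "real_of_rat r < real_of_rat q"
      using assms of_rat_dense[of t "real_of_rat q"] by (auto simp: side_def)
    thus ?thesis using True by (intro exI[of _ r]) (auto simp: side_def)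
  next
    case False
    then obtain r where "t > real_of_rat r" "real_of_rat r > real_of_rat q"
      using assms of_rat_dense[of "real_of_rat q" t] by (auto simp: side_def)
    thus ?thesis using False by (intro exI[of _ r]) (auto simp: side_def)
  qed
  thus ?thesis by (metis from_nat_to_nat)
qed

lemma rat_code_eq_Suc_iff:
  "rat_code (q, b) t = Suc k \<longleftrightarrow>
     side b * real_of_rat (from_nat k) < side b * real_of_rat q \<and>
     side b * t \<le> side b * real_of_rat (from_nat k) \<and>
     (\<forall>j<k. side b * real_of_rat (from_nat j) < side b * real_of_rat q \<longrightarrow>
        side b * real_of_rat (from_nat j) < side b * t)"
  (is "_ \<longleftrightarrow> ?P k \<and> ?Q k \<and> ?R")
proof
  assume eq: "rat_code (q, b) t = Suc k"
  hence lt: "side b * t < side b * real_of_rat q"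
    using rat_code_eq_0_iff[of q b t] by auto
  hence k: "k = (LEAST j. ?P j \<and> ?Q j)"
    using eq by (auto simp: rat_code_def Let_def)
  have "?P k \<and> ?Q k" unfolding k using rat_code_witness_ex[OF lt] by (rule LeastI_ex)
  moreover have "\<not> (?P j \<and> ?Q j)" if "j < k" for j
    using not_less_Least[of j "\<lambda>j. ?P j \<and> ?Q j"] that k by blast
  ultimately show "?P k \<and> ?Q k \<and> ?R" by (auto simp: not_le)
next
  assume *: "?P k \<and> ?Q k \<and> ?R"
  hence "\<not> side b * real_of_rat q \<le> side b * t" by linarith
  moreover have "(LEAST j. ?P j \<and> ?Q j) = k"
    using * by (intro Least_equality) (auto simp: not_less[symmetric])
  ultimately show "rat_code (q, b) t = Suc k" by (simp add: rat_code_def Let_def)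
qed

text \<open>
  A limit might admit a smaller witness than the numbers approaching it; this is excluded by the
  codes for the opposite side.
\<close>

lemma rat_code_limit:
  assumes u: "u \<longlonglongrightarrow> t" and a: "\<And>p. \<forall>\<^sub>F m in sequentially. rat_code p (u m) = a p"
  shows "rat_code p t = a p"
proof -
  have le: "side b * real_of_rat q \<le> side b * t"
    if "\<forall>\<^sub>F m in sequentially. side b * real_of_rat q \<le> side b * u m" for q b
    using tendsto_lowerbound[OF tendsto_mult_left[OF u] that] by simp
  have ge: "side b * t \<le> side b * real_of_rat q"
    if "\<forall>\<^sub>F m in sequentially. side b * u m \<le> side b * real_of_rat q" for q b
    using tendsto_upperbound[OF tendsto_mult_left[OF u] that] by simp
  obtain q b where p: "p = (q, b)" by (cases p)
  show ?thesis
  proof (cases "a (q, b)")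
    case 0
    have "\<forall>\<^sub>F m in sequentially. side b * real_of_rat q \<le> side b * u m"
      using a[of "(q, b)"] by eventually_elim (simp add: 0 rat_code_eq_0_iff)
    thus ?thesis using le[of b q] 0 p by (simp add: rat_code_eq_0_iff)
  next
    case (Suc k)
    have ev: "\<forall>\<^sub>F m in sequentially. rat_code (q, b) (u m) = Suc k"
      using a[of "(q, b)"] Suc by simp
    have P: "side b * real_of_rat (from_nat k) < side b * real_of_rat q"
      using eventually_happens'[OF sequentially_bot ev] by (auto simp: rat_code_eq_Suc_iff)
    have Q: "side b * t \<le> side b * real_of_rat (from_nat k)"
      by (rule ge) (use ev in eventually_elim, simp add: rat_code_eq_Suc_iff)
    have R: "side b * real_of_rat (from_nat j) < side b * t"
      if j: "j < k" "side b * real_of_rat (from_nat j) < side b * real_of_rat q" for j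
    proof -
      let ?s = "from_nat j :: rat"
      have lt: "\<forall>\<^sub>F m in sequentially. side b * real_of_rat ?s < side b * u m"
        using ev by eventually_elim (use j in \<open>auto simp: rat_code_eq_Suc_iff\<close>)
      \<comment> \<open>In the order given by \<open>side b\<close>, the rational \<open>?s\<close>
        lies strictly below the later \<open>u m\<close>, so its code on the opposite side is
        nonzero. The witness of that code lies strictly above \<open>?s\<close> and not above the
        limit, which keeps the limit away from \<open>?s\<close>.\<close>
      have "a (?s, \<not> b) \<noteq> 0"
      proof
        assume 0: "a (?s, \<not> b) = 0"
        have "\<forall>\<^sub>F m in sequentially. False"
          using lt a[of "(?s, \<not> b)"]
          by eventually_elim (simp add: 0 rat_code_eq_0_iff side_not)
        thus False by simp
      qed
      then obtain l where l: "a (?s, \<not> b) = Suc l" using not0_implies_Suc by blast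
      have ev': "\<forall>\<^sub>F m in sequentially. rat_code (?s, \<not> b) (u m) = Suc l"
        using a[of "(?s, \<not> b)"] l by simp
      have "side (\<not> b) * real_of_rat (from_nat l) < side (\<not> b) * real_of_rat ?s"
        using eventually_happens'[OF sequentially_bot ev'] by (auto simp: rat_code_eq_Suc_iff)
      moreover have "side (\<not> b) * t \<le> side (\<not> b) * real_of_rat (from_nat l)"
        by (rule ge) (use ev' in eventually_elim, simp add: rat_code_eq_Suc_iff)
      ultimately show ?thesis by (simp add: side_not)
    qed
    show ?thesis using P Q R Suc p by (simp add: rat_code_eq_Suc_iff)
  qed
qed

lemma measurable_rat_code[measurable]: "rat_code p \<in> borel \<rightarrow>\<^sub>M count_space UNIV"
  unfolding rat_code_def Let_def by measurable

text \<open>For a dense sequence \<open>q\<close> in a complete metric there are two kinds of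
  coordinates: the codes of the distances to all \<open>q i\<close>, and for each n the first index
  whose point is within 1/(n+1). The second kind makes points with longer and longer consistent
  prefixes a Cauchy sequence and separates points; the first kind ensures that the limit still has
  the prescribed coordinates.\<close>

lemma standard_borel_coding:
  assumes "standard_borel M"
  obtains c where "complete_coding M c" "generates c M"
proof -
  obtain X where X: "completely_metrizable_space X" "second_countable X" "topspace X = space M"
    and sets_X: "sets M = sigma_sets (topspace X) {U. openin X U}"
    using assms by (auto simp: standard_borel_def)
  obtain S d where S: "Metric_space S d" "Metric_space.mcomplete S d"
    and X_eq: "X = Metric_space.mtopology S d"
    using X(1) by (auto simp: completely_metrizable_space_def)
  interpret Metric_space S d by (rule S(1))
  have space_M: "space M = S" using X(3) X_eq by simp
  have sets_M: "sets M = sigma_sets S {U. openin mtopology U}" using sets_X X_eq by simp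
  show ?thesis
  proof (cases "S = {}")
    case True
    have "complete_coding M (\<lambda>n x. 0)" using True space_M
      by (auto simp: complete_coding_def)
    moreover have "generates (\<lambda>n x. 0) M"
    proof -
      have "space M = {}" using True space_M by simp
      moreover from this have "sets M = {{}}" by (simp add: space_empty_iff)
      moreover have "sigma_sets {} H = {{}}" if "H \<subseteq> Pow {}" for H :: "'a set set"
        using sigma_sets_into_sp[OF that] by (auto intro: sigma_sets.Empty)
      ultimately show ?thesis unfolding generates_def by auto
    qed
    ultimately show ?thesis by (rule that)
  next
    case False
    obtain C where C: "countable C" "C \<subseteq> S" "mtopology closure_of C = S"
      using second_countable_imp_separable_space[OF X(2)] X_eq by (auto simp: separable_space_def)
    have "C \<noteq> {}" using C(3) False by auto
    define q where "q = from_nat_into C"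
    have range_q: "range q = C" unfolding q_def using C(1) \<open>C \<noteq> {}\<close> by (rule range_from_nat_into[rotated])
    have qS: "q i \<in> S" for i using range_q C(2) by auto
    have dense: "\<exists>i. d (q i) x < r" if "x \<in> S" "0 < r" for x r
    proof -
      have "\<exists>y\<in>C. y \<in> mball x r" using C(3) that metric_closure_of by blast
      thus ?thesis using range_q commute qS by (metis imageE in_mball)
    qed
    have open_sets: "U \<in> sets M" if "openin mtopology U" for U
      unfolding sets_M using that by (intro sigma_sets.Basic) simp
    have dist_meas[measurable]: "d (q i) \<in> borel_measurable M" for i
    proof (subst borel_measurable_iff_less, intro allI)
      fix r
      have "{x \<in> space M. d (q i) x < r} = mball (q i) r" using qS by (auto simp: space_M)
      thus "{x \<in> space M. d (q i) x < r} \<in> sets M" using open_sets by simp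
    qed
    define idx where "idx n x = (LEAST k. d (q k) x < 1 / real (Suc n))" for n x
    have idx: "d (q (idx n x)) x < 1 / real (Suc n)" if "x \<in> S" for n x
      unfolding idx_def by (rule LeastI_ex) (use dense that in simp)
    define c where "c n x = (case sum_decode n of
        Inl m \<Rightarrow> (let (i, p) = from_nat m in rat_code p (d (q i) x))
      | Inr m \<Rightarrow> idx m x)" for n x
    have c_idx: "c (sum_encode (Inr m)) x = idx m x" for m x by (simp add: c_def)
    have c_rat: "c (sum_encode (Inl (to_nat (i, p)))) x = rat_code p (d (q i) x)" for i p x
      by (simp add: c_def)
    have c_meas[measurable]: "c n \<in> M \<rightarrow>\<^sub>M count_space UNIV" for n
    proof (cases "sum_decode n")
      case (Inl m)
      obtain i p where "from_nat m = (i :: nat, p :: rat \<times> bool)"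
        using prod.exhaust[of "from_nat m :: nat \<times> rat \<times> bool"] by blast
      hence "c n = (\<lambda>x. rat_code p (d (q i) x))" using Inl by (auto simp: c_def fun_eq_iff)
      thus ?thesis by simp
    next
      case (Inr m)
      hence "c n = idx m" by (auto simp: c_def fun_eq_iff)
      thus ?thesis unfolding idx_def by simp
    qed
    have complete: "\<exists>x\<in>S. \<forall>i. c i x = a i" if fin: "\<And>n. \<exists>x\<in>S. \<forall>i<n. c i x = a i" for a
    proof -
      obtain u where u: "\<And>n. u n \<in> S" "\<And>n i. i < n \<Longrightarrow> c i (u n) = a i"
        using fin by metis
      have ev: "\<forall>\<^sub>F m in sequentially. c i (u m) = a i" for i
        using u(2) by (intro eventually_sequentiallyI[of "Suc i"]) auto
      have "MCauchy u" unfolding MCauchy_def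
      proof (intro conjI allI impI)
        show "range u \<subseteq> S" using u(1) by auto
        fix e :: real assume "0 < e"
        then obtain n where n: "2 / real (Suc n) < e"
          using reals_Archimedean[of "e / 2"] by (auto simp: field_simps)
        let ?j = "sum_encode (Inr n)"
        have "d (q (a ?j)) (u m) < 1 / real (Suc n)" if "Suc ?j \<le> m" for m
          using idx[OF u(1), of n m] u(2)[of ?j m] that by (simp add: c_idx)
        hence "d (u m) (u m') < e" if "Suc ?j \<le> m" "Suc ?j \<le> m'" for m m'
          using triangle[OF u(1)[of m] qS[of "a ?j"] u(1)[of m']] commute[of "u m" "q (a ?j)"] that n
          by (smt (verit) add_divide_distrib)
        thus "\<exists>N. \<forall>m m'. N \<le> m \<longrightarrow> N \<le> m' \<longrightarrow> d (u m) (u m') < e" by blast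
      qed
      then obtain l where l: "limitin mtopology u l sequentially"
        using S(2) unfolding mcomplete_def by blast
      have lS: "l \<in> S" using l limitin_mspace by blast
      have lim: "(\<lambda>m. d (q i) (u m)) \<longlonglongrightarrow> d (q i) l" for i
      proof (rule tendstoI)
        fix e :: real assume "0 < e"
        with l have "\<forall>\<^sub>F m in sequentially. u m \<in> S \<and> d (u m) l < e" by (auto simp: limitin_metric)
        thus "\<forall>\<^sub>F m in sequentially. dist (d (q i) (u m)) (d (q i) l) < e"
        proof eventually_elim
          case (elim m)
          thus ?case using mdist_reverse_triangle[of "u m" "q i" l] qS lS commute
            by (simp add: dist_real_def)
        qed
      qed
      have rat: "rat_code p (d (q i) l) = a (sum_encode (Inl (to_nat (i, p))))" for p i
      proof -
        have "\<forall>\<^sub>F m in sequentially. rat_code p (d (q i) (u m)) = a (sum_encode (Inl (to_nat (i, p))))" for p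
          using ev[of "sum_encode (Inl (to_nat (i, p)))"] by (simp add: c_rat)
        from rat_code_limit[OF lim this] show ?thesis .
      qed
      have idx_l: "idx n l = a (sum_encode (Inr n))" for n
      proof -
        let ?k = "a (sum_encode (Inr n))"
        obtain s :: rat where r: "real_of_rat s = 1 / real (Suc n)"
          by (rule that[of "1 / of_nat (Suc n)"]) (simp add: of_rat_divide of_rat_add)
        have ev_idx: "\<forall>\<^sub>F m in sequentially. idx n (u m) = ?k"
          using ev[of "sum_encode (Inr n)"] by (simp add: c_idx)
        \<comment> \<open>The limit of strict inequalities alone gives only a weak one. If it failed
          to be strict, the code of the distance with respect to the rational 1/(n+1) would be 0 at
          \<open>l\<close>, hence also at the later \<open>u m\<close>.\<close>
        have "d (q ?k) l < 1 / real (Suc n)"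
        proof (rule ccontr)
          assume "\<not> ?thesis"
          hence "rat_code (s, True) (d (q ?k) l) = 0" by (simp add: rat_code_eq_0_iff r side_def)
          hence "\<forall>\<^sub>F m in sequentially. rat_code (s, True) (d (q ?k) (u m)) = 0"
            using rat[of "(s, True)" ?k] ev[of "sum_encode (Inl (to_nat (?k, s, True)))"]
            by (simp add: c_rat)
          with ev_idx have "\<forall>\<^sub>F m in sequentially. False"
          proof eventually_elim
            case (elim m)
            thus ?case using idx[OF u(1), of n m] by (simp add: rat_code_eq_0_iff r side_def)
          qed
          thus False by simp
        qed
        moreover have "\<not> d (q j) l < 1 / real (Suc n)" if "j < ?k" for j
        proof -
          have "\<forall>\<^sub>F m in sequentially. 1 / real (Suc n) \<le> d (q j) (u m)"
            using ev_idx
          proof eventually_elim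
            case (elim m)
            thus ?case using not_less_Least[of j "\<lambda>k. d (q k) (u m) < 1 / real (Suc n)"] that
              by (simp add: idx_def not_less)
          qed
          thus ?thesis using tendsto_lowerbound[OF lim] by (simp add: not_less)
        qed
        ultimately show ?thesis unfolding idx_def
          by (intro Least_equality) (auto simp: not_less[symmetric])
      qed
      have "c i l = a i" for i
      proof (cases "sum_decode i")
        case (Inl m)
        obtain j p where jp: "from_nat m = (j :: nat, p :: rat \<times> bool)"
        using prod.exhaust[of "from_nat m :: nat \<times> rat \<times> bool"] by blast
        let ?i = "sum_encode (Inl (to_nat (j, p)))"
        \<comment> \<open>\<open>from_nat\<close> need not be injective, so \<open>i\<close> may be
          a repetition of the canonical coordinate \<open>?i\<close> for the same pair.\<close>
        have same: "c i x = c ?i x" for x using Inl jp by (simp add: c_rat) (simp add: c_def)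
        have "\<forall>\<^sub>F m in sequentially. a i = a ?i"
          using ev[of i] ev[of ?i] by eventually_elim (use same in simp)
        hence "a i = a ?i" by simp
        thus ?thesis using rat[of p j] c_rat[of j p l] same[of l] by simp
      next
        case (Inr m)
        hence "sum_encode (Inr m) = i" by (metis sum_decode_inverse)
        thus ?thesis using idx_l[of m] c_idx[of m l] by simp
      qed
      thus ?thesis using lS by blast
    qed
    have sep: "x = y" if "x \<in> S" "y \<in> S" "\<And>n. c n x = c n y" for x y
    proof (rule ccontr)
      assume "x \<noteq> y"
      hence "0 < d x y" using that by simp
      then obtain n where n: "2 / real (Suc n) < d x y"
        using reals_Archimedean[of "d x y / 2"] by (auto simp: field_simps)
      have "idx n x = idx n y" using that(3)[of "sum_encode (Inr n)"] by (simp add: c_idx)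
      thus False using idx[OF that(1), of n] idx[OF that(2), of n] n
          triangle[OF that(1) qS that(2), of "idx n x"] commute[of x "q (idx n x)"]
        by (smt (verit) add_divide_distrib)
    qed
    have "complete_coding M c" unfolding complete_coding_def space_M
      using c_meas sep complete by blast
    moreover have "generates c M"
    proof -
      let ?G = "{c n -` {k} \<inter> space M | n k. True}"
      have "U \<in> sigma_sets S ?G" if U: "openin mtopology U" for U
      proof -
        let ?B = "\<lambda>(i, r). {x \<in> S. d (q i) x < real_of_rat r}"
        let ?I = "{p. ?B p \<subseteq> U}"
        have B: "?B p \<in> sigma_sets S ?G" for p
        proof -
          obtain i r where p: "p = (i, r)" by fastforce
          let ?n = "sum_encode (Inl (to_nat (i, r, True)))"
          have "?B p = S - (c ?n -` {0} \<inter> space M)"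
            by (auto simp: p c_rat rat_code_eq_0_iff side_def space_M)
          also have "\<dots> \<in> sigma_sets S ?G" by (intro sigma_sets.Compl sigma_sets.Basic) blast
          finally show ?thesis .
        qed
        have "U \<subseteq> (\<Union>p\<in>?I. ?B p)"
        proof
          fix x assume x: "x \<in> U"
          hence xS: "x \<in> S" using openin_subset[OF U] by auto
          obtain r where r: "r > 0" "mball x r \<subseteq> U" using U x by (auto simp: openin_mtopology)
          obtain s where s: "0 < real_of_rat s" "real_of_rat s < r / 2" using of_rat_dense[of 0 "r / 2"] r(1) by auto
          obtain i where i: "d (q i) x < real_of_rat s" using dense[OF xS s(1)] by blast
          have "?B (i, s) \<subseteq> mball x r"
          proof
            fix y assume "y \<in> ?B (i, s)"
            hence y: "y \<in> S" "d (q i) y < real_of_rat s" by auto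
            have "d x y \<le> d x (q i) + d (q i) y" using triangle xS qS y(1) by blast
            thus "y \<in> mball x r" using y xS i s commute[of x "q i"] by auto
          qed
          hence "(i, s) \<in> ?I" using r(2) by blast
          moreover have "x \<in> ?B (i, s)" using xS i by simp
          ultimately show "x \<in> (\<Union>p\<in>?I. ?B p)" by blast
        qed
        hence "U = (\<Union>p\<in>?I. ?B p)" by blast
        moreover have "(\<Union>p\<in>?I. ?B p) \<in> sigma_sets S ?G"
        proof -
          interpret sigma_algebra S "sigma_sets S ?G"
            by (rule sigma_algebra_sigma_sets) (auto simp: space_M)
          show ?thesis using B by (intro countable_UN'') auto
        qed
        ultimately show ?thesis by metis
      qed
      hence "sets M \<subseteq> sigma_sets S ?G"
        unfolding sets_M by (intro sigma_sets_mono) auto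
      moreover have "sigma_sets (space M) ?G \<subseteq> sets M"
        by (intro sets.sigma_sets_subset) auto
      ultimately show ?thesis unfolding generates_def space_M[symmetric] by blast
    qed
    ultimately show ?thesis by (rule that)
  qed
qed

text \<open>A coding that decides \<open>A\<close> embeds \<open>A\<close> into the real sequences.
  The image is closed: convergent integer coordinates are eventually constant, completeness supplies
  a point with the limiting code, and the deciding coordinate puts this point into \<open>A\<close>.
  The topology pulled back from the closed image is the required Polish one.\<close>

lemma standard_borel_restrict_space:
  assumes M: "standard_borel M" and A: "A \<in> sets M"
  shows "standard_borel (restrict_space M A)"
proof -
  obtain c0 where c0: "complete_coding M c0" "generates c0 M" using M by (rule standard_borel_coding)
  obtain c where c: "complete_coding M c" "finer c c0" "decides M c A"
    using complete_coding_refine1[OF c0 A] by blast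
  have AM: "A \<subseteq> space M" using sets.sets_into_space[OF A] .
  define \<phi> where "\<phi> x = (\<lambda>n. real (c n x))" for x
  have inj: "inj_on \<phi> A"
    using complete_codingD(2)[OF c(1)] AM by (auto simp: inj_on_def \<phi>_def fun_eq_iff)
  have closed: "closed (\<phi> ` A)" unfolding closed_sequential_limits
  proof (intro allI impI)
    fix y l assume *: "(\<forall>n. y n \<in> \<phi> ` A) \<and> y \<longlonglongrightarrow> l"
    define u where "u n = (SOME x. x \<in> A \<and> y n = \<phi> x)" for n
    have "u n \<in> A \<and> y n = \<phi> (u n)" for n
      unfolding u_def by (rule someI_ex) (use * in blast)
    hence u: "\<And>n. u n \<in> A" "\<And>n. y n = \<phi> (u n)" by auto
    have lim: "(\<lambda>n. real (c i (u n))) \<longlonglongrightarrow> l i" for i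
    proof -
      have "(\<lambda>n. y n i) \<longlonglongrightarrow> l i"
        by (rule continuous_on_tendsto_compose[OF continuous_on_product_coordinates conjunct2[OF *]]) simp_all
      thus ?thesis by (simp add: u(2) \<phi>_def)
    qed
    have "\<exists>a. (\<forall>\<^sub>F n in sequentially. c i (u n) = a) \<and> l i = real a" for i
    proof -
      have "\<forall>\<^sub>F n in sequentially. dist (real (c i (u n))) (l i) < 1 / 2"
        using lim by (rule tendstoD) simp
      then obtain N where N: "\<And>n. n \<ge> N \<Longrightarrow> dist (real (c i (u n))) (l i) < 1 / 2"
        by (auto simp: eventually_sequentially)
      have "c i (u n) = c i (u N)" if "n \<ge> N" for n
      proof -
        have "\<bar>real (c i (u n)) - real (c i (u N))\<bar> < 1"
          using N[OF that] N[OF order_refl] unfolding dist_real_def by linarith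
        thus ?thesis by linarith
      qed
      hence ev: "\<forall>\<^sub>F n in sequentially. c i (u n) = c i (u N)"
        unfolding eventually_sequentially by blast
      hence "(\<lambda>n. real (c i (u n))) \<longlonglongrightarrow> real (c i (u N))"
        by (intro tendsto_eventually) (auto simp: eventually_mono)
      thus ?thesis using ev LIMSEQ_unique[OF lim] by blast
    qed
    then obtain a where "\<forall>i. (\<forall>\<^sub>F n in sequentially. c i (u n) = a i) \<and> l i = real (a i)"
      using choice[of "\<lambda>i a. (\<forall>\<^sub>F n in sequentially. c i (u n) = a) \<and> l i = real a"] by blast
    hence a: "\<And>i. \<forall>\<^sub>F n in sequentially. c i (u n) = a i" "\<And>i. l i = real (a i)" by blast+
    have fin: "\<exists>x\<in>A. \<forall>i<n. c i x = a i" for n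
    proof -
      have "\<forall>\<^sub>F m in sequentially. \<forall>i\<in>{..<n}. c i (u m) = a i"
        by (rule eventually_ball_finite) (use a in auto)
      from eventually_happens'[OF sequentially_bot this] show ?thesis using u(1) by auto
    qed
    obtain x where x: "x \<in> space M" "\<And>i. c i x = a i"
      using complete_codingD(3)[OF c(1), of a] fin AM by (meson subsetD)
    obtain n K where A_eq: "A = {x \<in> space M. c n x \<in> K}" using c(3) by (auto simp: decides_def)
    obtain z where "z \<in> A" "c n z = a n" using fin[of "Suc n"] by auto
    hence "x \<in> A" using x A_eq by auto
    moreover have "\<phi> x = l" using x a(2) by (auto simp: \<phi>_def)
    ultimately show "l \<in> \<phi> ` A" by blast
  qed
  let ?X = "pullback_topology A \<phi> euclidean" and ?Y = "top_of_set (\<phi> ` A)"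
  have "homeomorphic_maps ?X ?Y \<phi> (inv_into A \<phi>)"
    unfolding homeomorphic_maps_def
  proof (intro conjI)
    show "continuous_map ?X ?Y \<phi>"
      unfolding continuous_map openin_pullback_topology topspace_pullback_topology
      by (auto simp: openin_open)
    show "continuous_map ?Y ?X (inv_into A \<phi>)"
    proof (rule continuous_map_pullback')
      show "continuous_map ?Y euclidean (\<phi> \<circ> inv_into A \<phi>)"
        by (rule continuous_map_eq[of _ _ id]) (auto simp: f_inv_into_f)
      show "topspace ?Y \<subseteq> inv_into A \<phi> -` A" by (auto intro: inv_into_into)
    qed
  qed (auto simp: topspace_pullback_topology inj f_inv_into_f)
  hence hom: "?X homeomorphic_space ?Y" by (auto simp: homeomorphic_space_def)
  have "completely_metrizable_space ?Y"
    using closed by (intro completely_metrizable_space_closedin completely_metrizable_space_euclidean) simp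
  hence 1: "completely_metrizable_space ?X" using homeomorphic_completely_metrizable_space[OF hom] by simp
  have "second_countable (euclidean :: (nat \<Rightarrow> real) topology)"
  proof -
    obtain B :: "(nat \<Rightarrow> real) set set" where B: "countable B" "topological_basis B"
      using ex_countable_basis by blast
    show ?thesis unfolding second_countable_def
    proof (intro exI[of _ B] conjI ballI allI impI)
      show "openin euclidean V" if "V \<in> B" for V
        using topological_basis_open[OF B(2) that] by simp
      fix U :: "(nat \<Rightarrow> real) set" and x assume U: "openin euclidean U \<and> x \<in> U"
      obtain V where "V \<in> B" "x \<in> V" "V \<subseteq> U"
        by (rule topological_basisE[OF B(2), of U x]) (use U in auto)
      thus "\<exists>V\<in>B. x \<in> V \<and> V \<subseteq> U" by blast
    qed (rule B(1))
  qed
  hence "second_countable ?Y" by (rule second_countable_subtopology)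
  hence 2: "second_countable ?X" using homeomorphic_space_second_countability[OF hom] by simp
  have "sets (restrict_space M A) = sigma_sets A {U. openin ?X U}"
  proof
    have "\<phi> \<in> borel_measurable M"
      unfolding \<phi>_def by (intro measurable_coordinatewise_then_product) (use complete_codingD(1)[OF c(1)] in measurable)
    hence "\<phi> -` U \<inter> A \<in> sets (restrict_space M A)" if "open U" for U
      using that A by (auto simp: sets_restrict_space intro!: image_eqI[of _ _ "\<phi> -` U \<inter> space M"] measurable_sets)
        (use AM in auto)
    hence "{U. openin ?X U} \<subseteq> sets (restrict_space M A)" by (auto simp: openin_pullback_topology)
    from sets.sigma_sets_subset[OF this] show "sigma_sets A {U. openin ?X U} \<subseteq> sets (restrict_space M A)"
      using AM by (simp add: space_restrict_space Int_absorb2)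
  next
    \<comment> \<open>The generating sets come from \<open>c0\<close>, which is known to generate;
      they are open for the pulled-back topology because the coordinates of \<open>c0\<close>
      reappear in \<open>c\<close>.\<close>
    let ?G = "{c0 n -` {k} \<inter> space M | n k. True}"
    have "sets (restrict_space M A) = (\<inter>) A ` sigma_sets (space M) ?G"
      using c0(2) by (simp only: sets_restrict_space generates_def)
    also have "\<dots> = sigma_sets A ((\<inter>) A ` ?G)"
      by (rule sigma_sets_Int) (use A c0(2) AM in \<open>simp_all only: generates_def\<close>)
    also have "\<dots> \<subseteq> sigma_sets A {U. openin ?X U}"
    proof (rule sigma_sets_mono, safe)
      fix n k
      obtain m where m: "c m = c0 n" using finer_ex[OF c(2)] by blast
      have "open {z :: nat \<Rightarrow> real. \<bar>z m - real k\<bar> < 1}"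
        by (intro open_Collect_less continuous_intros continuous_on_product_coordinates)
      moreover have "A \<inter> (c0 n -` {k} \<inter> space M) = \<phi> -` {z. \<bar>z m - real k\<bar> < 1} \<inter> A"
        using AM m[symmetric] by (auto simp: \<phi>_def)
      ultimately have "openin ?X (A \<inter> (c0 n -` {k} \<inter> space M))"
        unfolding openin_pullback_topology by auto
      thus "A \<inter> (c0 n -` {k} \<inter> space M) \<in> sigma_sets A (Collect (openin ?X))"
        by (intro sigma_sets.Basic) simp
    qed
    finally show "sets (restrict_space M A) \<subseteq> sigma_sets A {U. openin ?X U}" .
  qed
  thus ?thesis unfolding standard_borel_def using 1 2 AM
    by (intro exI[of _ ?X]) (simp add: topspace_pullback_topology space_restrict_space Int_absorb2)
qed

section \<open>Countable-to-one Borel maps\<close>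

text \<open>For fixed \<open>f\<close> these sets form a \<sigma>-ideal, the ideal of small sets in
  a perfect-set argument. \<open>A\<close> itself may be any set; only the covering sets are
  Borel.\<close>

definition sigma_injective :: "'a measure \<Rightarrow> ('a \<Rightarrow> 'b) \<Rightarrow> 'a set \<Rightarrow> bool" where
  "sigma_injective M f A \<longleftrightarrow>
     (\<exists>\<B>. countable \<B> \<and> (\<forall>B\<in>\<B>. B \<in> sets M \<and> inj_on f B) \<and> A \<subseteq> \<Union>\<B>)"

lemma sigma_injective_subset: "sigma_injective M f B \<Longrightarrow> A \<subseteq> B \<Longrightarrow> sigma_injective M f A"
  unfolding sigma_injective_def by (meson subset_trans)

lemma sigma_injective_inj: "A \<in> sets M \<Longrightarrow> inj_on f A \<Longrightarrow> sigma_injective M f A"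
  unfolding sigma_injective_def by (intro exI[of _ "{A}"]) auto

lemma sigma_injective_UN:
  assumes "countable I" "\<And>i. i \<in> I \<Longrightarrow> sigma_injective M f (A i)"
  shows "sigma_injective M f (\<Union>i\<in>I. A i)"
proof -
  define \<B> where "\<B> i = (SOME \<B>. countable \<B> \<and> (\<forall>B\<in>\<B>. B \<in> sets M \<and> inj_on f B) \<and> A i \<subseteq> \<Union>\<B>)" for i
  have *: "countable (\<B> i) \<and> (\<forall>B\<in>\<B> i. B \<in> sets M \<and> inj_on f B) \<and> A i \<subseteq> \<Union>(\<B> i)" if "i \<in> I" for i
    unfolding \<B>_def by (rule someI_ex) (use assms(2)[OF that] in \<open>simp add: sigma_injective_def\<close>)
  have \<B>: "\<And>i. i \<in> I \<Longrightarrow> countable (\<B> i)"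
    "\<And>i B. i \<in> I \<Longrightarrow> B \<in> \<B> i \<Longrightarrow> B \<in> sets M \<and> inj_on f B" "\<And>i. i \<in> I \<Longrightarrow> A i \<subseteq> \<Union>(\<B> i)"
    using * by simp_all
  have "countable (\<Union>i\<in>I. \<B> i)" using assms(1) \<B>(1) by (rule countable_UN)
  moreover have "\<forall>B\<in>(\<Union>i\<in>I. \<B> i). B \<in> sets M \<and> inj_on f B" using \<B>(2) by auto
  moreover have "(\<Union>i\<in>I. A i) \<subseteq> \<Union>(\<Union>i\<in>I. \<B> i)" using \<B>(3) by fastforce
  ultimately show ?thesis unfolding sigma_injective_def by (intro exI conjI)
qed

lemma sigma_injective_Un:
  assumes "sigma_injective M f A" "sigma_injective M f B"
  shows "sigma_injective M f (A \<union> B)"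
  using sigma_injective_UN[of "{A, B}" M f "\<lambda>X. X"] assms by auto

text \<open>A joint form of smallness: every point of the base is assigned to a member that is small
  above the assigned Borel set. For one Borel set it is \<sigma>-injectivity. For several members
  its negation ties them together over common base points, as needed for a tree whose branches all
  end in one fibre.\<close>

definition small_family :: "'a measure \<Rightarrow> 'b measure \<Rightarrow> ('a \<Rightarrow> 'b) \<Rightarrow> 'i set \<Rightarrow> ('i \<Rightarrow> 'a set) \<Rightarrow> bool" where
  "small_family M N f I A \<longleftrightarrow>
     (\<exists>W. (\<forall>i\<in>I. W i \<in> sets N \<and> sigma_injective M f (A i \<inter> f -` W i)) \<and> space N \<subseteq> (\<Union>i\<in>I. W i))"

definition cylinder :: "(nat \<Rightarrow> 'a \<Rightarrow> nat) \<Rightarrow> nat list \<Rightarrow> 'a set" where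
  "cylinder c u = {x. \<forall>i<length u. c i x = u ! i}"

lemma cylinder_sets:
  assumes "complete_coding M c" "A \<in> sets M" shows "A \<inter> cylinder c u \<in> sets M"
proof -
  have "A \<inter> cylinder c u = A \<inter> {x \<in> space M. \<forall>i\<in>{..<length u}. c i x = u ! i}"
    using sets.sets_into_space[OF assms(2)] by (auto simp: cylinder_def)
  moreover have "{x \<in> space M. \<forall>i\<in>{..<length u}. c i x = u ! i} \<in> sets M"
    using complete_codingD(1)[OF assms(1)] by measurable
  ultimately show ?thesis using assms(2) by simp
qed

text \<open>If every splitting were small, each of the countably many pairs of distinct words would
  give a Borel cover of the base. Base points covered by an old member for some pair go to that
  member, the rest to \<open>i\<close>. Above the rest, after removal of the countably many small
  pieces coming from \<open>j1\<close> and \<open>j2\<close>, the map is injective on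
  \<open>A i\<close>: two points of one fibre have distinct prefixes, and the cover for this pair
  would have removed one of them.\<close>

lemma small_family_split:
  assumes c: "complete_coding M c" and f: "f \<in> M \<rightarrow>\<^sub>M N" and fin: "finite I" and i: "i \<in> I"
    and A: "\<And>k. k \<in> I \<Longrightarrow> A k \<in> sets M"
    and j: "j1 \<notin> I - {i}" "j2 \<notin> I - {i}" "j1 \<noteq> j2"
    and big: "\<not> small_family M N f I A"
  shows "\<exists>u v. length u = length v \<and> n \<le> length u \<and> u \<noteq> v \<and>
    \<not> small_family M N f (insert j1 (insert j2 (I - {i})))
        (A(j1 := A i \<inter> cylinder c u, j2 := A i \<inter> cylinder c v))"
proof (rule ccontr)
  assume contra: "\<not> ?thesis"
  define P where "P = {(u :: nat list, v :: nat list). length u = length v \<and> n \<le> length u \<and> u \<noteq> v}"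
  have cP: "countable P" by simp
  let ?J = "I - {i}"
  let ?A = "\<lambda>p. A(j1 := A i \<inter> cylinder c (fst p), j2 := A i \<inter> cylinder c (snd p))"
  have "\<forall>p\<in>P. small_family M N f (insert j1 (insert j2 ?J)) (?A p)"
    using contra by (auto simp: P_def)
  from bchoice[OF this[unfolded small_family_def]] obtain W where
    W0: "\<forall>p\<in>P. (\<forall>k\<in>insert j1 (insert j2 ?J).
          W p k \<in> sets N \<and> sigma_injective M f (?A p k \<inter> f -` W p k)) \<and>
        space N \<subseteq> (\<Union>k\<in>insert j1 (insert j2 ?J). W p k)" by (rule exE)
  have W: "W p k \<in> sets N \<and> sigma_injective M f (?A p k \<inter> f -` W p k)"
    if "p \<in> P" "k \<in> insert j1 (insert j2 ?J)" for p k
    using bspec[OF conjunct1[OF bspec[OF W0 that(1)]] that(2)] .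
  have Wcover: "space N \<subseteq> (\<Union>k\<in>insert j1 (insert j2 ?J). W p k)" if "p \<in> P" for p
    using conjunct2[OF bspec[OF W0 that]] .
  have W1: "W p j1 \<in> sets N" "sigma_injective M f (A i \<inter> cylinder c (fst p) \<inter> f -` W p j1)" if "p \<in> P" for p
    using W[OF that, of j1] j by auto
  have W2: "W p j2 \<in> sets N" "sigma_injective M f (A i \<inter> cylinder c (snd p) \<inter> f -` W p j2)" if "p \<in> P" for p
    using W[OF that, of j2] j by auto
  have WJ: "W p k \<in> sets N" "sigma_injective M f (A k \<inter> f -` W p k)" if "p \<in> P" "k \<in> ?J" for p k
    using W[OF that(1), of k] that j by (auto simp: fun_upd_def split: if_splits)
  define V where "V k = (if k = i then space N - (\<Union>k\<in>?J. \<Union>p\<in>P. W p k) else (\<Union>p\<in>P. W p k))" for k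
  have VJ: "V k \<in> sets N" "sigma_injective M f (A k \<inter> f -` V k)" if "k \<in> ?J" for k
  proof -
    have V: "V k = (\<Union>p\<in>P. W p k)" using that by (simp add: V_def)
    show "V k \<in> sets N" unfolding V by (intro sets.countable_UN'' cP WJ(1) that)
    have "sigma_injective M f (\<Union>p\<in>P. A k \<inter> f -` W p k)"
      by (intro sigma_injective_UN cP WJ(2) that)
    thus "sigma_injective M f (A k \<inter> f -` V k)"
      by (rule sigma_injective_subset) (auto simp: V)
  qed
  have Vi: "V i \<in> sets N"
  proof -
    have "(\<Union>k\<in>?J. \<Union>p\<in>P. W p k) \<in> sets N"
      by (intro sets.countable_UN'' cP WJ(1)) (use fin in \<open>auto intro: countable_finite\<close>)
    thus ?thesis by (simp add: V_def)
  qed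
  let ?X = "\<Union>p\<in>P. (A i \<inter> cylinder c (fst p) \<inter> f -` W p j1) \<union> (A i \<inter> cylinder c (snd p) \<inter> f -` W p j2)"
  have X: "sigma_injective M f ?X"
    by (intro sigma_injective_UN cP sigma_injective_Un W1 W2)
  have piece: "A i \<inter> cylinder c u \<inter> f -` Y \<in> sets M" if "Y \<in> sets N" for u Y
  proof -
    have "f -` Y \<inter> space M \<in> sets M" using f that by (rule measurable_sets)
    hence "(A i \<inter> cylinder c u) \<inter> (f -` Y \<inter> space M) \<in> sets M"
      using cylinder_sets[OF c A[OF i]] by blast
    moreover have "A i \<subseteq> space M" using sets.sets_into_space[OF A[OF i]] .
    moreover from this have "(A i \<inter> cylinder c u) \<inter> (f -` Y \<inter> space M) = A i \<inter> cylinder c u \<inter> f -` Y" by blast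
    ultimately show ?thesis by simp
  qed
  have Xs: "?X \<in> sets M"
    by (intro sets.countable_UN'' cP sets.Un piece W1 W2)
  let ?R = "(A i \<inter> cylinder c [] \<inter> f -` V i) - ?X"
  have "?R \<in> sets M" using piece[OF Vi] Xs by blast
  moreover have "inj_on f ?R"
  proof (rule inj_onI, rule ccontr)
    fix x y assume x: "x \<in> ?R" and y: "y \<in> ?R" and eq: "f x = f y" and ne: "x \<noteq> y"
    have xy: "x \<in> space M" "y \<in> space M" using x y sets.sets_into_space[OF A[OF i]] by auto
    obtain m where m: "c m x \<noteq> c m y" using complete_codingD(2)[OF c xy] ne by blast
    \<comment> \<open>The length meets the lower bound \<open>n\<close> and reaches past the
      coordinate \<open>m\<close> where the two codes differ.\<close>
    define u v where "u = map (\<lambda>k. c k x) [0..<n + Suc m]" and "v = map (\<lambda>k. c k y) [0..<n + Suc m]"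
    have "u ! m \<noteq> v ! m" using m by (simp add: u_def v_def del: upt_Suc)
    hence uv: "(u, v) \<in> P" by (auto simp: P_def u_def v_def simp del: upt_Suc)
    have xu: "x \<in> cylinder c u" and yv: "y \<in> cylinder c v"
      by (auto simp: cylinder_def u_def v_def simp del: upt_Suc)
    have "f x \<in> V i" using x by auto
    hence "f x \<in> space N" "\<And>k. k \<in> ?J \<Longrightarrow> f x \<notin> W (u, v) k"
      using uv by (auto simp: V_def)
    hence "f x \<in> W (u, v) j1 \<or> f x \<in> W (u, v) j2" using Wcover[OF uv] by blast
    moreover have "f x \<notin> W (u, v) j1"
    proof
      assume "f x \<in> W (u, v) j1"
      hence "x \<in> ?X" using x xu by (intro UN_I[OF uv]) auto
      thus False using x by blast
    qed
    moreover have "f x \<notin> W (u, v) j2"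
    proof
      assume "f x \<in> W (u, v) j2"
      hence "y \<in> ?X" using y yv eq by (intro UN_I[OF uv]) auto
      thus False using y by blast
    qed
    ultimately show False by blast
  qed
  ultimately have "sigma_injective M f (?R \<union> ?X)"
    by (intro sigma_injective_Un sigma_injective_inj X)
  hence "sigma_injective M f (A i \<inter> f -` V i)"
    by (rule sigma_injective_subset) (auto simp: cylinder_def)
  hence "\<forall>k\<in>I. V k \<in> sets N \<and> sigma_injective M f (A k \<inter> f -` V k)"
    using Vi VJ by blast
  moreover have "space N \<subseteq> (\<Union>k\<in>I. V k)"
  proof
    fix y assume y: "y \<in> space N"
    show "y \<in> (\<Union>k\<in>I. V k)"
    proof (cases "y \<in> V i")
      case False
      then obtain k p where "k \<in> ?J" "p \<in> P" "y \<in> W p k" using y by (auto simp: V_def)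
      hence "k \<in> I" "y \<in> V k" by (auto simp: V_def)
      thus ?thesis by blast
    qed (use i in blast)
  qed
  ultimately have "small_family M N f I A" unfolding small_family_def by blast
  thus False using big by blast
qed

definition words :: "nat \<Rightarrow> bool list set" where "words n = {s. length s = n}"

lemma finite_words: "finite (words n)"
  using finite_lists_length_eq[of "UNIV :: bool set" n] by (simp add: words_def)

lemma words_Suc: "words (Suc n) = (\<lambda>s. True # s) ` words n \<union> (\<lambda>s. False # s) ` words n"
proof -
  have "s \<in> words (Suc n) \<longleftrightarrow> s \<in> (\<lambda>s. True # s) ` words n \<union> (\<lambda>s. False # s) ` words n" for s
    by (cases s; cases "hd s") (auto simp: words_def image_iff)
  thus ?thesis by blast
qed

text \<open>One level of the tree. Members are split one at a time, since non-smallness concerns the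
  whole family and must be preserved at each single splitting; \<open>m\<close> is the length of the
  code prefix that becomes constant on every new member.\<close>

lemma small_family_split_all:
  assumes c: "complete_coding M c" and f: "f \<in> M \<rightarrow>\<^sub>M N"
    and A: "\<And>s. s \<in> words n \<Longrightarrow> A s \<in> sets M"
    and big: "\<not> small_family M N f (words n) A"
  shows "\<exists>A'. (\<forall>s\<in>words (Suc n). A' s \<in> sets M) \<and> \<not> small_family M N f (words (Suc n)) A' \<and>
    (\<forall>s\<in>words n. (\<exists>i. \<forall>x\<in>A' (True # s). \<forall>y\<in>A' (False # s). c i x \<noteq> c i y) \<and>
      (\<forall>b. A' (b # s) \<subseteq> A s \<and> (\<forall>x\<in>A' (b # s). \<forall>y\<in>A' (b # s). \<forall>i<m. c i x = c i y)))"
proof -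
  \<comment> \<open>Index set of an intermediate stage: words in \<open>J\<close> have been replaced
    by their two children, the others still wait.\<close>
  let ?I = "\<lambda>J. (words n - J) \<union> ((\<lambda>s. True # s) ` J \<union> (\<lambda>s. False # s) ` J)"
  let ?Q = "\<lambda>J A'. (\<forall>s\<in>?I J. A' s \<in> sets M) \<and> \<not> small_family M N f (?I J) A' \<and>
    (\<forall>s\<in>words n - J. A' s = A s) \<and>
    (\<forall>s\<in>J. (\<exists>i. \<forall>x\<in>A' (True # s). \<forall>y\<in>A' (False # s). c i x \<noteq> c i y) \<and>
      (\<forall>b. A' (b # s) \<subseteq> A s \<and> (\<forall>x\<in>A' (b # s). \<forall>y\<in>A' (b # s). \<forall>i<m. c i x = c i y)))"
  have "\<exists>A'. ?Q J A'" if "J \<subseteq> words n" for J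
    using finite_subset[OF that finite_words] that
  proof (induction J rule: finite_induct)
    case empty
    show ?case using A big by (intro exI[of _ A]) auto
  next
    case (insert s J)
    then obtain A' where A': "?Q J A'" by auto
    have s: "s \<in> ?I J" "s \<in> words n - J" using insert by auto
    have len: "length s = n" "\<And>t. t \<in> J \<Longrightarrow> length t = n" using insert(4) by (auto simp: words_def)
    have new: "True # s \<notin> ?I J - {s}" "False # s \<notin> ?I J - {s}" "True # s \<noteq> False # s"
      using len insert(2) by (auto simp: words_def)
    have finI: "finite (?I J)" using finite_words insert(1) by simp
    have sA: "A' k \<in> sets M" if "k \<in> ?I J" for k using A' that by simp
    have big': "\<not> small_family M N f (?I J) A'" using A' by simp
    have "\<exists>u v. length u = length v \<and> m \<le> length u \<and> u \<noteq> v \<and>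
      \<not> small_family M N f (insert (True # s) (insert (False # s) (?I J - {s})))
        (A'(True # s := A' s \<inter> cylinder c u, False # s := A' s \<inter> cylinder c v))"
      by (rule small_family_split[OF c f finI s(1) _ new big']) (rule sA)
    then obtain u v where uv: "length u = length v" "m \<le> length u" "u \<noteq> v"
      "\<not> small_family M N f (insert (True # s) (insert (False # s) (?I J - {s})))
        (A'(True # s := A' s \<inter> cylinder c u, False # s := A' s \<inter> cylinder c v))"
      by (elim exE conjE)
    let ?B = "A'(True # s := A' s \<inter> cylinder c u, False # s := A' s \<inter> cylinder c v)"
    have I_eq: "insert (True # s) (insert (False # s) (?I J - {s})) = ?I (insert s J)"
    proof -
      have "s \<notin> (\<lambda>s. True # s) ` J \<union> (\<lambda>s. False # s) ` J"
        using len by (metis Un_iff imageE length_Cons n_not_Suc_n)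
      hence "?I J - {s} = (words n - insert s J) \<union> ((\<lambda>s. True # s) ` J \<union> (\<lambda>s. False # s) ` J)" by blast
      thus ?thesis by (simp add: Un_insert_left Un_insert_right insert_commute)
    qed
    have AsA: "A' s = A s" using A' s by blast
    have B: "?B (True # s) = A s \<inter> cylinder c u" "?B (False # s) = A s \<inter> cylinder c v"
      using AsA by simp_all
    have disj: "\<exists>i. \<forall>x\<in>cylinder c u. \<forall>y\<in>cylinder c v. c i x \<noteq> c i y"
    proof -
      obtain i where "i < length u" "u ! i \<noteq> v ! i" using uv(1,3) by (auto simp: list_eq_iff_nth_eq)
      thus ?thesis using uv(1) by (intro exI[of _ i]) (auto simp: cylinder_def)
    qed
    have old: "?B t = A' t" if "t \<noteq> True # s" "t \<noteq> False # s" for t using that by simp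
    have "?Q (insert s J) ?B"
    proof (intro conjI ballI)
      show "\<not> small_family M N f (?I (insert s J)) ?B" using uv(4) I_eq by simp
      show "?B t \<in> sets M" if "t \<in> ?I (insert s J)" for t
      proof -
        consider "t = True # s" | "t = False # s" | "t \<in> ?I J - {s}" "t \<noteq> True # s" "t \<noteq> False # s"
        proof -
          have "t \<in> insert (True # s) (insert (False # s) (?I J - {s}))" using \<open>t \<in> ?I (insert s J)\<close> I_eq by simp
          thus thesis using that by blast
        qed
        thus ?thesis
        proof cases
          case 3
          thus ?thesis using A' by simp
        qed (use A cylinder_sets[OF c] s AsA in auto)
      qed
      show "?B t = A t" if "t \<in> words n - insert s J" for t
      proof -
        have "length t = n" using that by (simp add: words_def)
        hence "?B t = A' t" using len(1) by (intro old) auto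
        thus ?thesis using that A' by simp
      qed
      fix t assume t: "t \<in> insert s J"
      show "\<exists>i. \<forall>x\<in>?B (True # t). \<forall>y\<in>?B (False # t). c i x \<noteq> c i y"
      proof (cases "t = s")
        case True
        thus ?thesis using B disj by blast
      next
        case False
        hence "?B (b # t) = A' (b # t)" for b by simp
        thus ?thesis using A' t False by (metis insertE)
      qed
      show "\<forall>b. ?B (b # t) \<subseteq> A t \<and> (\<forall>x\<in>?B (b # t). \<forall>y\<in>?B (b # t). \<forall>i<m. c i x = c i y)"
      proof (cases "t = s")
        case True
        have "?B (b # s) \<subseteq> A s \<and> (\<forall>x\<in>?B (b # s). \<forall>y\<in>?B (b # s). \<forall>i<m. c i x = c i y)" for b
          using B uv(1,2) by (cases b) (auto simp: cylinder_def)
        thus ?thesis using True by blast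
      next
        case False
        hence "?B (b # t) = A' (b # t)" for b by simp
        thus ?thesis using A' t False by (metis insertE)
      qed
    qed
    thus ?case by (rule exI[of _ ?B])
  qed
  from this[OF order_refl] show ?thesis unfolding words_Suc by auto
qed

text \<open>
  The members of a family that is not small are nonempty, and no Borel set separates the images of
  two of them. Hence repeated splitting produces a binary tree whose branches are distinct points
  with the same image.
\<close>

theorem countable_to_one_imp_sigma_injective:
  assumes M: "standard_borel M" and f: "f \<in> M \<rightarrow>\<^sub>M N"
    and D: "\<And>k::nat. D k \<in> sets N" "\<And>y z. y \<in> space N \<Longrightarrow> z \<in> space N \<Longrightarrow> (\<And>k. y \<in> D k \<longleftrightarrow> z \<in> D k) \<Longrightarrow> y = z"
    and countable: "\<And>y. y \<in> space N \<Longrightarrow> countable {x \<in> space M. f x = y}"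
  shows "sigma_injective M f (space M)"
proof (rule ccontr)
  assume not: "\<not> ?thesis"
  obtain c0 where c0: "complete_coding M c0" "generates c0 M" using M by (rule standard_borel_coding)
  obtain c where c: "complete_coding M c" "\<And>k. decides M c (f -` D k \<inter> space M)"
    by (rule complete_coding_refine[OF c0, of "\<lambda>k. f -` D k \<inter> space M"]) (use measurable_sets[OF f D(1)] in auto)
  define good where "good n A \<longleftrightarrow> (\<forall>s\<in>words n. A s \<in> sets M) \<and> \<not> small_family M N f (words n) A" for n A
  \<comment> \<open>The difference in one coordinate keeps the branches apart; constancy of the
    first \<open>n\<close> coordinates makes each branch converge to a point.\<close>
  define ref where "ref n A A' \<longleftrightarrow> (\<forall>s\<in>words n. (\<exists>i. \<forall>x\<in>A' (True # s). \<forall>y\<in>A' (False # s). c i x \<noteq> c i y) \<and>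
      (\<forall>b. A' (b # s) \<subseteq> A s \<and> (\<forall>x\<in>A' (b # s). \<forall>y\<in>A' (b # s). \<forall>i<n. c i x = c i y)))" for n A A'
  have "\<exists>A. \<forall>n. good n (A n) \<and> ref n (A n) (A (Suc n))"
  proof (rule dependent_nat_choice)
    have w0: "words 0 = {[]}" by (auto simp: words_def)
    have "\<not> small_family M N f (words 0) (\<lambda>s. space M)"
    proof
      assume "small_family M N f (words 0) (\<lambda>s. space M)"
      then obtain W where "sigma_injective M f (space M \<inter> f -` W [])" "space N \<subseteq> W []"
        by (auto simp: small_family_def w0)
      moreover have "space M \<subseteq> f -` space N" using measurable_space[OF f] by auto
      ultimately show False using not by (metis inf.absorb1 order_trans vimage_mono)
    qed
    thus "\<exists>A. good 0 A" unfolding good_def by (intro exI[of _ "\<lambda>s. space M"]) auto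
    fix A n assume "good n A"
    thus "\<exists>A'. good (Suc n) A' \<and> ref n A A'"
      using small_family_split_all[OF c(1) f, of n A n] unfolding good_def ref_def by blast
  qed
  then obtain A where A: "\<And>n. good n (A n)" "\<And>n. ref n (A n) (A (Suc n))" by blast
  \<comment> \<open>The word is reversed because children arise by prepending a letter.\<close>
  define br :: "(nat \<Rightarrow> bool) \<Rightarrow> nat \<Rightarrow> bool list" where "br \<alpha> n = rev (map \<alpha> [0..<n])" for \<alpha> n
  have br_Suc: "br \<alpha> (Suc n) = \<alpha> n # br \<alpha> n" for \<alpha> n by (simp add: br_def)
  have br_words: "br \<alpha> n \<in> words n" for \<alpha> n by (simp add: br_def words_def)
  have sub: "A (Suc n) (br \<alpha> (Suc n)) \<subseteq> A n (br \<alpha> n)" for \<alpha> n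
    using A(2)[of n] br_words unfolding ref_def br_Suc by blast
  have mono: "A n (br \<alpha> n) \<subseteq> A m (br \<alpha> m)" if "m \<le> n" for m n \<alpha>
    using lift_Suc_antimono_le[of "\<lambda>n. A n (br \<alpha> n)", OF sub that] .
  have const: "c i x = c i y" if "x \<in> A n (br \<alpha> n)" "y \<in> A n (br \<alpha> n)" "i < n - 1" for i x y n \<alpha>
  proof -
    have k: "n = Suc (n - 1)" using that(3) by simp
    let ?k = "n - 1"
    show ?thesis using A(2)[of ?k] br_words[of \<alpha> ?k] that br_Suc[of \<alpha> ?k] k[symmetric]
      unfolding ref_def by (metis (no_types, lifting))
  qed
  have AM: "A n (br \<alpha> n) \<subseteq> space M" for n \<alpha>
    using A(1)[of n] br_words sets.sets_into_space unfolding good_def by blast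
  have nonempty: "A n (br \<alpha> n) \<noteq> {}" for n \<alpha>
  proof
    assume empty: "A n (br \<alpha> n) = {}"
    have "small_family M N f (words n) (A n)" unfolding small_family_def
      by (intro exI[of _ "\<lambda>s. if s = br \<alpha> n then space N else {}"])
        (use empty br_words in \<open>auto intro!: sigma_injective_inj\<close>)
    thus False using A(1) by (auto simp: good_def)
  qed
  have "\<exists>x\<in>space M. \<forall>n. \<forall>i<n. \<forall>z\<in>A (Suc n) (br \<alpha> (Suc n)). c i z = c i x" for \<alpha>
  proof -
    define p where "p n = (SOME x. x \<in> A n (br \<alpha> n))" for n
    have p: "p n \<in> A n (br \<alpha> n)" for n using nonempty[of n \<alpha>] some_in_eq unfolding p_def by blast
    define a where "a i = c i (p (Suc (Suc i)))" for i
    have z: "c i z = a i" if "i < n" "z \<in> A (Suc n) (br \<alpha> (Suc n))" for i n z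
    proof -
      have "z \<in> A (Suc (Suc i)) (br \<alpha> (Suc (Suc i)))" using mono[of "Suc (Suc i)" "Suc n" \<alpha>] that by auto
      thus ?thesis unfolding a_def using const[OF _ p] by simp
    qed
    have "\<exists>x\<in>space M. \<forall>i<n. c i x = a i" for n
      using p[of "Suc n"] z[of _ n "p (Suc n)"] AM by blast
    from complete_codingD(3)[OF c(1) this] show ?thesis using z by metis
  qed
  then obtain x where x: "\<And>\<alpha>. x \<alpha> \<in> space M"
    "\<And>\<alpha> n i z. i < n \<Longrightarrow> z \<in> A (Suc n) (br \<alpha> (Suc n)) \<Longrightarrow> c i z = c i (x \<alpha>)" by metis
  have inj: "inj x"
  proof (rule injI, rule ccontr)
    fix \<alpha> \<beta> assume eq: "x \<alpha> = x \<beta>" and "\<alpha> \<noteq> \<beta>"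
    hence "\<exists>n. \<alpha> n \<noteq> \<beta> n" by auto
    then obtain n where n: "\<alpha> n \<noteq> \<beta> n" "\<And>m. m < n \<Longrightarrow> \<alpha> m = \<beta> m"
      using exists_least_iff[of "\<lambda>n. \<alpha> n \<noteq> \<beta> n"] by auto
    have br_eq: "br \<alpha> n = br \<beta> n" using n(2) by (simp add: br_def)
    obtain i where i: "\<forall>y\<in>A (Suc n) (True # br \<alpha> n). \<forall>z\<in>A (Suc n) (False # br \<alpha> n). c i y \<noteq> c i z"
      using A(2)[of n] br_words[of \<alpha> n] unfolding ref_def by blast
    let ?N = "Suc (max n (Suc i))"
    obtain y z where yz: "y \<in> A ?N (br \<alpha> ?N)" "z \<in> A ?N (br \<beta> ?N)" using nonempty by blast
    have "c i y = c i z" using x(2)[OF _ yz(1), of i] x(2)[OF _ yz(2), of i] eq by simp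
    moreover have "y \<in> A (Suc n) (\<alpha> n # br \<alpha> n)" "z \<in> A (Suc n) (\<beta> n # br \<alpha> n)"
      using yz mono[of "Suc n" ?N \<alpha>] mono[of "Suc n" ?N \<beta>] unfolding br_Suc br_eq by auto
    ultimately show False using i n(1) by (cases "\<alpha> n"; cases "\<beta> n") (simp_all, metis+)
  qed
  \<comment> \<open>Membership of \<open>f z\<close> in \<open>D k\<close> depends on a single
    coordinate of \<open>z\<close>, so deep enough in the tree each member is mapped entirely to one
    side of \<open>D k\<close>.\<close>
  have fibre: "f (x \<alpha>) = f (x \<beta>)" for \<alpha> \<beta>
  proof (rule D(2))
    show "f (x \<alpha>) \<in> space N" "f (x \<beta>) \<in> space N" using measurable_space[OF f x(1)] by auto
    fix k
    obtain n K where nK: "f -` D k \<inter> space M = {y \<in> space M. c n y \<in> K}"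
      using c(2)[of k] by (auto simp: decides_def)
    have in_D: "f z \<in> D k \<longleftrightarrow> f (x \<alpha>) \<in> D k" if "z \<in> A (Suc (Suc n)) (br \<alpha> (Suc (Suc n)))" for z \<alpha>
    proof -
      have "z \<in> space M" using that AM by blast
      hence "f z \<in> D k \<longleftrightarrow> c n z \<in> K" "f (x \<alpha>) \<in> D k \<longleftrightarrow> c n (x \<alpha>) \<in> K" using nK x(1)[of \<alpha>] by blast+
      thus ?thesis using x(2)[OF _ that, of n] by simp
    qed
    show "f (x \<alpha>) \<in> D k \<longleftrightarrow> f (x \<beta>) \<in> D k"
    proof (rule ccontr)
      assume neq: "\<not> ?thesis"
      let ?n = "Suc (Suc n)"
      \<comment> \<open>Each of the two members receives the side of \<open>D k\<close> that its
        image avoids. These sides are complementary, so the family would be small with empty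
        pieces.\<close>
      define W where "W s = (if s = br \<alpha> ?n then (if f (x \<alpha>) \<in> D k then space N - D k else D k)
        else if s = br \<beta> ?n then (if f (x \<beta>) \<in> D k then space N - D k else D k) else {})" for s
      have ne: "br \<alpha> ?n \<noteq> br \<beta> ?n"
        using in_D[of _ \<alpha>] in_D[of _ \<beta>] neq nonempty[of ?n \<alpha>] by (metis ex_in_conv)
      have "W s \<in> sets N \<and> A ?n s \<inter> f -` W s = {}" for s
        using in_D[of _ \<alpha>] in_D[of _ \<beta>] D(1)[of k] by (auto simp: W_def split: if_splits)
      moreover have "space N \<subseteq> W (br \<alpha> ?n) \<union> W (br \<beta> ?n)"
        using neq ne by (auto simp: W_def)
      ultimately have "small_family M N f (words ?n) (A ?n)" unfolding small_family_def
      proof (intro exI[of _ W] conjI ballI)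
        show "W s \<in> sets N" "sigma_injective M f (A ?n s \<inter> f -` W s)" for s
          using \<open>\<And>s. W s \<in> sets N \<and> A ?n s \<inter> f -` W s = {}\<close>[of s]
          by (auto intro!: sigma_injective_inj)
        show "space N \<subseteq> (\<Union>s\<in>words ?n. W s)"
          using \<open>space N \<subseteq> W (br \<alpha> ?n) \<union> W (br \<beta> ?n)\<close> br_words[of \<alpha> ?n] br_words[of \<beta> ?n] by blast
      qed
      thus False using A(1) by (auto simp: good_def)
    qed
  qed
  let ?F = "{z \<in> space M. f z = f (x (\<lambda>_. True))}"
  have "range x \<subseteq> ?F" using x(1) fibre by blast
  moreover have "countable ?F" using measurable_space[OF f x(1)] by (rule countable)
  ultimately have "countable (range x)" by (rule countable_subset)
  hence "countable (UNIV :: (nat \<Rightarrow> bool) set)" using inj by (rule countable_image_inj_on)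
  then obtain e :: "nat \<Rightarrow> nat \<Rightarrow> bool" where e: "range e = UNIV"
    by (metis UNIV_not_empty range_from_nat_into)
  have "(\<lambda>n. \<not> e n n) \<in> range e" using e by simp
  then obtain m where "e m = (\<lambda>n. \<not> e n n)" by (metis imageE)
  from fun_cong[OF this, of m] show False by simp
qed

section \<open>Separation of disjoint images and Borel images of injective maps\<close>

definition separates_points :: "'b measure \<Rightarrow> (nat \<Rightarrow> 'b set) \<Rightarrow> bool" where
  "separates_points N D \<longleftrightarrow> range D \<subseteq> sets N \<and>
     (\<forall>y\<in>space N. \<forall>z\<in>space N. (\<forall>k. y \<in> D k \<longleftrightarrow> z \<in> D k) \<longrightarrow> y = z)"

lemma separates_pointsD:
  assumes "separates_points N D"
  shows "D k \<in> sets N" and "y \<in> space N \<Longrightarrow> z \<in> space N \<Longrightarrow> (\<And>k. y \<in> D k \<longleftrightarrow> z \<in> D k) \<Longrightarrow> y = z"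
  using assms unfolding separates_points_def by auto

lemma coding_deciding:
  assumes M: "standard_borel M" and f: "f \<in> M \<rightarrow>\<^sub>M N" and D: "separates_points N D"
    and F: "\<And>k::nat. F k \<in> sets M"
  obtains c where "complete_coding M c" "\<And>k. decides M c (F k)" "\<And>k. decides M c (f -` D k \<inter> space M)"
proof -
  obtain c0 where c0: "complete_coding M c0" "generates c0 M" using M by (rule standard_borel_coding)
  let ?H = "\<lambda>n. if even n then F (n div 2) else f -` D (n div 2) \<inter> space M"
  have H: "?H k \<in> sets M" for k using F measurable_sets[OF f separates_pointsD(1)[OF D]] by simp
  show ?thesis
  proof (rule complete_coding_refine[of M c0 ?H, OF c0 H])
    fix c assume c: "complete_coding M c" "\<And>k. decides M c (?H k)"
    show ?thesis using c(1) c(2)[of "2 * k" for k] c(2)[of "Suc (2 * k)" for k]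
      by (intro that[of c]) auto
  qed
qed

definition borel_separable :: "'b measure \<Rightarrow> 'b set \<Rightarrow> 'b set \<Rightarrow> bool" where
  "borel_separable N X Y \<longleftrightarrow> (\<exists>E\<in>sets N. X \<subseteq> E \<and> E \<inter> Y = {})"

lemma borel_separable_UN:
  assumes "\<And>(i::nat) (j::nat). borel_separable N (X i) (Y j)"
  shows "borel_separable N (\<Union>i. X i) (\<Union>j. Y j)"
proof -
  define E where "E i j = (SOME E. E \<in> sets N \<and> X i \<subseteq> E \<and> E \<inter> Y j = {})" for i j
  have E: "E i j \<in> sets N \<and> X i \<subseteq> E i j \<and> E i j \<inter> Y j = {}" for i j
    unfolding E_def by (rule someI_ex) (use assms[of i j] in \<open>auto simp: borel_separable_def\<close>)
  show ?thesis unfolding borel_separable_def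
  proof (intro bexI conjI)
    have "range (E i) \<subseteq> sets N" for i using E by blast
    hence "(\<Inter>j. E i j) \<in> sets N" for i by (rule sets.countable_INT) simp
    hence "range (\<lambda>i. \<Inter>j. E i j) \<subseteq> sets N" by blast
    thus "(\<Union>i. \<Inter>j. E i j) \<in> sets N" by (rule sets.countable_UN)
    show "(\<Union>i. X i) \<subseteq> (\<Union>i. \<Inter>j. E i j)" using E by blast
    show "(\<Union>i. \<Inter>j. E i j) \<inter> (\<Union>j. Y j) = {}" using E by blast
  qed
qed

text \<open>An inseparable pair contains, for each coordinate, an inseparable pair on which this
  coordinate is constant in both members. The codes obtained in this way define points
  \<open>x\<close> in \<open>A\<close> and \<open>y\<close> in \<open>B\<close>. Some
  \<open>D k\<close> separates their images and is decided by one coordinate, so \<open>D k\<close>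
  or its complement already separates the images at a finite stage.\<close>

lemma borel_separable_images:
  assumes M: "standard_borel M" and f: "f \<in> M \<rightarrow>\<^sub>M N" and D: "separates_points N D"
    and A: "A \<in> sets M" and B: "B \<in> sets M" and disj: "f ` A \<inter> f ` B = {}"
  shows "borel_separable N (f ` A) (f ` B)"
proof (rule ccontr)
  assume not: "\<not> ?thesis"
  obtain c where c: "complete_coding M c" "\<And>k. decides M c (if k = (0::nat) then A else B)"
      "\<And>k. decides M c (f -` D k \<inter> space M)"
    by (rule coding_deciding[OF M f D, of "\<lambda>k. if k = 0 then A else B"]) (use A B in auto)
  have AM: "A \<subseteq> space M" "B \<subseteq> space M" using A B sets.sets_into_space by auto
  have "\<exists>P. \<forall>n. (fst (P n) \<subseteq> A \<and> snd (P n) \<subseteq> B \<and> \<not> borel_separable N (f ` fst (P n)) (f ` snd (P n))) \<and>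
     (\<exists>k l. P (Suc n) = (fst (P n) \<inter> {x. c n x = k}, snd (P n) \<inter> {x. c n x = l}))"
  proof (rule dependent_nat_choice)
    show "\<exists>P. fst P \<subseteq> A \<and> snd P \<subseteq> B \<and> \<not> borel_separable N (f ` fst P) (f ` snd P)"
      using not by (intro exI[of _ "(A, B)"]) auto
    fix P n assume P: "fst P \<subseteq> A \<and> snd P \<subseteq> B \<and> \<not> borel_separable N (f ` fst P) (f ` snd P)"
    have eq: "f ` S = (\<Union>k. f ` (S \<inter> {x. c n x = k}))" for S by auto
    obtain k l where "\<not> borel_separable N (f ` (fst P \<inter> {x. c n x = k})) (f ` (snd P \<inter> {x. c n x = l}))"
    proof (rule ccontr)
      assume "\<not> thesis"
      hence "borel_separable N (\<Union>k. f ` (fst P \<inter> {x. c n x = k})) (\<Union>l. f ` (snd P \<inter> {x. c n x = l}))"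
        using that by (intro borel_separable_UN) blast
      thus False using P eq[of "fst P"] eq[of "snd P"] by simp
    qed
    thus "\<exists>P'. (fst P' \<subseteq> A \<and> snd P' \<subseteq> B \<and> \<not> borel_separable N (f ` fst P') (f ` snd P')) \<and>
        (\<exists>k l. P' = (fst P \<inter> {x. c n x = k}, snd P \<inter> {x. c n x = l}))"
      using P by (intro exI[of _ "(fst P \<inter> {x. c n x = k}, snd P \<inter> {x. c n x = l})"]) auto
  qed
  then obtain P where P: "\<And>n. fst (P n) \<subseteq> A" "\<And>n. snd (P n) \<subseteq> B"
      "\<And>n. \<not> borel_separable N (f ` fst (P n)) (f ` snd (P n))"
      "\<forall>n. \<exists>k l. P (Suc n) = (fst (P n) \<inter> {x. c n x = k}, snd (P n) \<inter> {x. c n x = l})"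
    by blast
  from P(4) obtain a b where ab: "\<And>n. P (Suc n) = (fst (P n) \<inter> {x. c n x = a n}, snd (P n) \<inter> {x. c n x = b n})"
    by metis
  have code: "(\<forall>x\<in>fst (P n). \<forall>i<n. c i x = a i) \<and> (\<forall>y\<in>snd (P n). \<forall>i<n. c i y = b i)" for n
    by (induction n) (auto simp: ab less_Suc_eq)
  have ne: "fst (P n) \<noteq> {}" "snd (P n) \<noteq> {}" for n
  proof -
    have "f ` fst (P n) \<subseteq> space N" using P(1)[of n] AM measurable_space[OF f] by blast
    thus "fst (P n) \<noteq> {}" "snd (P n) \<noteq> {}" using P(3)[of n] unfolding borel_separable_def by auto
  qed
  have "\<exists>x\<in>space M. \<forall>i<n. c i x = a i" for n using ne(1)[of n] code[of n] P(1)[of n] AM by blast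
  then obtain x where x: "x \<in> space M" "\<And>i. c i x = a i" using complete_codingD(3)[OF c(1)] by metis
  have "\<exists>x\<in>space M. \<forall>i<n. c i x = b i" for n using ne(2)[of n] code[of n] P(2)[of n] AM by blast
  then obtain y where y: "y \<in> space M" "\<And>i. c i y = b i" using complete_codingD(3)[OF c(1)] by metis
  obtain n K where nK: "A = {x \<in> space M. c n x \<in> K}" using c(2)[of 0] by (auto simp: decides_def)
  have xA: "x \<in> A" using ne(1)[of "Suc n"] code[of "Suc n"] P(1)[of "Suc n"] nK x by fastforce
  obtain m L where mL: "B = {x \<in> space M. c m x \<in> L}" using c(2)[of 1] by (auto simp: decides_def)
  have yB: "y \<in> B" using ne(2)[of "Suc m"] code[of "Suc m"] P(2)[of "Suc m"] mL y by fastforce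
  have "f x \<noteq> f y" using xA yB disj by blast
  then obtain k where k: "\<not> (f x \<in> D k \<longleftrightarrow> f y \<in> D k)"
    using separates_pointsD(2)[OF D] measurable_space[OF f] x(1) y(1) by blast
  obtain j J where jJ: "f -` D k \<inter> space M = {z \<in> space M. c j z \<in> J}" using c(3)[of k] by (auto simp: decides_def)
  have in_D: "f z \<in> D k \<longleftrightarrow> c j z \<in> J" if "z \<in> space M" for z using jJ that by blast
  have 1: "f z \<in> D k \<longleftrightarrow> f x \<in> D k" if "z \<in> fst (P (Suc j))" for z
    using that code[of "Suc j"] P(1)[of "Suc j"] AM in_D[of z] in_D[OF x(1)] x(2)[of j] by auto
  have 2: "f z \<in> D k \<longleftrightarrow> f y \<in> D k" if "z \<in> snd (P (Suc j))" for z
    using that code[of "Suc j"] P(2)[of "Suc j"] AM in_D[of z] in_D[OF y(1)] y(2)[of j] by auto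
  have "f ` fst (P (Suc j)) \<subseteq> space N" using P(1)[of "Suc j"] AM measurable_space[OF f] by blast
  hence "borel_separable N (f ` fst (P (Suc j))) (f ` snd (P (Suc j)))"
    using 1 2 k separates_pointsD(1)[OF D, of k] unfolding borel_separable_def
    by (intro bexI[of _ "if f x \<in> D k then D k else space N - D k"]) auto
  thus False using P(3) by blast
qed

text \<open>By injectivity, the images of {c n = k} and of its complement within \<open>A\<close>
  are disjoint; the sets \<open>E n k\<close> separating them read off the code of the preimage from
  a point of the image. It remains to say in Borel terms that the code read off from
  \<open>y\<close> belongs to a preimage of \<open>y\<close>.\<close>

lemma borel_image_inj:
  assumes M: "standard_borel M" and f: "f \<in> M \<rightarrow>\<^sub>M N" and D: "separates_points N D"
    and A: "A \<in> sets M" and inj: "inj_on f A"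
  shows "f ` A \<in> sets N"
proof -
  obtain c where c: "complete_coding M c" "\<And>k::nat. decides M c A"
      "\<And>k. decides M c (f -` D k \<inter> space M)"
    by (rule coding_deciding[OF M f D, of "\<lambda>k. A"]) (use A in auto)
  have AM: "A \<subseteq> space M" using A sets.sets_into_space by auto
  obtain m L where mL: "A = {x \<in> space M. c m x \<in> L}" using c(2) by (auto simp: decides_def)
  have "\<forall>k. \<exists>n K. f -` D k \<inter> space M = {x \<in> space M. c n x \<in> K}" using c(3) by (simp add: decides_def)
  then obtain \<nu> K where \<nu>: "\<And>k. f -` D k \<inter> space M = {x \<in> space M. c (\<nu> k) x \<in> K k}" by metis
  have in_D: "f z \<in> D k \<longleftrightarrow> c (\<nu> k) z \<in> K k" if "z \<in> space M" for z k using \<nu>[of k] that by blast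
  have "\<exists>E\<in>sets N. f ` (A \<inter> {x. c n x = k}) \<subseteq> E \<and> E \<inter> f ` (A \<inter> {x. c n x \<noteq> k}) = {}" for n k
  proof -
    have "A \<inter> {x. c n x = k} = A \<inter> {x \<in> space M. c n x \<in> {k}}"
      "A \<inter> {x. c n x \<noteq> k} = A \<inter> {x \<in> space M. c n x \<in> - {k}}" using AM by auto
    hence "A \<inter> {x. c n x = k} \<in> sets M" "A \<inter> {x. c n x \<noteq> k} \<in> sets M"
      by (simp_all only: sets.Int[OF A] sets_coordinate[OF c(1)])
    moreover have "f ` (A \<inter> {x. c n x = k}) \<inter> f ` (A \<inter> {x. c n x \<noteq> k}) = {}"
      using inj by (auto simp: inj_on_def)
    ultimately show ?thesis using borel_separable_images[OF M f D] unfolding borel_separable_def by blast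
  qed
  then obtain E where E: "\<And>n k. E n k \<in> sets N" "\<And>n k. f ` (A \<inter> {x. c n x = k}) \<subseteq> E n k"
      "\<And>n k. E n k \<inter> f ` (A \<inter> {x. c n x \<noteq> k}) = {}" by metis
  have E_iff: "f x \<in> E n k \<longleftrightarrow> c n x = k" if "x \<in> A" for x n k using E(2,3)[of n k] that by blast
  \<comment> \<open>The clauses say that \<open>y\<close> determines at least one code, that all
    prefixes of such a code occur in \<open>A\<close>, and that the code predicts for every
    \<open>D k\<close> whether \<open>y\<close> lies in it. Completeness then gives a point with
    this code, and the \<open>D k\<close> identify its image as \<open>y\<close>.\<close>
  define Q where "Q = {y \<in> space N. (\<forall>n. \<exists>k. y \<in> E n k) \<and>
      (\<forall>s. A \<inter> cylinder c s = {} \<longrightarrow> (\<exists>i\<in>{..<length s}. y \<notin> E i (s ! i))) \<and>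
      (\<forall>k j. y \<in> E (\<nu> k) j \<longrightarrow> (y \<in> D k \<longleftrightarrow> j \<in> K k))}"
  have "Q \<in> sets N"
  proof -
    note [measurable] = E(1) separates_pointsD(1)[OF D]
    show ?thesis unfolding Q_def by measurable
  qed
  moreover have "Q = f ` A"
  proof
    show "f ` A \<subseteq> Q"
    proof
      fix y assume "y \<in> f ` A"
      then obtain x where x: "x \<in> A" "y = f x" by blast
      have "\<exists>i\<in>{..<length s}. f x \<notin> E i (s ! i)" if "A \<inter> cylinder c s = {}" for s
        using that x(1) unfolding E_iff[OF x(1)] cylinder_def by auto
      moreover have "f x \<in> D k \<longleftrightarrow> j \<in> K k" if "f x \<in> E (\<nu> k) j" for k j
        using that x(1) AM E_iff[OF x(1)] in_D by auto
      moreover have "f x \<in> space N" using x(1) AM measurable_space[OF f] by blast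
      ultimately show "y \<in> Q" unfolding Q_def x(2) using E_iff[OF x(1)] by simp
    qed
    show "Q \<subseteq> f ` A"
    proof
      fix y assume y: "y \<in> Q"
      hence "\<forall>n. \<exists>k. y \<in> E n k" by (simp add: Q_def)
      then obtain a where a: "\<And>n. y \<in> E n (a n)" by metis
      have ne: "A \<inter> cylinder c (map a [0..<n]) \<noteq> {}" for n
      proof
        assume "A \<inter> cylinder c (map a [0..<n]) = {}"
        then obtain i where "i < n" "y \<notin> E i (map a [0..<n] ! i)" using y unfolding Q_def by force
        thus False using a by simp
      qed
      have prefix: "\<exists>x\<in>A. \<forall>i<n. c i x = a i" for n using ne[of n] by (fastforce simp: cylinder_def)
      obtain x where x: "x \<in> space M" "\<And>i. c i x = a i"
        using complete_codingD(3)[OF c(1), of a] prefix AM by (meson subsetD)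
      have xA: "x \<in> A" using prefix[of "Suc m"] x mL by auto
      have "f x = y"
      proof (rule separates_pointsD(2)[OF D])
        show "f x \<in> space N" using measurable_space[OF f x(1)] .
        show "y \<in> space N" using y by (simp add: Q_def)
        fix k
        have "y \<in> D k \<longleftrightarrow> a (\<nu> k) \<in> K k" using y a unfolding Q_def by blast
        thus "f x \<in> D k \<longleftrightarrow> y \<in> D k" using in_D[OF x(1)] x(2) by simp
      qed
      thus "y \<in> f ` A" using xA by blast
    qed
  qed
  ultimately show ?thesis by simp
qed

theorem countable_to_one_partition:
  assumes M: "standard_borel M" and f: "f \<in> M \<rightarrow>\<^sub>M N" and D: "separates_points N D"
    and countable: "\<And>y. y \<in> space N \<Longrightarrow> countable {x \<in> space M. f x = y}"
  obtains X :: "nat \<Rightarrow> 'a set" where "\<And>n. X n \<in> sets M" "\<And>n. inj_on f (X n)" "disjoint_family X"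
    "(\<Union>n. X n) = space M"
proof -
  have "sigma_injective M f (space M)"
    using countable_to_one_imp_sigma_injective[of M f N D, OF M f] separates_pointsD[OF D] countable by metis
  then obtain \<B> where \<B>: "countable \<B>" "\<And>B. B \<in> \<B> \<Longrightarrow> B \<in> sets M \<and> inj_on f B" "space M \<subseteq> \<Union>\<B>"
    unfolding sigma_injective_def by auto
  \<comment> \<open>The empty set is inserted so that there is something to enumerate even if the
    cover is empty.\<close>
  define e where "e = from_nat_into (insert {} \<B>)"
  have range_e: "range e = insert {} \<B>" unfolding e_def using \<B>(1) by (intro range_from_nat_into) auto
  have e: "e n \<in> sets M \<and> inj_on f (e n)" for n
    using range_e \<B>(2) by (metis empty_iff inj_on_empty insert_iff rangeI sets.empty_sets)
  show ?thesis
  proof (rule that[of "disjointed e"])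
    show "disjointed e n \<in> sets M" for n using e sets.range_disjointed_sets[of e M] by auto
    show "inj_on f (disjointed e n)" for n using e disjointed_subset by (metis inj_on_subset)
    show "disjoint_family (disjointed e)" by (rule disjoint_family_disjointed)
    have "(\<Union>n. e n) \<subseteq> space M" using e sets.sets_into_space by blast
    moreover have "space M \<subseteq> (\<Union>n. e n)" using \<B>(3) range_e by auto
    ultimately show "(\<Union>n. disjointed e n) = space M" unfolding UN_disjointed_eq by blast
  qed
qed

section \<open>Operators on square integrable functions\<close>

lemma bounded_operatorsD:
  assumes "T \<in> bounded_operators M"
  shows "\<xi> \<in> L2 M \<Longrightarrow> T \<xi> \<in> L2 M"
    and "\<xi> \<in> L2 M \<Longrightarrow> \<eta> \<in> L2 M \<Longrightarrow> T (L2_add M \<xi> \<eta>) = L2_add M (T \<xi>) (T \<eta>)"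
    and "\<xi> \<in> L2 M \<Longrightarrow> T (L2_scale M c \<xi>) = L2_scale M c (T \<xi>)"
    and "\<exists>K. \<forall>\<xi>\<in>L2 M. L2_norm M (T \<xi>) \<le> K * L2_norm M \<xi>"
  using assms unfolding bounded_operators_def by blast+

lemma commutant_bounded: "T \<in> commutant M S \<Longrightarrow> T \<in> bounded_operators M"
  by (simp add: commutant_def)

lemma commutantD: "T \<in> commutant M S \<Longrightarrow> A \<in> S \<Longrightarrow> \<xi> \<in> L2 M \<Longrightarrow> T (A \<xi>) = A (T \<xi>)"
  by (simp add: commutant_def)

lemma commutantI:
  assumes "T \<in> bounded_operators M"
    and "\<And>A f. A \<in> S \<Longrightarrow> f \<in> square_integrable M \<Longrightarrow> T (A (L2_class M f)) = A (T (L2_class M f))"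
  shows "T \<in> commutant M S"
  using assms by (auto simp: commutant_def L2_def)

lemma bicommutant_extensive:
  assumes "S \<subseteq> bounded_operators M" shows "S \<subseteq> commutant M (commutant M S)"
  using assms by (auto simp: commutant_def)

lemma commutant_antimono: "S \<subseteq> T \<Longrightarrow> commutant M T \<subseteq> commutant M S"
  by (auto simp: commutant_def)

lemma L2_cases:
  assumes "\<xi> \<in> L2 M" obtains f where "f \<in> square_integrable M" "\<xi> = L2_class M f"
  using assms by (auto simp: L2_def)

subsection \<open>Sums of operators\<close>

definition op_add :: "'a measure \<Rightarrow> 'a L2_operator \<Rightarrow> 'a L2_operator \<Rightarrow> 'a L2_operator" where
  "op_add M S T = restrict (\<lambda>\<xi>. L2_add M (S \<xi>) (T \<xi>)) (L2 M)"

text \<open>The factor 2 instead of the sharp 1 comes from \<open>cmod_add_square\<close> and from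
  rounding the square root of 2 up; it suffices for boundedness of a sum.\<close>

lemma L2_norm_add_le:
  assumes "\<xi> \<in> L2 M" "\<eta> \<in> L2 M"
  shows "L2_norm M (L2_add M \<xi> \<eta>) \<le> 2 * (L2_norm M \<xi> + L2_norm M \<eta>)"
proof -
  obtain f g where f: "f \<in> square_integrable M" "\<xi> = L2_class M f"
    and g: "g \<in> square_integrable M" "\<eta> = L2_class M g"
    using assms by (auto elim!: L2_cases)
  let ?n = "\<lambda>f. \<integral>x. (cmod (f x))\<^sup>2 \<partial>M"
  note fg = square_integrable_add[OF f(1) g(1)]
  have i: "integrable M (\<lambda>x. (cmod (f x))\<^sup>2)" "integrable M (\<lambda>x. (cmod (g x))\<^sup>2)"
    "integrable M (\<lambda>x. (cmod (f x + g x))\<^sup>2)"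
    using f(1) g(1) fg by (auto simp: square_integrable_def)
  have "?n (\<lambda>x. f x + g x) \<le> (\<integral>x. 2 * (cmod (f x))\<^sup>2 + 2 * (cmod (g x))\<^sup>2 \<partial>M)"
    using i cmod_add_square by (intro integral_mono) auto
  also have "\<dots> = 2 * (?n f + ?n g)" using i by simp
  finally have "sqrt (?n (\<lambda>x. f x + g x)) \<le> sqrt 2 * sqrt (?n f + ?n g)"
    by (simp flip: real_sqrt_mult)
  also have "\<dots> \<le> 2 * (sqrt (?n f) + sqrt (?n g))"
    by (intro mult_mono sqrt_add_le_add_sqrt real_le_lsqrt) auto
  finally have "sqrt (?n (\<lambda>x. f x + g x)) \<le> 2 * (sqrt (?n f) + sqrt (?n g))" .
  thus ?thesis using f g fg by (simp add: L2_add_class L2_norm_class)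
qed

lemma L2_add_in: "\<xi> \<in> L2 M \<Longrightarrow> \<eta> \<in> L2 M \<Longrightarrow> L2_add M \<xi> \<eta> \<in> L2 M"
  by (auto elim!: L2_cases simp: L2_add_class intro!: L2_class_in_L2 square_integrable_add)

lemma L2_scale_in: "\<xi> \<in> L2 M \<Longrightarrow> L2_scale M c \<xi> \<in> L2 M"
  by (auto elim!: L2_cases simp: L2_scale_class intro!: L2_class_in_L2 square_integrable_scale)

lemma L2_add_swap:
  assumes "a \<in> L2 M" "b \<in> L2 M" "c \<in> L2 M" "d \<in> L2 M"
  shows "L2_add M (L2_add M a b) (L2_add M c d) = L2_add M (L2_add M a c) (L2_add M b d)"
  using assms by (auto elim!: L2_cases simp: L2_add_class square_integrable_add algebra_simps)

lemma L2_scale_add: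
  assumes "a \<in> L2 M" "b \<in> L2 M"
  shows "L2_add M (L2_scale M c a) (L2_scale M c b) = L2_scale M c (L2_add M a b)"
  using assms by (auto elim!: L2_cases
    simp: L2_add_class L2_scale_class square_integrable_add square_integrable_scale algebra_simps)

lemma bounded_operators_add:
  assumes S: "S \<in> bounded_operators M" and T: "T \<in> bounded_operators M"
  shows "op_add M S T \<in> bounded_operators M"
proof -
  note S' = bounded_operatorsD[OF S] and T' = bounded_operatorsD[OF T]
  obtain K L where K: "\<And>\<xi>. \<xi> \<in> L2 M \<Longrightarrow> L2_norm M (S \<xi>) \<le> K * L2_norm M \<xi>"
    and L: "\<And>\<xi>. \<xi> \<in> L2 M \<Longrightarrow> L2_norm M (T \<xi>) \<le> L * L2_norm M \<xi>"
    using S'(4) T'(4) by blast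
  have "L2_norm M (op_add M S T \<xi>) \<le> (2 * (K + L)) * L2_norm M \<xi>" if "\<xi> \<in> L2 M" for \<xi>
    using L2_norm_add_le[OF S'(1)[OF that] T'(1)[OF that]] K[OF that] L[OF that] that
    by (simp add: op_add_def algebra_simps)
  moreover have "op_add M S T \<in> L2 M \<rightarrow>\<^sub>E L2 M"
    unfolding op_add_def by (auto intro!: L2_add_in S'(1) T'(1))
  ultimately show ?thesis unfolding bounded_operators_def
    by (auto simp: op_add_def L2_add_in L2_scale_in S' T' L2_add_swap L2_scale_add)
qed

lemma commutant_add:
  assumes A: "A \<subseteq> bounded_operators M" and "S \<in> commutant M A" "T \<in> commutant M A"
  shows "op_add M S T \<in> commutant M A"
proof -
  have "op_add M S T (C \<xi>) = C (op_add M S T \<xi>)" if C: "C \<in> A" and \<xi>: "\<xi> \<in> L2 M" for C \<xi>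
    using bounded_operatorsD(1,2)[of C M] A C \<xi> commutantD[OF assms(2) C \<xi>] commutantD[OF assms(3) C \<xi>]
      bounded_operatorsD(1)[OF commutant_bounded[OF assms(2)] \<xi>]
      bounded_operatorsD(1)[OF commutant_bounded[OF assms(3)] \<xi>]
    by (auto simp: op_add_def)
  moreover have "op_add M S T \<in> bounded_operators M"
    using assms(2,3) by (intro bounded_operators_add commutant_bounded)
  ultimately show ?thesis by (simp add: commutant_def)
qed

subsection \<open>Convergence in the mean\<close>

text \<open>Formulated for functions rather than classes, so that dominated convergence applies
  directly and representatives are compared only at the end.\<close>

definition L2_tendsto :: "'a measure \<Rightarrow> (nat \<Rightarrow> 'a \<Rightarrow> complex) \<Rightarrow> ('a \<Rightarrow> complex) \<Rightarrow> bool" where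
  "L2_tendsto M u f \<longleftrightarrow> (\<lambda>n. \<integral>x. (cmod (u n x - f x))\<^sup>2 \<partial>M) \<longlonglongrightarrow> 0"

lemma L2_tendsto_cong:
  assumes "\<And>n. u n \<in> borel_measurable N" "\<And>n. v n \<in> borel_measurable N" "f \<in> borel_measurable N"
    and "\<And>n. AE x in N. u n x = v n x" "L2_tendsto N u f"
  shows "L2_tendsto N v f"
proof -
  note [measurable] = assms(1-3)
  have "(\<integral>x. (cmod (v n x - f x))\<^sup>2 \<partial>N) = (\<integral>x. (cmod (u n x - f x))\<^sup>2 \<partial>N)" for n
    by (rule integral_cong_AE) (measurable, use assms(4)[of n] in eventually_elim, simp)
  thus ?thesis using assms(5) by (simp add: L2_tendsto_def)
qed

lemma square_integrable_measurable: "f \<in> square_integrable N \<Longrightarrow> f \<in> borel_measurable N"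
  by (simp add: square_integrable_def)

lemma L2_tendsto_unique:
  assumes sq: "\<And>n. u n \<in> square_integrable M" "f \<in> square_integrable M" "g \<in> square_integrable M"
    and lim: "L2_tendsto M u f" "L2_tendsto M u g"
  shows "AE x in M. f x = g x"
proof -
  let ?d = "\<lambda>f g. \<integral>x. (cmod (f x - g x))\<^sup>2 \<partial>M"
  have i: "integrable M (\<lambda>x. (cmod (a x - b x))\<^sup>2)"
    if "a \<in> square_integrable M" "b \<in> square_integrable M" for a b
    using square_integrable_diff[OF that] by (simp add: square_integrable_def)
  have bound: "?d f g \<le> 2 * ?d (u n) f + 2 * ?d (u n) g" for n
  proof -
    have "?d f g \<le> (\<integral>x. 2 * (cmod (u n x - f x))\<^sup>2 + 2 * (cmod (u n x - g x))\<^sup>2 \<partial>M)"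
    proof (intro integral_mono)
      show "(cmod (f x - g x))\<^sup>2 \<le> 2 * (cmod (u n x - f x))\<^sup>2 + 2 * (cmod (u n x - g x))\<^sup>2" for x
        using cmod_add_square[of "f x - u n x" "u n x - g x"] by (simp add: norm_minus_commute)
    qed (intro i sq Bochner_Integration.integrable_add integrable_mult_right)+
    also have "\<dots> = 2 * ?d (u n) f + 2 * ?d (u n) g" using i sq by simp
    finally show ?thesis .
  qed
  have "(\<lambda>n. 2 * ?d (u n) f + 2 * ?d (u n) g) \<longlonglongrightarrow> 2 * 0 + 2 * 0"
    using lim unfolding L2_tendsto_def by (intro tendsto_intros)
  from LIMSEQ_le_const[OF this] bound have "?d f g \<le> 0" by auto
  hence "?d f g = 0" by (simp add: order_antisym)
  hence "AE x in M. (cmod (f x - g x))\<^sup>2 = 0"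
    using integral_nonneg_eq_0_iff_AE[OF i[OF sq(2,3)]] by simp
  thus ?thesis by simp
qed

lemma L2_tendsto_operator:
  assumes T: "T \<in> bounded_operators M" and sq: "\<And>n. u n \<in> square_integrable M" "f \<in> square_integrable M"
    and lim: "L2_tendsto M u f"
  shows "L2_tendsto M (\<lambda>n. L2_rep (T (L2_class M (u n)))) (L2_rep (T (L2_class M f)))"
proof -
  note T' = bounded_operatorsD[OF T]
  obtain K where K: "\<And>\<xi>. \<xi> \<in> L2 M \<Longrightarrow> L2_norm M (T \<xi>) \<le> K * L2_norm M \<xi>" using T'(4) by blast
  let ?r = "\<lambda>f. L2_rep (T (L2_class M f))"
  have rsq: "?r f \<in> square_integrable M" if "f \<in> square_integrable M" for f
    using L2_rep(1)[OF T'(1)[OF L2_class_in_L2[OF that]]] .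
  have r_class: "L2_class M (?r f) = T (L2_class M f)" if "f \<in> square_integrable M" for f
    using L2_rep(2)[OF T'(1)[OF L2_class_in_L2[OF that]]] .
  have bound: "(\<integral>x. (cmod (?r (u n) x - ?r f x))\<^sup>2 \<partial>M) \<le> K\<^sup>2 * (\<integral>x. (cmod (u n x - f x))\<^sup>2 \<partial>M)" for n
  proof -
    let ?v = "\<lambda>x. u n x - f x"
    have v: "?v \<in> square_integrable M" using sq by (intro square_integrable_diff)
    have "L2_class M (u n) = L2_add M (L2_class M ?v) (L2_class M f)"
      using L2_add_class[OF v sq(2)] by simp
    hence "T (L2_class M (u n)) = L2_add M (T (L2_class M ?v)) (T (L2_class M f))"
      using T'(2)[OF L2_class_in_L2[OF v] L2_class_in_L2[OF sq(2)]] by simp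
    also have "\<dots> = L2_class M (\<lambda>x. ?r ?v x + ?r f x)"
      by (simp add: L2_add_def)
    finally have "AE x in M. ?r (u n) x = ?r ?v x + ?r f x"
      using L2_rep_class[OF square_integrable_add[OF rsq[OF v] rsq[OF sq(2)]]] by simp
    hence "(\<integral>x. (cmod (?r (u n) x - ?r f x))\<^sup>2 \<partial>M) = (\<integral>x. (cmod (?r ?v x))\<^sup>2 \<partial>M)"
      using rsq[OF sq(1)[of n]] rsq[OF v] rsq[OF sq(2)]
      by (intro integral_cong_AE) (auto simp: square_integrable_def)
    also have "\<dots> = (L2_norm M (T (L2_class M ?v)))\<^sup>2" by (simp add: L2_norm_def)
    also have "\<dots> \<le> (K * L2_norm M (L2_class M ?v))\<^sup>2"
      by (intro power_mono K L2_class_in_L2 v) (simp add: L2_norm_def)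
    also have "\<dots> = K\<^sup>2 * (\<integral>x. (cmod (?v x))\<^sup>2 \<partial>M)" using L2_norm_class[OF v] by (simp add: power_mult_distrib)
    finally show ?thesis .
  qed
  have "(\<lambda>n. K\<^sup>2 * (\<integral>x. (cmod (u n x - f x))\<^sup>2 \<partial>M)) \<longlonglongrightarrow> K\<^sup>2 * 0"
    using lim unfolding L2_tendsto_def by (intro tendsto_intros)
  hence lim': "(\<lambda>n. K\<^sup>2 * (\<integral>x. (cmod (u n x - f x))\<^sup>2 \<partial>M)) \<longlonglongrightarrow> 0" by simp
  show ?thesis unfolding L2_tendsto_def
  proof (rule tendsto_sandwich[where f="\<lambda>_. 0" and h="\<lambda>n. K\<^sup>2 * (\<integral>x. (cmod (u n x - f x))\<^sup>2 \<partial>M)"])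
  qed (intro always_eventually allI bound tendsto_const integral_nonneg_AE AE_I2 zero_le_power2 lim')+
qed

lemma L2_tendsto_dominated:
  assumes "\<And>n. u n \<in> borel_measurable M" "f \<in> borel_measurable M" "h \<in> square_integrable M"
    and "\<And>x. x \<in> space M \<Longrightarrow> (\<lambda>n. u n x) \<longlonglongrightarrow> f x"
    and "\<And>n x. x \<in> space M \<Longrightarrow> cmod (u n x - f x) \<le> C * cmod (h x)"
  shows "L2_tendsto M u f"
proof -
  note [measurable] = assms(1,2)
  have "(\<lambda>n. \<integral>x. (cmod (u n x - f x))\<^sup>2 \<partial>M) \<longlonglongrightarrow> (\<integral>x. 0 \<partial>M)"
  proof (rule integral_dominated_convergence[where w="\<lambda>x. C\<^sup>2 * (cmod (h x))\<^sup>2"])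
    show "integrable M (\<lambda>x. C\<^sup>2 * (cmod (h x))\<^sup>2)" using assms(3) by (simp add: square_integrable_def)
    show "AE x in M. (\<lambda>n. (cmod (u n x - f x))\<^sup>2) \<longlonglongrightarrow> 0"
    proof (rule AE_I2)
      fix x assume "x \<in> space M"
      from assms(4)[OF this] have "(\<lambda>n. (cmod (u n x - f x))\<^sup>2) \<longlonglongrightarrow> (cmod (f x - f x))\<^sup>2"
        by (intro tendsto_intros)
      thus "(\<lambda>n. (cmod (u n x - f x))\<^sup>2) \<longlonglongrightarrow> 0" by simp
    qed
    show "AE x in M. norm ((cmod (u n x - f x))\<^sup>2) \<le> C\<^sup>2 * (cmod (h x))\<^sup>2" for n
      using power_mono[OF assms(5), of _ n 2] by (intro AE_I2) (simp add: power_mult_distrib)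
  qed measurable
  thus ?thesis by (simp add: L2_tendsto_def)
qed

lemma bounded_operators_eq_limit:
  assumes S: "S \<in> bounded_operators M" and T: "T \<in> bounded_operators M"
    and sq: "\<And>n. u n \<in> square_integrable M" "f \<in> square_integrable M"
    and lim: "L2_tendsto M u f" and eq: "\<And>n. S (L2_class M (u n)) = T (L2_class M (u n))"
  shows "S (L2_class M f) = T (L2_class M f)"
proof -
  have in_L2: "R (L2_class M g) \<in> L2 M" if "R \<in> bounded_operators M" "g \<in> square_integrable M" for R g
    using bounded_operatorsD(1)[OF that(1) L2_class_in_L2[OF that(2)]] .
  have "AE x in M. L2_rep (S (L2_class M f)) x = L2_rep (T (L2_class M f)) x"
  proof (rule L2_tendsto_unique)
    show "L2_tendsto M (\<lambda>n. L2_rep (S (L2_class M (u n)))) (L2_rep (S (L2_class M f)))"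
      using S sq lim by (rule L2_tendsto_operator)
    show "L2_tendsto M (\<lambda>n. L2_rep (S (L2_class M (u n)))) (L2_rep (T (L2_class M f)))"
      unfolding eq using T sq lim by (rule L2_tendsto_operator)
  qed (use L2_rep(1) in_L2 S T sq in blast)+
  from L2_class_eqI[OF this] show ?thesis using L2_rep(2) in_L2 S T sq by metis
qed

lemma operator_sum:
  assumes T: "T \<in> bounded_operators M" and "finite F" and h: "\<And>i. i \<in> F \<Longrightarrow> h i \<in> square_integrable M"
    and k: "\<And>i. i \<in> F \<Longrightarrow> k i \<in> square_integrable M"
    and eq: "\<And>i. i \<in> F \<Longrightarrow> T (L2_class M (h i)) = L2_class M (k i)"
  shows "T (L2_class M (\<lambda>x. \<Sum>i\<in>F. h i x)) = L2_class M (\<lambda>x. \<Sum>i\<in>F. k i x)"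
proof -
  have zero: "(\<lambda>x. 0) \<in> square_integrable M" by (simp add: square_integrable_def)
  have sq: "finite F \<Longrightarrow> (\<And>i. i \<in> F \<Longrightarrow> h i \<in> square_integrable M) \<Longrightarrow>
    (\<lambda>x. \<Sum>i\<in>F. h i x) \<in> square_integrable M" for F and h :: "'b \<Rightarrow> 'a \<Rightarrow> complex"
    by (induction F rule: finite_induct) (auto intro: square_integrable_add zero)
  show ?thesis using \<open>finite F\<close> h k eq
  proof (induction F rule: finite_induct)
    case empty
    \<comment> \<open>The zero function is written as a multiple of itself: homogeneity with the
      scalar 0 gives T 0 = 0.\<close>
    have "T (L2_class M (\<lambda>x. 0 * 0)) = L2_class M (\<lambda>x. 0 * L2_rep (T (L2_class M (\<lambda>x. 0))) x)"
      unfolding L2_scale_class[OF zero, symmetric] bounded_operatorsD(3)[OF T L2_class_in_L2[OF zero]]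
      by (simp add: L2_scale_def)
    thus ?case by simp
  next
    case (insert i F)
    have 1: "h i \<in> square_integrable M" "(\<lambda>x. \<Sum>i\<in>F. h i x) \<in> square_integrable M"
      "k i \<in> square_integrable M" "(\<lambda>x. \<Sum>i\<in>F. k i x) \<in> square_integrable M"
      using insert by (auto intro: sq)
    have "T (L2_class M (\<lambda>x. h i x + (\<Sum>i\<in>F. h i x))) =
      L2_add M (T (L2_class M (h i))) (T (L2_class M (\<lambda>x. \<Sum>i\<in>F. h i x)))"
      unfolding L2_add_class[OF 1(1,2), symmetric]
      by (rule bounded_operatorsD(2)[OF T]) (intro L2_class_in_L2 1)+
    also have "\<dots> = L2_class M (\<lambda>x. k i x + (\<Sum>i\<in>F. k i x))"
      using insert 1 by (simp add: L2_add_class)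
    finally show ?case using insert(1,2) by simp
  qed
qed

subsection \<open>Weighted composition operators\<close>

text \<open>The common form of left translations, right translations and multiplication operators;
  boundedness and commutation are proved once for this form.\<close>

definition wcomp_operator :: "'a measure \<Rightarrow> ('a \<Rightarrow> complex) \<Rightarrow> ('a \<Rightarrow> 'a) \<Rightarrow> 'a L2_operator" where
  "wcomp_operator M \<phi> \<tau> = restrict (\<lambda>\<xi>. L2_class M (\<lambda>x. \<phi> x * L2_rep \<xi> (\<tau> x))) (L2 M)"

definition measure_preserving_self :: "'a measure \<Rightarrow> ('a \<Rightarrow> 'a) \<Rightarrow> bool" where
  "measure_preserving_self M \<tau> \<longleftrightarrow> \<tau> \<in> M \<rightarrow>\<^sub>M M \<and> distr M M \<tau> = M"

lemma AE_compose_preserving: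
  assumes "measure_preserving_self M \<tau>" "AE x in M. P x" shows "AE x in M. P (\<tau> x)"
proof -
  have \<tau>: "\<tau> \<in> M \<rightarrow>\<^sub>M M" and d: "distr M M \<tau> = M"
    using assms(1) by (auto simp: measure_preserving_self_def)
  have "AE x in distr M M \<tau>. P x" unfolding d by (rule assms(2))
  thus ?thesis by (rule AE_distrD[OF \<tau>])
qed

lemma square_integrable_compose:
  assumes "measure_preserving_self M \<tau>" "f \<in> square_integrable M"
  shows "(\<lambda>x. f (\<tau> x)) \<in> square_integrable M"
    and "(\<integral>x. (cmod (f (\<tau> x)))\<^sup>2 \<partial>M) = (\<integral>x. (cmod (f x))\<^sup>2 \<partial>M)"
proof -
  have \<tau>[measurable]: "\<tau> \<in> M \<rightarrow>\<^sub>M M" and d: "distr M M \<tau> = M"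
    using assms(1) by (auto simp: measure_preserving_self_def)
  have f[measurable]: "f \<in> borel_measurable M" and i: "integrable M (\<lambda>x. (cmod (f x))\<^sup>2)"
    using assms(2) by (auto simp: square_integrable_def)
  have "integrable (distr M M \<tau>) (\<lambda>x. (cmod (f x))\<^sup>2)" using i d by simp
  hence "integrable M (\<lambda>x. (cmod (f (\<tau> x)))\<^sup>2)" by (subst (asm) integrable_distr_eq) auto
  thus "(\<lambda>x. f (\<tau> x)) \<in> square_integrable M" by (simp add: square_integrable_def)
  have "(\<integral>x. (cmod (f x))\<^sup>2 \<partial>distr M M \<tau>) = (\<integral>x. (cmod (f (\<tau> x)))\<^sup>2 \<partial>M)"
    by (rule integral_distr) auto
  thus "(\<integral>x. (cmod (f (\<tau> x)))\<^sup>2 \<partial>M) = (\<integral>x. (cmod (f x))\<^sup>2 \<partial>M)" using d by simp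
qed

text \<open>The operator factors into composition with \<tau>, which is isometric, and a
  multiplication, so the bound and linearity are inherited from
  \<open>mult_operator\<close>.\<close>

lemma wcomp_operator_eq_mult:
  assumes "measure_preserving_self M \<tau>" "f \<in> square_integrable M"
  shows "wcomp_operator M \<phi> \<tau> (L2_class M f) = mult_operator M \<phi> (L2_class M (\<lambda>x. f (\<tau> x)))"
proof -
  have "wcomp_operator M \<phi> \<tau> (L2_class M f) = L2_class M (\<lambda>x. \<phi> x * f (\<tau> x))"
    unfolding wcomp_operator_def using L2_class_in_L2[OF assms(2)]
      AE_compose_preserving[OF assms(1) L2_rep_class[OF assms(2)]]
    by (auto intro!: L2_class_eqI)
  thus ?thesis using square_integrable_compose(1)[OF assms] by (simp add: mult_operator_class)
qed

lemma wcomp_operator_class: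
  assumes "measure_preserving_self M \<tau>" "f \<in> square_integrable M"
  shows "wcomp_operator M \<phi> \<tau> (L2_class M f) = L2_class M (\<lambda>x. \<phi> x * f (\<tau> x))"
  using wcomp_operator_eq_mult[OF assms] square_integrable_compose(1)[OF assms]
  by (simp add: mult_operator_class)

lemma mult_operator_wcomp: "mult_operator M \<phi> = wcomp_operator M \<phi> (\<lambda>x. x)"
  by (simp add: mult_operator_def wcomp_operator_def)

lemma measure_preserving_id: "measure_preserving_self M (\<lambda>x. x)"
  by (simp add: measure_preserving_self_def distr_id2)

lemma wcomp_operator_bounded:
  assumes \<tau>: "measure_preserving_self M \<tau>" and \<phi>: "\<phi> \<in> borel_measurable M" "AE x in M. cmod (\<phi> x) \<le> C"
  shows "wcomp_operator M \<phi> \<tau> \<in> bounded_operators M"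
proof -
  note m = mult_operator_bounded[OF \<phi>]
  note sq = square_integrable_compose[OF \<tau>] and eq = wcomp_operator_eq_mult[OF \<tau>]
  obtain K where K: "\<And>\<xi>. \<xi> \<in> L2 M \<Longrightarrow> L2_norm M (mult_operator M \<phi> \<xi>) \<le> K * L2_norm M \<xi>"
    using bounded_operatorsD(4)[OF m] by blast
  have "wcomp_operator M \<phi> \<tau> \<in> L2 M \<rightarrow>\<^sub>E L2 M"
  proof (rule PiE_I)
    fix \<xi> assume "\<xi> \<in> L2 M"
    thus "wcomp_operator M \<phi> \<tau> \<xi> \<in> L2 M"
      by (elim L2_cases) (simp add: eq, intro bounded_operatorsD(1)[OF m] L2_class_in_L2 sq)
  qed (simp add: wcomp_operator_def)
  moreover have "wcomp_operator M \<phi> \<tau> (L2_add M \<xi> \<eta>) =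
      L2_add M (wcomp_operator M \<phi> \<tau> \<xi>) (wcomp_operator M \<phi> \<tau> \<eta>)" if \<xi>\<eta>: "\<xi> \<in> L2 M" "\<eta> \<in> L2 M" for \<xi> \<eta>
  proof -
    obtain f g where f: "f \<in> square_integrable M" "\<xi> = L2_class M f"
      and g: "g \<in> square_integrable M" "\<eta> = L2_class M g"
      using \<xi>\<eta> by (auto simp: L2_def)
    show ?thesis
      using f g bounded_operatorsD(2)[OF m L2_class_in_L2[OF sq(1)[OF f(1)]] L2_class_in_L2[OF sq(1)[OF g(1)]]]
      by (simp add: L2_add_class eq square_integrable_add sq(1))
  qed
  moreover have "wcomp_operator M \<phi> \<tau> (L2_scale M c \<xi>) = L2_scale M c (wcomp_operator M \<phi> \<tau> \<xi>)"
    if \<xi>: "\<xi> \<in> L2 M" for \<xi> c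
  proof -
    obtain f where f: "f \<in> square_integrable M" "\<xi> = L2_class M f" using \<xi> by (rule L2_cases)
    show ?thesis using f bounded_operatorsD(3)[OF m L2_class_in_L2[OF sq(1)[OF f(1)]], of c]
      by (simp add: L2_scale_class eq square_integrable_scale sq(1))
  qed
  moreover have "L2_norm M (wcomp_operator M \<phi> \<tau> \<xi>) \<le> K * L2_norm M \<xi>" if \<xi>: "\<xi> \<in> L2 M" for \<xi>
  proof -
    obtain f where f: "f \<in> square_integrable M" "\<xi> = L2_class M f" using \<xi> by (rule L2_cases)
    have "L2_norm M (L2_class M (\<lambda>x. f (\<tau> x))) = L2_norm M \<xi>" using f sq by (simp add: L2_norm_class)
    thus ?thesis using f K[OF L2_class_in_L2[OF sq(1)[OF f(1)]]] by (simp add: eq)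
  qed
  ultimately show ?thesis unfolding bounded_operators_def
    by (intro CollectI conjI ballI allI exI[of _ K])
qed

text \<open>The two products have weights \<open>\<phi> * (\<psi> o \<tau>)\<close> and
  \<open>\<psi> * (\<phi> o \<sigma>)\<close>, which agree; the substitutions have to agree only
  where this common weight is nonzero.\<close>

lemma wcomp_operator_commute:
  assumes \<tau>: "measure_preserving_self M \<tau>" and \<phi>: "\<phi> \<in> borel_measurable M" "\<And>x. x \<in> space M \<Longrightarrow> cmod (\<phi> x) \<le> C"
    and \<sigma>: "measure_preserving_self M \<sigma>" and \<psi>: "\<psi> \<in> borel_measurable M" "\<And>x. x \<in> space M \<Longrightarrow> cmod (\<psi> x) \<le> D"
    and comm: "\<And>x. x \<in> space M \<Longrightarrow> \<phi> x * \<psi> (\<tau> x) = \<psi> x * \<phi> (\<sigma> x)"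
      "\<And>x. x \<in> space M \<Longrightarrow> \<phi> x * \<psi> (\<tau> x) \<noteq> 0 \<Longrightarrow> \<sigma> (\<tau> x) = \<tau> (\<sigma> x)"
    and f: "f \<in> square_integrable M"
  shows "wcomp_operator M \<phi> \<tau> (wcomp_operator M \<psi> \<sigma> (L2_class M f)) =
    wcomp_operator M \<psi> \<sigma> (wcomp_operator M \<phi> \<tau> (L2_class M f))"
proof -
  have sq: "(\<lambda>x. \<phi> x * f (\<tau> x)) \<in> square_integrable M"
    by (rule square_integrable_mult[OF square_integrable_compose(1)[OF \<tau> f] \<phi>(1), of C]) (use \<phi>(2) in auto)
  have sq': "(\<lambda>x. \<psi> x * f (\<sigma> x)) \<in> square_integrable M"
    by (rule square_integrable_mult[OF square_integrable_compose(1)[OF \<sigma> f] \<psi>(1), of D]) (use \<psi>(2) in auto)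
  have "\<phi> x * (\<psi> (\<tau> x) * f (\<sigma> (\<tau> x))) = \<psi> x * (\<phi> (\<sigma> x) * f (\<tau> (\<sigma> x)))" if "x \<in> space M" for x
    using comm(1,2)[OF that] by (metis mult.assoc mult_zero_left)
  thus ?thesis
    by (simp add: wcomp_operator_class \<tau> \<sigma> f sq sq') (intro L2_class_eqI AE_I2, simp)
qed

section \<open>Groupoids consisting of isotropy\<close>

locale isotropy_groupoid = discrete_measured_groupoid G \<mu>
  for G :: "'g groupoid" and \<mu> :: "'g measure" +
  assumes isotropic: "arrows G = Iso G"
begin

abbreviation "p \<equiv> src G"
abbreviation "\<Gamma> \<equiv> isotropy_group G"
abbreviation "M \<equiv> mu_src G \<mu>"

section \<open>The fibres as groups\<close>

lemma tgt_eq_src: assumes "g \<in> arrows G" shows "tgt G g = p g"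
proof -
  have "g \<in> Iso G" using assms by (subst isotropic[symmetric])
  thus ?thesis by (simp add: Iso_def)
qed

lemma composable_iff: "(g, h) \<in> composable G \<longleftrightarrow> g \<in> arrows G \<and> h \<in> arrows G \<and> p g = p h"
  using tgt_eq_src by (auto simp: composable_def)

lemma carrier_\<Gamma>: "carrier (\<Gamma> x) = {g \<in> arrows G. p g = x}"
  using tgt_eq_src by (auto simp: isotropy_group_def)

lemma mult_\<Gamma>: "g \<otimes>\<^bsub>\<Gamma> x\<^esub> h = gmult G g h" and one_\<Gamma>: "\<one>\<^bsub>\<Gamma> x\<^esub> = x"
  by (simp_all add: isotropy_group_def)

lemma group_\<Gamma>:
  assumes x: "x \<in> units G" shows "group (\<Gamma> x)"
proof (rule groupI)
  fix g h assume "g \<in> carrier (\<Gamma> x)" "h \<in> carrier (\<Gamma> x)"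
  thus "g \<otimes>\<^bsub>\<Gamma> x\<^esub> h \<in> carrier (\<Gamma> x)"
    using mult_in_arrows[of g h] src_mult[of g h] by (simp add: composable_iff carrier_\<Gamma> mult_\<Gamma>)
next
  show "\<one>\<^bsub>\<Gamma> x\<^esub> \<in> carrier (\<Gamma> x)" using x units_subset src_unit[OF x] by (auto simp: carrier_\<Gamma> one_\<Gamma>)
next
  fix g h k assume "g \<in> carrier (\<Gamma> x)" "h \<in> carrier (\<Gamma> x)" "k \<in> carrier (\<Gamma> x)"
  thus "g \<otimes>\<^bsub>\<Gamma> x\<^esub> h \<otimes>\<^bsub>\<Gamma> x\<^esub> k = g \<otimes>\<^bsub>\<Gamma> x\<^esub> (h \<otimes>\<^bsub>\<Gamma> x\<^esub> k)"
    using mult_assoc[of g h k] by (simp add: composable_iff carrier_\<Gamma> mult_\<Gamma>)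
next
  fix g assume g: "g \<in> carrier (\<Gamma> x)"
  thus "\<one>\<^bsub>\<Gamma> x\<^esub> \<otimes>\<^bsub>\<Gamma> x\<^esub> g = g"
    using mult_unit_left[of g] tgt_eq_src[of g] by (simp add: carrier_\<Gamma> mult_\<Gamma> one_\<Gamma>)
  show "\<exists>h\<in>carrier (\<Gamma> x). h \<otimes>\<^bsub>\<Gamma> x\<^esub> g = \<one>\<^bsub>\<Gamma> x\<^esub>"
    using g inv_in_arrows[of g] src_inv[of g] inv_mult_left[of g] tgt_eq_src[of g]
    by (intro bexI[of _ "ginv G g"]) (auto simp: carrier_\<Gamma> mult_\<Gamma> one_\<Gamma>)
qed

lemma inv_\<Gamma>:
  assumes "g \<in> arrows G" "p g = x" shows "inv\<^bsub>\<Gamma> x\<^esub> g = ginv G g"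
proof -
  have x: "x \<in> units G" using assms src_in_units by blast
  show ?thesis
    by (rule group.inv_equality[OF group_\<Gamma>[OF x]])
      (use assms inv_in_arrows[of g] src_inv[of g] inv_mult_left[of g] tgt_eq_src[of g]
        in \<open>auto simp: carrier_\<Gamma> mult_\<Gamma> one_\<Gamma>\<close>)
qed

lemma mult_closed:
  assumes "g \<in> arrows G" "h \<in> arrows G" "p g = p h"
  shows "gmult G g h \<in> arrows G" and "p (gmult G g h) = p h"
  using assms mult_in_arrows[of g h] src_mult[of g h] by (auto simp: composable_iff)

lemma inv_closed:
  assumes "g \<in> arrows G" shows "ginv G g \<in> arrows G" and "p (ginv G g) = p g"
  using assms inv_in_arrows src_inv tgt_eq_src by auto

lemma mult_assoc':
  assumes "g \<in> arrows G" "h \<in> arrows G" "k \<in> arrows G" "p g = p h" "p h = p k"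
  shows "gmult G (gmult G g h) k = gmult G g (gmult G h k)"
  using assms mult_assoc[of g h k] by (simp add: composable_iff)

lemma inv_mult_cancel:
  assumes "g \<in> arrows G" "h \<in> arrows G" "p g = p h"
  shows "gmult G (ginv G g) (gmult G g h) = h" and "gmult G g (gmult G (ginv G g) h) = h"
    and "gmult G (gmult G h g) (ginv G g) = h" and "gmult G (gmult G h (ginv G g)) g = h"
proof -
  have "gmult G (p h) h = h" "gmult G h (p h) = h"
    using mult_unit_left[OF assms(2)] mult_unit_right[OF assms(2)] tgt_eq_src[OF assms(2)] by auto
  thus "gmult G (ginv G g) (gmult G g h) = h" "gmult G g (gmult G (ginv G g) h) = h"
    "gmult G (gmult G h g) (ginv G g) = h" "gmult G (gmult G h (ginv G g)) g = h"
    using assms inv_closed[OF assms(1)] inv_mult_left[OF assms(1)] inv_mult_right[OF assms(1)]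
      tgt_eq_src[OF assms(1)] by (simp_all flip: mult_assoc') (simp_all add: mult_assoc')
qed

subsection \<open>Borel sections and bisections\<close>

lemma space_unit: "space (unit_space G) = units G"
  using units_subset by (auto simp: unit_space_def space_restrict_space)

lemma sets_unit: "sets (unit_space G) \<subseteq> sets (gborel G)"
  using sets_restrict_space_iff[of "units G" "gborel G"] units_borel sets.sets_into_space
  unfolding unit_space_def by (auto simp: sets_restrict_space)

lemma standard_borel_units: "standard_borel (unit_space G)"
  unfolding unit_space_def using standard_borel_arrows units_borel by (rule standard_borel_restrict_space)

lemma units_separated: "\<exists>D. separates_points (unit_space G) D"
proof -
  obtain c where c: "complete_coding (unit_space G) c" "generates c (unit_space G)"
    using standard_borel_units by (rule standard_borel_coding)
  define D where "D n = {x \<in> space (unit_space G). c (fst (prod_decode n)) x \<in> {snd (prod_decode n)}}" for n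
  have "x = y" if "x \<in> units G" "y \<in> units G" "\<forall>k. x \<in> D k \<longleftrightarrow> y \<in> D k" for x y
  proof (rule complete_codingD(2)[OF c(1)])
    fix n
    show "c n x = c n y" using spec[OF that(3), of "prod_encode (n, c n x)"] that by (simp add: D_def space_unit)
  qed (use that space_unit in auto)
  moreover have "D n \<in> sets (unit_space G)" for n
    unfolding D_def by (rule sets_coordinate[OF c(1)])
  ultimately show ?thesis unfolding separates_points_def space_unit by (intro exI[of _ D]) blast
qed

lemma src_image_sets:
  assumes "A \<in> sets (gborel G)" "inj_on p A" shows "p ` A \<in> sets (unit_space G)"
proof -
  obtain D where "separates_points (unit_space G) D" using units_separated by blast
  from borel_image_inj[OF standard_borel_arrows src_borel this assms] show ?thesis .
qed

text \<open>One partition into bisections is fixed by choice, so that sections, fibre counts and the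
  cutoff of conjugacy classes all refer to the same pieces.\<close>

definition part :: "nat \<Rightarrow> 'g set" where
  "part = (SOME X. (\<forall>n. X n \<in> sets (gborel G)) \<and> (\<forall>n. inj_on p (X n)) \<and> disjoint_family X \<and>
     (\<Union>n. X n) = arrows G)"

lemma part: "part n \<in> sets (gborel G)" "inj_on p (part n)" "disjoint_family part" "(\<Union>n. part n) = arrows G"
proof -
  obtain D where D: "separates_points (unit_space G) D" using units_separated by blast
  have cnt: "countable {g \<in> arrows G. p g = x}" if "x \<in> space (unit_space G)" for x
    using src_countable_to_one that space_unit by auto
  obtain X :: "nat \<Rightarrow> 'g set" where "\<And>n. X n \<in> sets (gborel G)" "\<And>n. inj_on p (X n)" "disjoint_family X"
      "(\<Union>n. X n) = arrows G"
    using countable_to_one_partition[OF standard_borel_arrows src_borel D cnt] by blast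
  hence "\<exists>X :: nat \<Rightarrow> 'g set. (\<forall>n. X n \<in> sets (gborel G)) \<and> (\<forall>n. inj_on p (X n)) \<and> disjoint_family X \<and>
     (\<Union>n. X n) = arrows G" by blast
  from someI_ex[OF this] show "part n \<in> sets (gborel G)" "inj_on p (part n)" "disjoint_family part"
    "(\<Union>n. part n) = arrows G"
    unfolding part_def[symmetric] by blast+
qed

definition borel_section :: "('g \<Rightarrow> 'g) \<Rightarrow> bool" where
  "borel_section b \<longleftrightarrow> b \<in> unit_space G \<rightarrow>\<^sub>M gborel G \<and> (\<forall>x\<in>units G. b x \<in> arrows G \<and> p (b x) = x)"

text \<open>Outside \<open>p ` A\<close> the section takes the identity of the group as its value.\<close>

definition sec :: "'g set \<Rightarrow> 'g \<Rightarrow> 'g" where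
  "sec A x = (if x \<in> p ` A then inv_into A p x else x)"

lemma sec_in: "x \<in> p ` A \<Longrightarrow> sec A x \<in> A" by (simp add: sec_def inv_into_into)

lemma src_sec: "x \<in> p ` A \<Longrightarrow> p (sec A x) = x" by (simp add: sec_def f_inv_into_f)

lemma sec_src: "inj_on p A \<Longrightarrow> g \<in> A \<Longrightarrow> sec A (p g) = g" by (simp add: sec_def)

text \<open>Source and target agree on arrows, so injectivity of the source already gives that of
  the target.\<close>

lemma bisectionI: "A \<in> sets (gborel G) \<Longrightarrow> inj_on p A \<Longrightarrow> borel_bisection G A"
  using tgt_eq_src sets.sets_into_space[of A "gborel G"]
  unfolding borel_bisection_def inj_on_def by (auto simp: subset_iff)

lemma bisectionD:
  assumes "borel_bisection G A" shows "A \<in> sets (gborel G)" "inj_on p A" "A \<subseteq> arrows G"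
  using assms sets.sets_into_space[of A "gborel G"] by (auto simp: borel_bisection_def)

text \<open>The preimage of \<open>E\<close> is the source image of \<open>A \<inter> E\<close>,
  which is Borel by injectivity on \<open>A\<close>, together with the units of \<open>E\<close>
  outside the source image of \<open>A\<close>, where the section is the identity.\<close>

lemma borel_section_sec:
  assumes A: "borel_bisection G A" shows "borel_section (sec A)"
proof -
  note A' = bisectionD[OF A]
  have pA: "p ` A \<in> sets (unit_space G)" using A'(1,2) by (rule src_image_sets)
  have pAu: "p ` A \<subseteq> units G" using A'(3) src_in_units by auto
  have "sec A \<in> unit_space G \<rightarrow>\<^sub>M gborel G"
  proof (rule measurableI)
    fix x assume "x \<in> space (unit_space G)"
    thus "sec A x \<in> arrows G" using sec_in[of x A] A'(3) units_subset by (cases "x \<in> p ` A") (auto simp: sec_def space_unit)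
  next
    fix E assume E: "E \<in> sets (gborel G)"
    have "sec A -` E \<inter> space (unit_space G) = p ` (A \<inter> E) \<union> ((units G - p ` A) \<inter> (units G \<inter> E))"
    proof (rule subset_antisym; rule subsetI)
      fix x assume x: "x \<in> sec A -` E \<inter> space (unit_space G)"
      show "x \<in> p ` (A \<inter> E) \<union> ((units G - p ` A) \<inter> (units G \<inter> E))"
      proof (cases "x \<in> p ` A")
        case True
        hence "sec A x \<in> A \<inter> E" using sec_in x by blast
        thus ?thesis using src_sec[OF True] by (metis UnI1 image_eqI)
      qed (use x in \<open>auto simp: space_unit sec_def\<close>)
    next
      fix x assume "x \<in> p ` (A \<inter> E) \<union> ((units G - p ` A) \<inter> (units G \<inter> E))"
      thus "x \<in> sec A -` E \<inter> space (unit_space G)"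
        using pAu sec_src[OF A'(2)] by (auto simp: space_unit) (simp add: sec_def)
    qed
    moreover have "p ` (A \<inter> E) \<in> sets (unit_space G)"
      using A' E by (intro src_image_sets) (auto intro: inj_on_subset)
    moreover have "units G \<in> sets (unit_space G)" using sets.top[of "unit_space G"] space_unit by simp
    moreover have "units G \<inter> E \<in> sets (unit_space G)" using E by (auto simp: unit_space_def sets_restrict_space)
    ultimately show "sec A -` E \<inter> space (unit_space G) \<in> sets (unit_space G)" using pA by auto
  qed
  moreover have "sec A x \<in> arrows G \<and> p (sec A x) = x" if "x \<in> units G" for x
    using that sec_in[of x A] src_sec[of x A] A'(3) units_subset src_unit[of x]
    by (cases "x \<in> p ` A") (auto simp: sec_def)
  ultimately show ?thesis by (simp add: borel_section_def)
qed

lemma bisection_part: "borel_bisection G (part n)" using part by (intro bisectionI)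

lemma fibre_eq_range_sections:
  assumes x: "x \<in> units G" shows "{g \<in> arrows G. p g = x} = range (\<lambda>n. sec (part n) x)"
proof
  show "range (\<lambda>n. sec (part n) x) \<subseteq> {g \<in> arrows G. p g = x}"
    using borel_section_sec[OF bisection_part] x by (auto simp: borel_section_def)
  show "{g \<in> arrows G. p g = x} \<subseteq> range (\<lambda>n. sec (part n) x)"
  proof
    fix g assume g: "g \<in> {g \<in> arrows G. p g = x}"
    then obtain n where "g \<in> part n" using part(4) by blast
    hence "g = sec (part n) x" using sec_src[OF part(2), of g n] g by simp
    thus "g \<in> range (\<lambda>n. sec (part n) x)" by blast
  qed
qed

lemma mult_measurable:
  assumes "u \<in> N \<rightarrow>\<^sub>M gborel G" "v \<in> N \<rightarrow>\<^sub>M gborel G" "\<And>y. y \<in> space N \<Longrightarrow> p (u y) = p (v y)"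
  shows "(\<lambda>y. gmult G (u y) (v y)) \<in> N \<rightarrow>\<^sub>M gborel G"
proof -
  have "(\<lambda>y. (u y, v y)) \<in> N \<rightarrow>\<^sub>M restrict_space (gborel G \<Otimes>\<^sub>M gborel G) (composable G)"
    using assms measurable_space[OF assms(1)] measurable_space[OF assms(2)]
    by (intro measurable_restrict_space2) (auto simp: composable_iff)
  from measurable_compose[OF this mult_borel] show ?thesis by simp
qed

theorem measurable_field: "measurable_field_of_countable_groups (unit_space G) (gborel G) \<Gamma>"
proof -
  have fp: "field_proj (unit_space G) \<Gamma> g = p g" if "g \<in> arrows G" for g
    unfolding field_proj_def using that src_in_units[OF that]
    by (intro the_equality) (auto simp: space_unit carrier_\<Gamma>)
  have comp: "(\<Union>x\<in>space (unit_space G). carrier (\<Gamma> x) \<times> carrier (\<Gamma> x)) = composable G"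
    using src_in_units by (auto simp: composable_iff carrier_\<Gamma> space_unit)
  have "\<exists>e :: nat \<Rightarrow> 'g \<Rightarrow> 'g. (\<forall>n. e n \<in> unit_space G \<rightarrow>\<^sub>M gborel G) \<and>
        (\<forall>x\<in>space (unit_space G). carrier (\<Gamma> x) = range (\<lambda>n. e n x))"
    using borel_section_sec[OF bisection_part] fibre_eq_range_sections
    by (intro exI[of _ "\<lambda>n. sec (part n)"]) (auto simp: borel_section_def space_unit carrier_\<Gamma>)
  moreover have "field_proj (unit_space G) \<Gamma> \<in> gborel G \<rightarrow>\<^sub>M unit_space G"
    using src_borel by (rule measurable_cong[THEN iffD1, rotated]) (simp add: fp)
  moreover have "(\<lambda>(g, h). g \<otimes>\<^bsub>\<Gamma> (field_proj (unit_space G) \<Gamma> g)\<^esub> h)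
       \<in> restrict_space (gborel G \<Otimes>\<^sub>M gborel G) (\<Union>x\<in>space (unit_space G). carrier (\<Gamma> x) \<times> carrier (\<Gamma> x)) \<rightarrow>\<^sub>M gborel G"
    unfolding comp mult_\<Gamma> by (rule mult_borel)
  moreover have "(\<lambda>g. inv\<^bsub>\<Gamma> (field_proj (unit_space G) \<Gamma> g)\<^esub> g) \<in> gborel G \<rightarrow>\<^sub>M gborel G"
    using inv_borel by (rule measurable_cong[THEN iffD1, rotated]) (simp add: fp inv_\<Gamma>)
  moreover have "(\<lambda>x. \<one>\<^bsub>\<Gamma> x\<^esub>) \<in> unit_space G \<rightarrow>\<^sub>M gborel G"
    unfolding one_\<Gamma> unit_space_def by (rule measurable_restrict_space1) simp
  moreover have "disjoint_family_on (\<lambda>x. carrier (\<Gamma> x)) (space (unit_space G))"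
    by (auto simp: disjoint_family_on_def carrier_\<Gamma>)
  moreover have "arrows G = (\<Union>x\<in>space (unit_space G). carrier (\<Gamma> x))"
    using src_in_units by (auto simp: carrier_\<Gamma> space_unit)
  moreover have "group (\<Gamma> x) \<and> countable (carrier (\<Gamma> x))" if "x \<in> space (unit_space G)" for x
    using that group_\<Gamma> src_countable_to_one by (simp add: space_unit carrier_\<Gamma>)
  ultimately show ?thesis unfolding measurable_field_of_countable_groups_def
    using standard_borel_units standard_borel_arrows by (intro conjI ballI) blast+
qed

subsection \<open>The measure\<close>

abbreviation "fibre_count A x \<equiv> emeasure (count_space UNIV) {g \<in> A. p g = x}"

text \<open>Each piece of the partition meets a fibre at most once, so the count is a countable sum
  of indicators of source images, which are Borel.\<close>

lemma fibre_count_measurable: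
  assumes A: "A \<in> sets (gborel G)" shows "fibre_count A \<in> borel_measurable \<mu>"
proof -
  have "fibre_count A x = (\<Sum>n. indicator (p ` (A \<inter> part n)) x)" for x
  proof -
    have "A \<subseteq> (\<Union>n. part n)" using sets.sets_into_space[OF A] part(4) by simp
    hence "{g \<in> A. p g = x} = (\<Union>n. {g \<in> A \<inter> part n. p g = x})" by blast
    moreover have "disjoint_family (\<lambda>n. {g \<in> A \<inter> part n. p g = x})"
      using part(3) by (auto simp: disjoint_family_on_def)
    ultimately have "fibre_count A x = (\<Sum>n. fibre_count (A \<inter> part n) x)"
      using suminf_emeasure[of "\<lambda>n. {g \<in> A \<inter> part n. p g = x}" "count_space UNIV"] by simp
    moreover have "fibre_count (A \<inter> part n) x = indicator (p ` (A \<inter> part n)) x" for n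
    proof (cases "x \<in> p ` (A \<inter> part n)")
      case True
      then obtain g where "g \<in> A \<inter> part n" "p g = x" by blast
      hence "{g \<in> A \<inter> part n. p g = x} = {g}" using part(2)[of n] by (auto simp: inj_on_def)
      thus ?thesis using True by simp
    next
      case False
      hence e: "{g \<in> A \<inter> part n. p g = x} = {}" by auto
      show ?thesis unfolding e using False by (simp del: image_iff image_Int_subset)
    qed
    ultimately show ?thesis by simp
  qed
  moreover have "p ` (A \<inter> part n) \<in> sets \<mu>" for n
    unfolding sets_mu using A part(1,2)[of n] by (intro src_image_sets) (auto intro: inj_on_subset)
  ultimately show ?thesis by (simp add: borel_measurable_suminf_order cong: measurable_cong)
qed

lemma sets_M: "sets M = sets (gborel G)" and space_M: "space M = arrows G"
  unfolding mu_src_def by (simp_all add: sets.space_closed sets.sigma_sets_eq)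

text \<open>\<open>measure_of\<close> gives the intended values only if the set function is
  countably additive. Counting is additive on each fibre; exchanging sum and integral uses
  measurability of the fibre counts.\<close>

lemma emeasure_M:
  assumes A: "A \<in> sets (gborel G)" shows "emeasure M A = (\<integral>\<^sup>+ x. fibre_count A x \<partial>\<mu>)"
proof -
  have "countably_additive (sets (gborel G)) (\<lambda>A. \<integral>\<^sup>+ x. fibre_count A x \<partial>\<mu>)"
  proof (rule countably_additiveI)
    fix A :: "nat \<Rightarrow> 'g set" assume A: "range A \<subseteq> sets (gborel G)" "disjoint_family A" "(\<Union>i. A i) \<in> sets (gborel G)"
    have "fibre_count (\<Union>i. A i) x = (\<Sum>i. fibre_count (A i) x)" for x
    proof -
      have "{g \<in> (\<Union>i. A i). p g = x} = (\<Union>i. {g \<in> A i. p g = x})" by blast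
      moreover have "disjoint_family (\<lambda>i. {g \<in> A i. p g = x})"
        using A(2) by (auto simp: disjoint_family_on_def)
      ultimately show ?thesis
        using suminf_emeasure[of "\<lambda>i. {g \<in> A i. p g = x}" "count_space UNIV"] by simp
    qed
    thus "(\<Sum>i. \<integral>\<^sup>+ x. fibre_count (A i) x \<partial>\<mu>) = (\<integral>\<^sup>+ x. fibre_count (\<Union>i. A i) x \<partial>\<mu>)"
      using A(1) by (subst nn_integral_suminf[symmetric]) (auto intro: fibre_count_measurable)
  qed
  thus ?thesis
    by (intro emeasure_measure_of[OF mu_src_def sets.space_closed])
      (use A in \<open>auto simp: positive_def sets_M\<close>)
qed

text \<open>Counting measure has no nonempty null sets, so a null set of \<open>M\<close> has empty
  fibres over almost every unit; conversely, the full preimage of a null set of units is null. This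
  converts statements almost everywhere on the arrows into statements on whole fibres.\<close>

lemma AE_M_iff:
  "(AE g in M. P g) \<longleftrightarrow> (AE x in \<mu>. \<forall>g\<in>arrows G. p g = x \<longrightarrow> P g)"
proof
  assume "AE g in M. P g"
  then obtain N where N: "{g \<in> space M. \<not> P g} \<subseteq> N" "emeasure M N = 0" "N \<in> sets M" by (rule AE_E)
  have N': "N \<in> sets (gborel G)" using N(3) sets_M by simp
  have "(\<integral>\<^sup>+ x. fibre_count N x \<partial>\<mu>) = 0" using N(2) emeasure_M[OF N'] by simp
  hence "AE x in \<mu>. fibre_count N x = 0"
    using nn_integral_0_iff_AE[OF fibre_count_measurable[OF N']] by simp
  thus "AE x in \<mu>. \<forall>g\<in>arrows G. p g = x \<longrightarrow> P g"
  proof eventually_elim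
    case (elim x)
    hence "{g \<in> N. p g = x} = {}" by (simp add: emeasure_count_space_eq_0)
    thus ?case using N(1) space_M by blast
  qed
next
  assume "AE x in \<mu>. \<forall>g\<in>arrows G. p g = x \<longrightarrow> P g"
  then obtain E where E: "{x \<in> space \<mu>. \<not> (\<forall>g\<in>arrows G. p g = x \<longrightarrow> P g)} \<subseteq> E" "emeasure \<mu> E = 0" "E \<in> sets \<mu>"
    by (rule AE_E)
  let ?N = "p -` E \<inter> arrows G"
  have N: "?N \<in> sets (gborel G)" using src_borel E(3) sets_mu by (auto intro: measurable_sets)
  have "AE x in \<mu>. x \<notin> E" using E by (intro AE_not_in) auto
  hence "AE x in \<mu>. fibre_count ?N x = 0"
  proof eventually_elim
    case (elim x)
    hence e: "{g \<in> ?N. p g = x} = {}" by auto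
    show ?case unfolding e by (rule emeasure_empty)
  qed
  hence "emeasure M ?N = 0"
    using nn_integral_0_iff_AE[OF fibre_count_measurable[OF N]] emeasure_M[OF N] by simp
  moreover have "{g \<in> space M. \<not> P g} \<subseteq> ?N"
  proof
    fix g assume g: "g \<in> {g \<in> space M. \<not> P g}"
    hence "g \<in> arrows G" by (simp add: space_M)
    moreover have "p g \<in> space \<mu>" using src_in_units[OF \<open>g \<in> arrows G\<close>] sets_eq_imp_space_eq[OF sets_mu] space_unit by simp
    ultimately show "g \<in> ?N" using g E(1) by auto
  qed
  ultimately show "AE g in M. P g" using N sets_M by (intro AE_I[of _ _ ?N]) auto
qed

text \<open>A bijection that maps every fibre to itself preserves the counting measure on it, hence
  the integral of these counts over the units.\<close>

lemma measure_preserving_fibrewise: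
  assumes \<tau>: "\<tau> \<in> gborel G \<rightarrow>\<^sub>M gborel G" and bij: "bij_betw \<tau> (arrows G) (arrows G)"
    and src: "\<And>g. g \<in> arrows G \<Longrightarrow> p (\<tau> g) = p g"
  shows "measure_preserving_self M \<tau>"
proof -
  have \<tau>M: "\<tau> \<in> M \<rightarrow>\<^sub>M M" using \<tau> measurable_cong_sets[OF sets_M sets_M] by blast
  have "distr M M \<tau> = M"
  proof (rule measure_eqI)
    fix A assume "A \<in> sets (distr M M \<tau>)"
    hence A: "A \<in> sets (gborel G)" by (simp add: sets_M)
    have pre: "\<tau> -` A \<inter> arrows G \<in> sets (gborel G)" using measurable_sets[OF \<tau> A] .
    have "fibre_count (\<tau> -` A \<inter> arrows G) x = fibre_count A x" for x
    proof -
      have "bij_betw \<tau> {g \<in> \<tau> -` A \<inter> arrows G. p g = x} {g \<in> A. p g = x}"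
      proof (rule bij_betw_imageI)
        show "inj_on \<tau> {g \<in> \<tau> -` A \<inter> arrows G. p g = x}"
          using bij by (auto simp: bij_betw_def intro: inj_on_subset)
        show "\<tau> ` {g \<in> \<tau> -` A \<inter> arrows G. p g = x} = {g \<in> A. p g = x}"
        proof
          show "{g \<in> A. p g = x} \<subseteq> \<tau> ` {g \<in> \<tau> -` A \<inter> arrows G. p g = x}"
          proof
            fix g assume g: "g \<in> {g \<in> A. p g = x}"
            hence "g \<in> \<tau> ` arrows G" using bij sets.sets_into_space[OF A] by (auto simp: bij_betw_def)
            then obtain h where "h \<in> arrows G" "g = \<tau> h" by blast
            thus "g \<in> \<tau> ` {g \<in> \<tau> -` A \<inter> arrows G. p g = x}" using g src by auto
          qed
        qed (use src in auto)
      qed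
      from bij_betw_same_card[OF this] bij_betw_finite[OF this] show ?thesis
        by (simp add: emeasure_count_space)
    qed
    thus "emeasure (distr M M \<tau>) A = emeasure M A"
      using A pre \<tau>M by (simp add: emeasure_distr sets_M space_M emeasure_M)
  qed simp
  thus ?thesis using \<tau>M by (simp add: measure_preserving_self_def)
qed

section \<open>Translations by Borel sections\<close>

definition left_trans :: "('g \<Rightarrow> 'g) \<Rightarrow> 'g \<Rightarrow> 'g" where
  "left_trans b g = gmult G (ginv G (b (p g))) g"

definition right_trans :: "('g \<Rightarrow> 'g) \<Rightarrow> 'g \<Rightarrow> 'g" where
  "right_trans b g = gmult G g (ginv G (b (p g)))"

lemma section_in:
  assumes "borel_section b" "g \<in> arrows G" shows "b (p g) \<in> arrows G" "p (b (p g)) = p g"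
  using assms src_in_units by (auto simp: borel_section_def)

lemma trans_closed:
  assumes "borel_section b" "g \<in> arrows G"
  shows "left_trans b g \<in> arrows G" "p (left_trans b g) = p g"
    "right_trans b g \<in> arrows G" "p (right_trans b g) = p g"
  using section_in[OF assms] inv_closed[of "b (p g)"] mult_closed assms(2)
  by (auto simp: left_trans_def right_trans_def)

lemma section_src_measurable:
  assumes b: "borel_section b" shows "(\<lambda>g. b (p g)) \<in> gborel G \<rightarrow>\<^sub>M gborel G"
  using b measurable_compose[OF src_borel] unfolding borel_section_def by blast

text \<open>The inverse maps multiply by the section itself instead of its inverse. Since both
  multiplications stay in the fibre, no density factor enters, neither on the left nor on the
  right.\<close>

lemma trans_preserving:
  assumes b: "borel_section b"
  shows "measure_preserving_self M (left_trans b)" "measure_preserving_self M (right_trans b)"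
proof -
  note s = section_in[OF b] and c = trans_closed[OF b]
  note bm = measurable_compose[OF section_src_measurable[OF b] inv_borel]
  have id: "(\<lambda>g. g) \<in> gborel G \<rightarrow>\<^sub>M gborel G" by simp
  show "measure_preserving_self M (left_trans b)"
  proof (rule measure_preserving_fibrewise)
    show "left_trans b \<in> gborel G \<rightarrow>\<^sub>M gborel G" unfolding left_trans_def
      by (rule mult_measurable[OF bm id]) (simp add: s inv_closed)
    show "bij_betw (left_trans b) (arrows G) (arrows G)"
      by (rule bij_betw_byWitness[of _ "\<lambda>g. gmult G (b (p g)) g"])
        (auto simp: c(1,2) s mult_closed, auto simp: left_trans_def s mult_closed inv_closed inv_mult_cancel)
  qed (rule c)
  show "measure_preserving_self M (right_trans b)"
  proof (rule measure_preserving_fibrewise)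
    show "right_trans b \<in> gborel G \<rightarrow>\<^sub>M gborel G" unfolding right_trans_def
      by (rule mult_measurable[OF id bm]) (simp add: s inv_closed)
    show "bij_betw (right_trans b) (arrows G) (arrows G)"
      by (rule bij_betw_byWitness[of _ "\<lambda>g. gmult G g (b (p g))"])
        (auto simp: c(3,4) s mult_closed, auto simp: right_trans_def s mult_closed inv_closed inv_mult_cancel)
  qed (rule c)
qed


section \<open>The generators as weighted translations\<close>

definition weight :: "'g set \<Rightarrow> 'g \<Rightarrow> complex" where
  "weight A g = indicator (p ` A) (p g)"

definition generators :: "'g L2_operator set" where
  "generators = {lambda_op G \<mu> A | A. borel_bisection G A}"

lemma groupoid_vN_eq: "groupoid_vN G \<mu> = commutant M (commutant M generators)"
  by (simp add: groupoid_vN_def generators_def)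

lemma measurable_M: "f \<in> borel_measurable M \<longleftrightarrow> f \<in> borel_measurable (gborel G)"
  by (rule arg_cong[of _ _ "\<lambda>S. f \<in> S"]) (rule measurable_cong_sets[OF sets_M refl])

lemma weight_measurable:
  assumes A: "borel_bisection G A" shows "weight A \<in> borel_measurable M"
proof -
  have "p ` A \<in> sets (unit_space G)" using bisectionD[OF A] by (intro src_image_sets)
  hence "(\<lambda>g. indicator (p ` A) (p g) :: complex) \<in> borel_measurable (gborel G)"
    by (intro measurable_compose[OF src_borel] borel_measurable_indicator)
  thus ?thesis unfolding measurable_M weight_def .
qed

lemma weight_le: "cmod (weight A g) \<le> 1"
  by (simp add: weight_def indicator_def)

lemma weighted_translation_bounded:
  assumes A: "borel_bisection G A"
  shows "wcomp_operator M (weight A) (left_trans (sec A)) \<in> bounded_operators M"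
    and "wcomp_operator M (weight A) (right_trans (sec A)) \<in> bounded_operators M"
  by (intro wcomp_operator_bounded[where C=1] trans_preserving borel_section_sec A weight_measurable AE_I2 weight_le)+

text \<open>In a fibre that meets \<open>A\<close> in \<open>a\<close>, the element g lies in a E
  exactly if the translate of g by the inverse of \<open>a\<close> lies in \<open>E\<close>. In the
  other fibres the product set is empty while \<open>sec A\<close> is the identity; there the weight
  supplies the value 0.\<close>

lemma indicator_set_mult:
  assumes A: "borel_bisection G A" and E: "E \<subseteq> arrows G" and g: "g \<in> arrows G"
  shows "weight A g * indicator E (left_trans (sec A) g) = indicator (set_mult G A E) g"
proof -
  note A' = bisectionD[OF A]
  have "g \<in> set_mult G A E \<longleftrightarrow> p g \<in> p ` A \<and> left_trans (sec A) g \<in> E"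
  proof
    assume "g \<in> set_mult G A E"
    then obtain a h where ah: "g = gmult G a h" "a \<in> A" "h \<in> E" "p a = tgt G h"
      by (auto simp: set_mult_def)
    have *: "a \<in> arrows G" "h \<in> arrows G" "p a = p h" using ah A'(3) E tgt_eq_src[of h] by auto
    have pg: "p g = p a" using mult_closed(2)[OF *] ah(1) *(3) by simp
    hence "sec A (p g) = a" using sec_src[OF A'(2) ah(2)] by simp
    hence "left_trans (sec A) g = h" unfolding left_trans_def using inv_mult_cancel(1)[OF *] ah(1) by simp
    thus "p g \<in> p ` A \<and> left_trans (sec A) g \<in> E" using pg ah(2,3) by (metis image_eqI)
  next
    assume *: "p g \<in> p ` A \<and> left_trans (sec A) g \<in> E"
    let ?a = "sec A (p g)"
    have a: "?a \<in> A" "p ?a = p g" using * sec_in src_sec by auto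
    hence "?a \<in> arrows G" using A'(3) by blast
    hence "g = gmult G ?a (left_trans (sec A) g)"
      unfolding left_trans_def using inv_mult_cancel(2)[of ?a g] g a(2) by simp
    moreover have "p ?a = tgt G (left_trans (sec A) g)"
      using trans_closed(1,2)[OF borel_section_sec[OF A] g] tgt_eq_src a(2) by simp
    ultimately show "g \<in> set_mult G A E" using a(1) * unfolding set_mult_def by blast
  qed
  thus ?thesis by (auto simp: weight_def indicator_def)
qed

text \<open>The weighted translation has the prescribed values on indicators, and bounded operators
  with equal values there are equal, so the definite description denotes it.\<close>

lemma lambda_op_eq:
  assumes A: "borel_bisection G A"
  shows "lambda_op G \<mu> A = wcomp_operator M (weight A) (left_trans (sec A))"
proof -
  let ?T = "wcomp_operator M (weight A) (left_trans (sec A))"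
  have T: "?T \<in> bounded_operators M" using A by (rule weighted_translation_bounded)
  have val: "?T (L2_class M (indicator E)) = L2_class M (indicator (set_mult G A E))"
    if E: "E \<in> sets (gborel G)" "emeasure M E < \<infinity>" for E
  proof -
    have "indicator E \<in> square_integrable M" using E sets_M by (intro indicator_square_integrable) auto
    thus ?thesis
      using indicator_set_mult[OF A sets.sets_into_space[OF E(1)]]
      by (subst wcomp_operator_class[OF trans_preserving(1)[OF borel_section_sec[OF A]]])
        (auto intro!: L2_class_eqI AE_I2 simp: space_M)
  qed
  show ?thesis unfolding lambda_op_def
  proof (rule the_equality)
    fix S assume S: "S \<in> bounded_operators M \<and> (\<forall>E\<in>sets (gborel G). emeasure M E < \<infinity> \<longrightarrow>
      S (L2_class M (indicator E)) = L2_class M (indicator (set_mult G A E)))"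
    thus "S = ?T" using T val sets_M by (intro bounded_operators_eqI[of S M]) auto
  qed (use T val in auto)
qed

lemma generators_bounded: "generators \<subseteq> bounded_operators M"
  using weighted_translation_bounded(1) lambda_op_eq by (auto simp: generators_def)

lemma lambda_op_class:
  assumes "borel_bisection G A" "f \<in> square_integrable M"
  shows "lambda_op G \<mu> A (L2_class M f) = L2_class M (\<lambda>g. weight A g * f (left_trans (sec A) g))"
  using assms by (simp add: lambda_op_eq wcomp_operator_class trans_preserving borel_section_sec)

definition rho_op :: "'g set \<Rightarrow> 'g L2_operator" where
  "rho_op A = wcomp_operator M (weight A) (right_trans (sec A))"

lemma rho_op_class:
  assumes "borel_bisection G A" "f \<in> square_integrable M"
  shows "rho_op A (L2_class M f) = L2_class M (\<lambda>g. weight A g * f (right_trans (sec A) g))"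
  using assms by (simp add: rho_op_def wcomp_operator_class trans_preserving borel_section_sec)

lemma trans_commute:
  assumes "borel_section b" "borel_section c" "g \<in> arrows G"
  shows "left_trans b (right_trans c g) = right_trans c (left_trans b g)"
proof -
  have "p (gmult G g (ginv G (c (p g)))) = p g" "p (gmult G (ginv G (b (p g))) g) = p g"
    using trans_closed[OF assms(2,3)] trans_closed[OF assms(1,3)] by (auto simp: left_trans_def right_trans_def)
  thus ?thesis
    using section_in[OF assms(1,3)] section_in[OF assms(2,3)] assms(3)
    by (simp add: left_trans_def right_trans_def inv_closed mult_assoc')
qed

text \<open>Associativity makes left and right translations commute, and each weight depends only on
  the source, which translations preserve.\<close>

lemma rho_op_commutant:
  assumes B: "borel_bisection G B" shows "rho_op B \<in> commutant M generators"
proof (rule commutantI)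
  show "rho_op B \<in> bounded_operators M" unfolding rho_op_def using B by (rule weighted_translation_bounded)
  fix C f assume "C \<in> generators" and f: "f \<in> square_integrable M"
  then obtain A where A: "borel_bisection G A" "C = lambda_op G \<mu> A" by (auto simp: generators_def)
  note sA = borel_section_sec[OF A(1)] and sB = borel_section_sec[OF B]
  show "rho_op B (C (L2_class M f)) = C (rho_op B (L2_class M f))"
    unfolding A(2) lambda_op_eq[OF A(1)] rho_op_def
  proof (rule wcomp_operator_commute[where C=1 and D=1])
    fix g assume "g \<in> space M"
    hence g: "g \<in> arrows G" by (simp add: space_M)
    show "weight B g * weight A (right_trans (sec B) g) = weight A g * weight B (left_trans (sec A) g)"
      using trans_closed[OF sA g] trans_closed[OF sB g] by (simp add: weight_def)
    show "left_trans (sec A) (right_trans (sec B) g) = right_trans (sec B) (left_trans (sec A) g)"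
      using trans_commute[OF sA sB g] .
  qed (intro trans_preserving sA sB weight_measurable A B weight_le f)+
qed

subsection \<open>The centre contains the functions on the unit space\<close>

lemma tgt_measurable:
  assumes "f \<in> borel_measurable \<mu>"
  shows "(\<lambda>g. f (tgt G g)) \<in> borel_measurable M"
proof -
  have "f \<in> borel_measurable (unit_space G)" using assms measurable_cong_sets[OF sets_mu refl] by blast
  from measurable_compose[OF tgt_borel this] show ?thesis by (simp add: measurable_M)
qed

lemma AE_M_tgt:
  assumes "AE x in \<mu>. P x" shows "AE g in M. P (tgt G g)"
  unfolding AE_M_iff using assms by eventually_elim (auto simp: tgt_eq_src)

lemma units_bisection:
  assumes "Y \<in> sets (unit_space G)" shows "borel_bisection G Y"
proof (rule bisectionI)
  show "Y \<in> sets (gborel G)" using assms sets_unit by blast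
  have "Y \<subseteq> units G" using sets.sets_into_space[OF assms] space_unit by simp
  thus "inj_on p Y" by (auto simp: inj_on_def src_unit subset_iff)
qed

text \<open>For an indicator the operator is the generator \<open>lambda_op\<close> of a set of
  units, and linearity extends the commutation with \<open>S\<close> to simple functions. A bounded
  \<open>f\<close> is a dominated limit of simple functions; continuity of \<open>S\<close> and
  uniqueness of limits in the mean conclude.\<close>

lemma mult_operator_bicommutant:
  assumes f: "f \<in> borel_measurable \<mu>" and bound: "\<And>x. cmod (f x) \<le> C"
  shows "mult_operator M (\<lambda>g. f (tgt G g)) \<in> commutant M (commutant M generators)"
proof (rule commutantI)
  let ?T = "mult_operator M (\<lambda>g. f (tgt G g))"
  show "?T \<in> bounded_operators M"
    by (rule mult_operator_bounded[OF tgt_measurable[OF f], of C]) (use bound in simp)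
  fix S h assume S: "S \<in> commutant M generators" and h: "h \<in> square_integrable M"
  note Sb = commutant_bounded[OF S]
  let ?r = "\<lambda>h. L2_rep (S (L2_class M h))"
  have r_sq: "?r h \<in> square_integrable M" and r_class: "L2_class M (?r h) = S (L2_class M h)"
    if "h \<in> square_integrable M" for h
    using L2_rep[OF bounded_operatorsD(1)[OF Sb L2_class_in_L2[OF that]]] by auto
  \<comment> \<open>These approximants satisfy |s i| \<le> 2 |f|, which is the origin of the bounds
    \<open>2 * C\<close> and \<open>3 * C\<close> below.\<close>
  obtain s where s: "\<And>i. simple_function \<mu> (s i)" "\<And>x. x \<in> space \<mu> \<Longrightarrow> (\<lambda>i. s i x) \<longlonglongrightarrow> f x"
      "\<And>i x. x \<in> space \<mu> \<Longrightarrow> norm (s i x) \<le> 2 * norm (f x)"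
    using borel_measurable_implies_sequence_metric[OF f, of 0] by (simp add: dist_norm) blast
  have sm: "s i \<in> borel_measurable \<mu>" for i using s(1) by (rule borel_measurable_simple_function)
  have t_space: "tgt G g \<in> space \<mu>" if "g \<in> space M" for g
    using that tgt_in_units sets_eq_imp_space_eq[OF sets_mu] by (simp add: space_M space_unit)
  have s_bound: "cmod (s i (tgt G g)) \<le> 2 * C" if "g \<in> space M" for i g
    using s(3)[OF t_space[OF that], of i] bound[of "tgt G g"] by linarith
  have sq: "(\<lambda>g. s i (tgt G g) * k g) \<in> square_integrable M" if "k \<in> square_integrable M" for i k
    using that tgt_measurable[OF sm] by (rule square_integrable_mult[where C="2 * C"]) (use s_bound in auto)
  have sqf: "(\<lambda>g. f (tgt G g) * k g) \<in> square_integrable M" if "k \<in> square_integrable M" for k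
    using that tgt_measurable[OF f] by (rule square_integrable_mult[where C=C]) (use bound in auto)
  have step: "S (L2_class M (\<lambda>g. s i (tgt G g) * h g)) = L2_class M (\<lambda>g. s i (tgt G g) * ?r h g)" for i
  proof -
    let ?F = "s i ` space \<mu>" and ?Y = "\<lambda>y. s i -` {y} \<inter> space \<mu>"
    have fin: "finite ?F" using s(1)[of i] by (auto simp: simple_function_def)
    have Y: "?Y y \<in> sets (unit_space G)" for y
      using measurable_sets[OF sm[of i], of "{y}"] sets_mu by simp
    let ?i = "\<lambda>y g. indicator (?Y y) (tgt G g) :: complex"
    have expand: "s i (tgt G g) * k = (\<Sum>y\<in>?F. y * (?i y g * k))" if "g \<in> space M" for g k
    proof -
      have "(\<Sum>y\<in>?F. y * (?i y g * k)) = (\<Sum>y\<in>?F. if y = s i (tgt G g) then y * k else 0)"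
        using t_space[OF that] by (intro sum.cong) (auto simp: indicator_def)
      also have "\<dots> = s i (tgt G g) * k" using fin t_space[OF that] by simp
      finally show ?thesis ..
    qed
    have isq: "(\<lambda>g. ?i y g * k g) \<in> square_integrable M" if "k \<in> square_integrable M" for y k
    proof (rule square_integrable_mult[where C=1])
      show "?i y \<in> borel_measurable M"
        using Y[of y] sets_mu by (intro tgt_measurable[of "indicator (?Y y)"] borel_measurable_indicator) auto
    qed (use that in \<open>auto simp: indicator_def\<close>)
    have "S (L2_class M (\<lambda>g. \<Sum>y\<in>?F. y * (?i y g * h g))) = L2_class M (\<lambda>g. \<Sum>y\<in>?F. y * (?i y g * ?r h g))"
    proof (rule operator_sum[OF Sb fin])
      fix y
      show "(\<lambda>g. y * (?i y g * h g)) \<in> square_integrable M" "(\<lambda>g. y * (?i y g * ?r h g)) \<in> square_integrable M"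
        by (intro square_integrable_scale isq h r_sq)+
      have "lambda_op G \<mu> (?Y y) \<in> generators" using units_bisection[OF Y] by (auto simp: generators_def)
      from commutantD[OF S this L2_class_in_L2[OF h]]
      have "S (L2_class M (\<lambda>g. ?i y g * h g)) = mult_operator M (?i y) (S (L2_class M h))"
        using h by (simp only: lambda_op_units[OF Y] mult_operator_class)
      also have "\<dots> = L2_class M (\<lambda>g. ?i y g * ?r h g)"
        using r_sq[OF h] mult_operator_class[of "?r h" M "?i y"] r_class[OF h] by simp
      finally have "S (L2_scale M y (L2_class M (\<lambda>g. ?i y g * h g))) = L2_scale M y (L2_class M (\<lambda>g. ?i y g * ?r h g))"
        using bounded_operatorsD(3)[OF Sb L2_class_in_L2[OF isq[OF h]]] by simp
      thus "S (L2_class M (\<lambda>g. y * (?i y g * h g))) = L2_class M (\<lambda>g. y * (?i y g * ?r h g))"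
        by (simp only: L2_scale_class[OF isq[OF h]] L2_scale_class[OF isq[OF r_sq[OF h]]])
    qed
    moreover have "L2_class M (\<lambda>g. s i (tgt G g) * k g) = L2_class M (\<lambda>g. \<Sum>y\<in>?F. y * (?i y g * k g))" for k
      using expand by (intro L2_class_eqI AE_I2) blast
    ultimately show ?thesis by simp
  qed
  have lim: "L2_tendsto M (\<lambda>i g. s i (tgt G g) * k g) (\<lambda>g. f (tgt G g) * k g)" if k: "k \<in> square_integrable M" for k
  proof (rule L2_tendsto_dominated[where h=k and C="3 * C"])
    fix g assume g: "g \<in> space M"
    show "(\<lambda>i. s i (tgt G g) * k g) \<longlonglongrightarrow> f (tgt G g) * k g"
      by (intro tendsto_intros s(2) t_space g)
    fix i
    have "cmod (s i (tgt G g) - f (tgt G g)) \<le> 3 * C"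
      using s_bound[OF g, of i] bound[of "tgt G g"] norm_triangle_ineq4[of "s i (tgt G g)" "f (tgt G g)"] by linarith
    thus "cmod (s i (tgt G g) * k g - f (tgt G g) * k g) \<le> 3 * C * cmod (k g)"
      by (simp add: norm_mult mult_right_mono flip: left_diff_distrib)
  qed (use k sq sqf square_integrable_measurable in blast)+
  have "AE g in M. ?r (\<lambda>g. f (tgt G g) * h g) g = f (tgt G g) * ?r h g"
  proof (rule L2_tendsto_unique)
    show "L2_tendsto M (\<lambda>i g. s i (tgt G g) * ?r h g) (\<lambda>g. f (tgt G g) * ?r h g)"
      by (intro lim r_sq h)
    show "L2_tendsto M (\<lambda>i g. s i (tgt G g) * ?r h g) (?r (\<lambda>g. f (tgt G g) * h g))"
    proof (rule L2_tendsto_cong)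
      show "L2_tendsto M (\<lambda>i. ?r (\<lambda>g. s i (tgt G g) * h g)) (?r (\<lambda>g. f (tgt G g) * h g))"
        by (intro L2_tendsto_operator Sb sq sqf h lim)
      show "AE g in M. ?r (\<lambda>g. s i (tgt G g) * h g) g = s i (tgt G g) * ?r h g" for i
        unfolding step by (rule L2_rep_class[OF sq[OF r_sq[OF h]]])
    qed (intro square_integrable_measurable r_sq sq sqf h)+
  qed (intro r_sq sq sqf h)+
  hence "L2_class M (?r (\<lambda>g. f (tgt G g) * h g)) = L2_class M (\<lambda>g. f (tgt G g) * ?r h g)"
    by (rule L2_class_eqI)
  hence "S (L2_class M (\<lambda>g. f (tgt G g) * h g)) = mult_operator M (\<lambda>g. f (tgt G g)) (L2_class M (?r h))"
    using r_class[OF sqf[OF h]] mult_operator_class[OF r_sq[OF h]] by simp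
  thus "?T (S (L2_class M h)) = S (?T (L2_class M h))"
    using mult_operator_class[OF h] r_class[OF h] by simp
qed

text \<open>The triple commutant collapses to the commutant of the generators.\<close>

lemma center_eq: "center M (groupoid_vN G \<mu>) = commutant M (commutant M generators) \<inter> commutant M generators"
proof -
  have "commutant M generators \<subseteq> commutant M (commutant M (commutant M generators))"
    using commutant_bounded by (intro bicommutant_extensive) auto
  moreover have "commutant M (commutant M (commutant M generators)) \<subseteq> commutant M generators"
    by (intro commutant_antimono bicommutant_extensive generators_bounded)
  ultimately show ?thesis unfolding center_def groupoid_vN_eq by blast
qed

lemma Linf_subset_center: "Linf_units G \<mu> \<subseteq> center M (groupoid_vN G \<mu>)"
proof
  fix T assume "T \<in> Linf_units G \<mu>"
  then obtain f C where f: "T = mult_operator M (\<lambda>g. f (tgt G g))" "f \<in> borel_measurable \<mu>"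
      "AE x in \<mu>. cmod (f x) \<le> C" by (auto simp: Linf_units_def)
  \<comment> \<open>An essentially bounded function is truncated to an everywhere bounded one that
    defines the same operator.\<close>
  define k where "k x = (if cmod (f x) \<le> C then f x else 0)" for x
  have k: "k \<in> borel_measurable \<mu>" unfolding k_def using f(2) by measurable
  have kb: "cmod (k x) \<le> \<bar>C\<bar>" for x using abs_ge_self[of C] by (auto simp: k_def)
  have "AE x in \<mu>. f x = k x" using f(3) by eventually_elim (simp add: k_def)
  hence "AE g in M. f (tgt G g) = k (tgt G g)" by (rule AE_M_tgt)
  hence "L2_class M (\<lambda>g. f (tgt G g) * L2_rep \<xi> g) = L2_class M (\<lambda>g. k (tgt G g) * L2_rep \<xi> g)" for \<xi>
    by (intro L2_class_eqI) (auto elim: eventually_mono)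
  hence T: "T = mult_operator M (\<lambda>g. k (tgt G g))" unfolding f(1) mult_operator_def by simp
  have "T \<in> commutant M generators" unfolding T
  proof (rule commutantI)
    show "mult_operator M (\<lambda>g. k (tgt G g)) \<in> bounded_operators M"
      by (rule mult_operator_bounded[OF tgt_measurable[OF k], of "\<bar>C\<bar>"]) (use kb in simp)
    fix D h assume "D \<in> generators" and h: "h \<in> square_integrable M"
    then obtain A where A: "borel_bisection G A" "D = lambda_op G \<mu> A" by (auto simp: generators_def)
    note sA = borel_section_sec[OF A(1)]
    show "mult_operator M (\<lambda>g. k (tgt G g)) (D (L2_class M h)) = D (mult_operator M (\<lambda>g. k (tgt G g)) (L2_class M h))"
      unfolding A(2) lambda_op_eq[OF A(1)] mult_operator_wcomp
    proof (rule wcomp_operator_commute[where C="\<bar>C\<bar>" and D=1])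
      fix g assume "g \<in> space M"
      hence g: "g \<in> arrows G" by (simp add: space_M)
      show "k (tgt G g) * weight A g = weight A g * k (tgt G (left_trans (sec A) g))"
        using trans_closed[OF sA g] g by (simp add: tgt_eq_src)
    qed (intro trans_preserving measure_preserving_id sA weight_measurable A weight_le h kb tgt_measurable k refl)+
  qed
  thus "T \<in> center M (groupoid_vN G \<mu>)"
    unfolding center_eq using mult_operator_bicommutant[OF k kb] T by simp
qed


subsection \<open>Finite conjugacy classes\<close>

definition cj :: "'g \<Rightarrow> 'g \<Rightarrow> 'g" where
  "cj h g = gmult G (gmult G h g) (ginv G h)"

lemma cj_closed:
  assumes "h \<in> arrows G" "g \<in> arrows G" "p h = p g"
  shows "cj h g \<in> arrows G" "p (cj h g) = p g"
  using assms mult_closed[of h g] inv_closed[of h] mult_closed[of "gmult G h g" "ginv G h"]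
  by (auto simp: cj_def)

lemma cj_cj:
  assumes "h \<in> arrows G" "k \<in> arrows G" "g \<in> arrows G" "p h = p g" "p k = p g"
  shows "cj k (cj h g) = cj (gmult G k h) g"
proof -
  interpret group "\<Gamma> (p g)" using group_\<Gamma> src_in_units assms by blast
  have c: "h \<in> carrier (\<Gamma> (p g))" "k \<in> carrier (\<Gamma> (p g))" "g \<in> carrier (\<Gamma> (p g))"
    using assms by (auto simp: carrier_\<Gamma>)
  have "k \<otimes>\<^bsub>\<Gamma> (p g)\<^esub> (h \<otimes>\<^bsub>\<Gamma> (p g)\<^esub> g \<otimes>\<^bsub>\<Gamma> (p g)\<^esub> inv\<^bsub>\<Gamma> (p g)\<^esub> h) \<otimes>\<^bsub>\<Gamma> (p g)\<^esub> inv\<^bsub>\<Gamma> (p g)\<^esub> k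
      = (k \<otimes>\<^bsub>\<Gamma> (p g)\<^esub> h) \<otimes>\<^bsub>\<Gamma> (p g)\<^esub> g \<otimes>\<^bsub>\<Gamma> (p g)\<^esub> inv\<^bsub>\<Gamma> (p g)\<^esub> (k \<otimes>\<^bsub>\<Gamma> (p g)\<^esub> h)"
    using c by (simp add: m_assoc inv_mult_group)
  thus ?thesis using assms mult_closed[of k h] by (simp add: cj_def mult_\<Gamma> inv_\<Gamma>)
qed

lemma inv_inv: "g \<in> arrows G \<Longrightarrow> ginv G (ginv G g) = g"
  using group.inv_inv[OF group_\<Gamma>[OF src_in_units[of g]], of g] inv_closed[of g]
  by (simp add: carrier_\<Gamma> inv_\<Gamma>)

lemma cj_src: assumes "g \<in> arrows G" shows "cj (p g) g = g"
proof -
  interpret group "\<Gamma> (p g)" using group_\<Gamma> src_in_units assms by blast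
  show ?thesis
    using assms src_in_units[OF assms] src_unit[OF src_in_units[OF assms]] units_subset
      r_one[of g] l_one[of g] inv_one inv_\<Gamma>[of "p g" "p g"]
    by (auto simp: cj_def carrier_\<Gamma> mult_\<Gamma> one_\<Gamma>)
qed

lemma cj_inv:
  assumes "h \<in> arrows G" "g \<in> arrows G" "p h = p g"
  shows "cj h (cj (ginv G h) g) = g" "cj (ginv G h) (cj h g) = g"
proof -
  have 1: "gmult G h (ginv G h) = p g" "gmult G (ginv G h) h = p g"
    using inv_mult_right[OF assms(1)] inv_mult_left[OF assms(1)] tgt_eq_src[OF assms(1)] assms(3) by auto
  have "cj (p g) g = g" using assms(2) by (rule cj_src)
  thus "cj h (cj (ginv G h) g) = g" "cj (ginv G h) (cj h g) = g"
    using cj_cj[of "ginv G h" h g] cj_cj[of h "ginv G h" g] assms inv_closed[OF assms(1)] 1 by auto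
qed

lemma cj_unit:
  assumes "h \<in> arrows G" "g \<in> arrows G" "p h = p g" "cj h g \<in> units G"
  shows "g \<in> units G"
proof -
  have "cj h g = p g" using cj_closed(2)[OF assms(1-3)] src_unit[OF assms(4)] by simp
  hence "g = cj (ginv G h) (p g)" using cj_inv(2)[OF assms(1-3)] by simp
  also have "\<dots> = gmult G (ginv G h) h"
    using mult_unit_right[of "ginv G h"] inv_closed[OF assms(1)] assms(3) inv_inv[OF assms(1)]
    by (simp add: cj_def)
  also have "\<dots> = p h" using inv_mult_left[OF assms(1)] .
  finally show ?thesis using src_in_units[OF assms(1)] by simp
qed

text \<open>For every \<open>N\<close> the nontrivial elements whose conjugates all lie in the first \<open>N\<close> pieces of the
  partition form a conjugation invariant union of \<open>N\<close> bisections.\<close>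

definition fc :: "nat \<Rightarrow> 'g set" where
  "fc N = {g \<in> arrows G - units G. \<forall>h\<in>arrows G. p h = p g \<longrightarrow> cj h g \<in> (\<Union>n<N. part n)}"

text \<open>The quantifier over all \<open>h\<close> in the fibre becomes a countable one, because
  the sections of the pieces exhaust every fibre and conjugation by a section is a Borel
  map.\<close>

lemma fc_sets: "fc N \<in> sets (gborel G)"
proof -
  let ?S = "\<lambda>m g. cj (sec (part m) (p g)) g"
  have m: "?S m \<in> gborel G \<rightarrow>\<^sub>M gborel G" for m
  proof -
    note b = borel_section_sec[OF bisection_part, of m]
    note bm = section_src_measurable[OF b] and s = section_in[OF b]
    have id: "(\<lambda>g. g) \<in> gborel G \<rightarrow>\<^sub>M gborel G" by simp
    show ?thesis unfolding cj_def
      by (rule mult_measurable[OF mult_measurable[OF bm id] measurable_compose[OF bm inv_borel]])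
        (simp_all add: s inv_closed mult_closed)
  qed
  have "g \<in> fc N \<longleftrightarrow> g \<in> arrows G - units G \<and> (\<forall>m. ?S m g \<in> (\<Union>n<N. part n))" for g
  proof (cases "g \<in> arrows G")
    case True
    have "(\<forall>h\<in>arrows G. p h = p g \<longrightarrow> cj h g \<in> (\<Union>n<N. part n)) \<longleftrightarrow>
        (\<forall>h\<in>{h \<in> arrows G. p h = p g}. cj h g \<in> (\<Union>n<N. part n))" by blast
    also have "\<dots> \<longleftrightarrow> (\<forall>m. ?S m g \<in> (\<Union>n<N. part n))"
      unfolding fibre_eq_range_sections[OF src_in_units[OF True]] by blast
    finally show ?thesis by (simp add: fc_def)
  qed (simp add: fc_def)
  hence "fc N = (arrows G - units G) \<inter> (\<Inter>m. ?S m -` (\<Union>n<N. part n) \<inter> arrows G)" by auto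
  also have "\<dots> \<in> sets (gborel G)"
  proof -
    have "(\<Union>n<N. part n) \<in> sets (gborel G)" using part(1) by (intro sets.finite_UN) auto
    hence "range (\<lambda>m. ?S m -` (\<Union>n<N. part n) \<inter> arrows G) \<subseteq> sets (gborel G)"
      using measurable_sets[OF m] by blast
    hence "(\<Inter>m. ?S m -` (\<Union>n<N. part n) \<inter> arrows G) \<in> sets (gborel G)"
      by (rule sets.countable_INT) simp
    thus ?thesis using units_borel by blast
  qed
  finally show ?thesis .
qed

lemma fcD: "g \<in> fc N \<Longrightarrow> g \<in> arrows G" "g \<in> fc N \<Longrightarrow> g \<notin> units G"
  by (auto simp: fc_def)

lemma fc_cj:
  assumes g: "g \<in> fc N" and h: "h \<in> arrows G" "p h = p g" shows "cj h g \<in> fc N"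
proof -
  have ga: "g \<in> arrows G" using g by (rule fcD)
  note c = cj_closed[OF h(1) ga h(2)]
  have "cj k (cj h g) \<in> (\<Union>n<N. part n)" if "k \<in> arrows G" "p k = p (cj h g)" for k
    using cj_cj[OF h(1) that(1) ga h(2)] that c mult_closed[OF that(1) h(1)] h g by (simp add: fc_def)
  moreover have "cj h g \<notin> units G" using cj_unit[OF h(1) ga h(2)] fcD(2)[OF g] by blast
  ultimately show ?thesis using c by (simp add: fc_def)
qed

lemma fc_part:
  assumes "g \<in> fc N" obtains n where "n < N" "g \<in> part n"
proof -
  have ga: "g \<in> arrows G" and x: "p g \<in> units G" using fcD[OF assms] src_in_units by auto
  have "cj (p g) g \<in> (\<Union>n<N. part n)"
    using assms x units_subset src_unit[OF x] by (auto simp: fc_def)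
  moreover have "cj (p g) g = g" using ga by (rule cj_src)
  ultimately show ?thesis using that by auto
qed

lemma finite_parts_fibre: "finite {g \<in> (\<Union>n<N. part n). p g = x}"
proof -
  have "finite {g \<in> part n. p g = x}" for n
    using part(2)[of n] by (intro finite_if_finite_subsets_card_bdd[THEN conjunct1, of _ 1])
      (auto simp: inj_on_def card_le_Suc0_iff_eq subset_iff)
  hence "finite (\<Union>n<N. {g \<in> part n. p g = x})" by simp
  moreover have "{g \<in> (\<Union>n<N. part n). p g = x} = (\<Union>n<N. {g \<in> part n. p g = x})" by blast
  ultimately show ?thesis by simp
qed

lemma conj_class_eq:
  assumes "g \<in> arrows G" "p g = x"
  shows "{h \<otimes>\<^bsub>\<Gamma> x\<^esub> g \<otimes>\<^bsub>\<Gamma> x\<^esub> inv\<^bsub>\<Gamma> x\<^esub> h | h. h \<in> carrier (\<Gamma> x)} = (\<lambda>h. cj h g) ` {h \<in> arrows G. p h = x}"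
  by (auto simp: carrier_\<Gamma> cj_def mult_\<Gamma> inv_\<Gamma> image_iff) (metis inv_\<Gamma>)+

text \<open>A finite class meets only finitely many pieces, hence lies in the first \<open>N\<close>
  of them for some \<open>N\<close>; conversely, \<open>N\<close> pieces contain at most
  \<open>N\<close> elements of a fibre.\<close>

lemma icc_iff:
  assumes x: "x \<in> units G"
  shows "icc (\<Gamma> x) \<longleftrightarrow> (\<forall>N. \<forall>g\<in>arrows G. p g = x \<longrightarrow> g \<notin> fc N)"
proof
  assume icc: "icc (\<Gamma> x)"
  show "\<forall>N. \<forall>g\<in>arrows G. p g = x \<longrightarrow> g \<notin> fc N"
  proof (intro allI ballI impI notI)
    fix N g assume g: "g \<in> arrows G" "p g = x" "g \<in> fc N"
    have "g \<noteq> x" using fcD(2)[OF g(3)] x by blast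
    hence "infinite ((\<lambda>h. cj h g) ` {h \<in> arrows G. p h = x})"
      using icc g unfolding icc_def conj_class_eq[OF g(1,2), symmetric] by (simp add: carrier_\<Gamma> one_\<Gamma>)
    moreover have "(\<lambda>h. cj h g) ` {h \<in> arrows G. p h = x} \<subseteq> {g \<in> (\<Union>n<N. part n). p g = x}"
      using g cj_closed(2) by (auto simp: fc_def)
    ultimately show False using finite_parts_fibre finite_subset by blast
  qed
next
  assume *: "\<forall>N. \<forall>g\<in>arrows G. p g = x \<longrightarrow> g \<notin> fc N"
  show "icc (\<Gamma> x)" unfolding icc_def
  proof (intro ballI impI notI)
    fix g assume "g \<in> carrier (\<Gamma> x)" and ne: "g \<noteq> \<one>\<^bsub>\<Gamma> x\<^esub>"
      and fin: "finite {h \<otimes>\<^bsub>\<Gamma> x\<^esub> g \<otimes>\<^bsub>\<Gamma> x\<^esub> inv\<^bsub>\<Gamma> x\<^esub> h | h. h \<in> carrier (\<Gamma> x)}"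
    hence g: "g \<in> arrows G" "p g = x" by (auto simp: carrier_\<Gamma>)
    let ?C = "(\<lambda>h. cj h g) ` {h \<in> arrows G. p h = x}"
    have finC: "finite ?C" using fin unfolding conj_class_eq[OF g] .
    have "?C \<subseteq> (\<Union>n. part n)" unfolding part(4) using cj_closed(1) g by auto
    hence "\<forall>c\<in>?C. \<exists>n. c \<in> part n" by blast
    then obtain n where n: "\<And>c. c \<in> ?C \<Longrightarrow> c \<in> part (n c)" by metis
    obtain N where N: "\<forall>c\<in>?C. n c < N"
      using finite_nat_set_iff_bounded[of "n ` ?C"] finC by auto
    have "cj h g \<in> (\<Union>n<N. part n)" if "h \<in> arrows G" "p h = p g" for h
    proof -
      have "cj h g \<in> ?C" using that g by blast
      thus ?thesis using n N by blast
    qed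
    moreover have "g \<notin> units G" using ne g(2) src_unit by (auto simp: one_\<Gamma>)
    ultimately have "g \<in> fc N" using g by (simp add: fc_def)
    thus False using * g by blast
  qed
qed

text \<open>Only countably many cutoffs occur, so the quantifier over \<open>N\<close> and the one
  over almost all units can be exchanged.\<close>

lemma AE_icc_iff: "(AE x in \<mu>. icc (\<Gamma> x)) \<longleftrightarrow> (\<forall>N. AE g in M. g \<notin> fc N)"
proof -
  have "(AE x in \<mu>. icc (\<Gamma> x)) \<longleftrightarrow> (AE x in \<mu>. \<forall>N. \<forall>g\<in>arrows G. p g = x \<longrightarrow> g \<notin> fc N)"
    by (rule AE_cong) (simp add: icc_iff sets_eq_imp_space_eq[OF sets_mu] space_unit)
  also have "\<dots> \<longleftrightarrow> (\<forall>N. AE x in \<mu>. \<forall>g\<in>arrows G. p g = x \<longrightarrow> g \<notin> fc N)"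
    by (rule AE_all_countable)
  finally show ?thesis unfolding AE_M_iff .
qed

subsection \<open>The unit vector\<close>

lemma emeasure_M_units:
  assumes B: "B \<in> sets (gborel G)" "B \<subseteq> units G" shows "emeasure M B < \<infinity>"
proof -
  have "fibre_count B x \<le> 1" for x
  proof -
    have "{g \<in> B. p g = x} \<subseteq> {x}" using B(2) src_unit by auto
    hence "fibre_count B x \<le> emeasure (count_space UNIV) {x}" by (intro emeasure_mono) auto
    thus ?thesis by simp
  qed
  hence "emeasure M B \<le> (\<integral>\<^sup>+ x. 1 \<partial>\<mu>)" unfolding emeasure_M[OF B(1)] by (intro nn_integral_mono)
  also have "\<dots> = 1" by (simp add: emeasure_space_1)
  finally show ?thesis by (rule order.strict_trans1) simp
qed

text \<open>On each fibre this is the point mass at the identity of the group.\<close>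

definition \<delta> :: "'g \<Rightarrow> complex" where "\<delta> = indicator (units G)"

lemma \<delta>_sq: "\<delta> \<in> square_integrable M"
  unfolding \<delta>_def using units_borel emeasure_M_units[OF units_borel order_refl] sets_M
  by (intro indicator_square_integrable) auto

lemma div_in_units_iff:
  assumes "a \<in> arrows G" "g \<in> arrows G" "p a = p g"
  shows "gmult G (ginv G a) g \<in> units G \<longleftrightarrow> g = a" "gmult G g (ginv G a) \<in> units G \<longleftrightarrow> g = a"
proof -
  note i = inv_closed[OF assms(1)]
  note c = mult_closed[of "ginv G a" g] mult_closed[of g "ginv G a"]
  show "gmult G (ginv G a) g \<in> units G \<longleftrightarrow> g = a"
  proof
    assume "gmult G (ginv G a) g \<in> units G"
    hence "gmult G (ginv G a) g = p a" using src_unit c i assms by metis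
    thus "g = a" using inv_mult_cancel(2)[OF assms] mult_unit_right[OF assms(1)] by simp
  next
    assume e: "g = a" show "gmult G (ginv G a) g \<in> units G"
      unfolding e inv_mult_left[OF assms(1)] using assms(1) by (rule src_in_units)
  qed
  show "gmult G g (ginv G a) \<in> units G \<longleftrightarrow> g = a"
  proof
    assume "gmult G g (ginv G a) \<in> units G"
    hence "gmult G g (ginv G a) = p a" using src_unit c i assms by metis
    thus "g = a" using inv_mult_cancel(4)[OF assms] mult_unit_left[OF assms(1)] tgt_eq_src[OF assms(1)] by simp
  next
    assume e: "g = a" show "gmult G g (ginv G a) \<in> units G"
      unfolding e inv_mult_right[OF assms(1)] using assms(1) by (rule tgt_in_units)
  qed
qed

text \<open>Translating the point mass at the identity by \<open>a\<close>, on either side, gives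
  the point mass at \<open>a\<close>. The coincidence of the two sides is the source of conjugation
  invariance for central operators.\<close>

lemma weight_\<delta>:
  assumes A: "borel_bisection G A" and g: "g \<in> arrows G"
  shows "weight A g * \<delta> (left_trans (sec A) g) = indicator A g"
    and "weight A g * \<delta> (right_trans (sec A) g) = indicator A g"
proof -
  note s = section_in[OF borel_section_sec[OF A] g]
  note d = div_in_units_iff[OF s(1) g s(2)]
  have "weight A g * \<delta> (left_trans (sec A) g) = indicator A g \<and>
    weight A g * \<delta> (right_trans (sec A) g) = indicator A g"
  proof (cases "p g \<in> p ` A")
    case True
    have "g = sec A (p g) \<longleftrightarrow> g \<in> A"
      using sec_in[OF True] sec_src[OF bisectionD(2)[OF A], of g] by metis
    thus ?thesis using True d by (simp add: weight_def \<delta>_def left_trans_def right_trans_def indicator_def)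
  next
    case False
    hence "g \<notin> A" by blast
    thus ?thesis using False by (simp add: weight_def)
  qed
  thus "weight A g * \<delta> (left_trans (sec A) g) = indicator A g"
    "weight A g * \<delta> (right_trans (sec A) g) = indicator A g" by simp_all
qed

subsection \<open>Central elements from finite conjugacy classes\<close>

definition fc_part_set :: "nat \<Rightarrow> nat \<Rightarrow> 'g set" where
  "fc_part_set N n = fc N \<inter> part n"

lemma fc_part_bisection: "borel_bisection G (fc_part_set N n)"
  unfolding fc_part_set_def using part(1,2)[of n] fc_sets by (intro bisectionI) (auto intro: inj_on_subset)

text \<open>\<open>conv N N\<close> is convolution with the indicator function of \<open>fc N\<close>.\<close>

fun conv :: "nat \<Rightarrow> nat \<Rightarrow> 'g L2_operator" where
  "conv N 0 = lambda_op G \<mu> {}"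
| "conv N (Suc n) = op_add M (conv N n) (lambda_op G \<mu> (fc_part_set N n))"

lemma conv_bicommutant: "conv N n \<in> commutant M (commutant M generators)"
proof (induction n)
  case 0
  have "borel_bisection G {}" by (intro bisectionI) auto
  hence "lambda_op G \<mu> {} \<in> generators" by (auto simp: generators_def)
  thus ?case using bicommutant_extensive[OF generators_bounded] by auto
next
  case (Suc n)
  have "lambda_op G \<mu> (fc_part_set N n) \<in> generators" using fc_part_bisection by (auto simp: generators_def)
  moreover have "commutant M generators \<subseteq> bounded_operators M" using commutant_bounded by blast
  ultimately show ?case
    using Suc bicommutant_extensive[OF generators_bounded] by (auto intro!: commutant_add)
qed

definition conv_fun :: "nat \<Rightarrow> nat \<Rightarrow> ('g \<Rightarrow> complex) \<Rightarrow> 'g \<Rightarrow> complex" where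
  "conv_fun N n f g = (\<Sum>i<n. weight (fc_part_set N i) g * f (left_trans (sec (fc_part_set N i)) g))"

lemma translate_sq:
  assumes "borel_bisection G A" "f \<in> square_integrable M"
  shows "(\<lambda>g. weight A g * f (left_trans (sec A) g)) \<in> square_integrable M"
  by (rule square_integrable_mult[OF square_integrable_compose(1)[OF trans_preserving(1)[OF borel_section_sec]], of _ _ _ 1])
    (use assms weight_measurable weight_le in auto)

lemma conv_class:
  assumes f: "f \<in> square_integrable M"
  shows "conv_fun N n f \<in> square_integrable M \<and> conv N n (L2_class M f) = L2_class M (conv_fun N n f)"
proof (induction n)
  case 0
  have b: "borel_bisection G {}" by (intro bisectionI) auto
  have "conv_fun N 0 f = (\<lambda>g. weight {} g * f (left_trans (sec {}) g))"
    by (simp add: conv_fun_def weight_def fun_eq_iff)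
  thus ?case using translate_sq[OF b f] lambda_op_class[OF b f] by simp
next
  case (Suc n)
  note b = fc_part_bisection[of N n]
  have e: "conv_fun N (Suc n) f =
      (\<lambda>g. conv_fun N n f g + weight (fc_part_set N n) g * f (left_trans (sec (fc_part_set N n)) g))"
    by (simp add: conv_fun_def fun_eq_iff)
  show ?case unfolding e
    using Suc square_integrable_add[OF _ translate_sq[OF b f]] lambda_op_class[OF b f]
      L2_class_in_L2[OF f] L2_add_class[OF _ translate_sq[OF b f]]
    by (simp add: op_add_def)
qed

text \<open>Since the pieces are disjoint, each element of \<open>fc N\<close> in the fibre belongs
  to exactly one index. The resulting sum over group elements no longer mentions the partition, so
  conjugation can act on it.\<close>

lemma conv_fun_eq:
  assumes g: "g \<in> arrows G"
  shows "conv_fun N N f g = (\<Sum>t\<in>{t \<in> fc N. p t = p g}. f (gmult G (ginv G t) g))"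
proof -
  let ?A = "fc_part_set N" and ?x = "p g"
  let ?I = "{i \<in> {..<N}. ?x \<in> p ` ?A i}"
  have "conv_fun N N f g = (\<Sum>i<N. if ?x \<in> p ` ?A i then f (gmult G (ginv G (sec (?A i) ?x)) g) else 0)"
    unfolding conv_fun_def by (intro sum.cong) (auto simp: weight_def left_trans_def)
  also have "\<dots> = (\<Sum>i\<in>?I. f (gmult G (ginv G (sec (?A i) ?x)) g))"
    by (simp add: sum.If_cases Int_def)
  also have "\<dots> = (\<Sum>t\<in>{t \<in> fc N. p t = p g}. f (gmult G (ginv G t) g))"
  proof (rule sum.reindex_bij_betw)
    show "bij_betw (\<lambda>i. sec (?A i) ?x) ?I {t \<in> fc N. p t = p g}"
    proof (rule bij_betw_imageI)
      show "inj_on (\<lambda>i. sec (?A i) ?x) ?I"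
      proof (rule inj_onI)
        fix i j assume "i \<in> ?I" "j \<in> ?I" and eq: "sec (?A i) ?x = sec (?A j) ?x"
        hence "sec (?A i) ?x \<in> part i" "sec (?A j) ?x \<in> part j"
          using sec_in[of ?x "?A i"] sec_in[of ?x "?A j"] by (auto simp: fc_part_set_def)
        thus "i = j" using part(3) eq by (auto simp: disjoint_family_on_def)
      qed
      show "(\<lambda>i. sec (?A i) ?x) ` ?I = {t \<in> fc N. p t = p g}"
      proof
        show "(\<lambda>i. sec (?A i) ?x) ` ?I \<subseteq> {t \<in> fc N. p t = p g}"
          using sec_in[of ?x "?A _"] src_sec[of ?x "?A _"] by (auto simp: fc_part_set_def)
        show "{t \<in> fc N. p t = p g} \<subseteq> (\<lambda>i. sec (?A i) ?x) ` ?I"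
        proof
          fix t assume t: "t \<in> {t \<in> fc N. p t = p g}"
          then obtain n where n: "n < N" "t \<in> part n" using fc_part by blast
          hence tA: "t \<in> ?A n" using t by (simp add: fc_part_set_def)
          hence "sec (?A n) (p t) = t" by (rule sec_src[OF bisectionD(2)[OF fc_part_bisection]])
          hence "t = sec (?A n) ?x" using t by simp
          moreover have "?x \<in> p ` ?A n" using t tA by (metis (mono_tags, lifting) image_eqI mem_Collect_eq)
          ultimately show "t \<in> (\<lambda>i. sec (?A i) ?x) ` ?I" using n(1) by blast
        qed
      qed
    qed
  qed
  finally show ?thesis .
qed

lemma div_mult:
  assumes "a \<in> arrows G" "b \<in> arrows G" "g \<in> arrows G" "p a = p g" "p b = p g"
  shows "gmult G (ginv G a) (gmult G (ginv G b) g) = gmult G (ginv G (gmult G b a)) g"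
proof -
  interpret group "\<Gamma> (p g)" using group_\<Gamma> src_in_units assms by blast
  have c: "a \<in> carrier (\<Gamma> (p g))" "b \<in> carrier (\<Gamma> (p g))" "g \<in> carrier (\<Gamma> (p g))"
    using assms by (auto simp: carrier_\<Gamma>)
  have "inv\<^bsub>\<Gamma> (p g)\<^esub> a \<otimes>\<^bsub>\<Gamma> (p g)\<^esub> (inv\<^bsub>\<Gamma> (p g)\<^esub> b \<otimes>\<^bsub>\<Gamma> (p g)\<^esub> g) = inv\<^bsub>\<Gamma> (p g)\<^esub> (b \<otimes>\<^bsub>\<Gamma> (p g)\<^esub> a) \<otimes>\<^bsub>\<Gamma> (p g)\<^esub> g"
    using c by (simp add: m_assoc inv_mult_group)
  thus ?thesis using assms mult_closed[of b a] by (simp add: mult_\<Gamma> inv_\<Gamma>)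
qed

text \<open>Over the fibre of g, with b the value of the section of \<open>B\<close>, the two sides
  sum f at \<open>(t b)^-1 g\<close> and at \<open>(b t)^-1 g\<close>. Conjugation by b permutes the
  elements t of \<open>fc N\<close> in the fibre and carries one sum to the other; outside the
  fibres that meet \<open>B\<close> both sides vanish.\<close>

lemma conv_commutes:
  assumes B: "borel_bisection G B" and f: "f \<in> square_integrable M"
  shows "conv N N (lambda_op G \<mu> B (L2_class M f)) = lambda_op G \<mu> B (conv N N (L2_class M f))"
proof -
  let ?l = "\<lambda>f g. weight B g * f (left_trans (sec B) g)"
  note s = borel_section_sec[OF B]
  have "conv_fun N N (?l f) g = ?l (conv_fun N N f) g" if g: "g \<in> arrows G" for g
  proof (cases "p g \<in> p ` B")
    case False
    hence "weight B h = 0" if "p h = p g" for h using that by (simp add: weight_def)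
    moreover have "p (gmult G (ginv G t) g) = p g" if "t \<in> {t \<in> fc N. p t = p g}" for t
      using that fcD(1)[of t N] inv_closed[of t] mult_closed(2)[of "ginv G t" g] g by auto
    ultimately show ?thesis unfolding conv_fun_eq[OF g] by simp
  next
    case True
    let ?b = "sec B (p g)"
    have b: "?b \<in> arrows G" "p ?b = p g" using section_in[OF s g] .
    have lt: "left_trans (sec B) g \<in> arrows G" "p (left_trans (sec B) g) = p g" using trans_closed(1,2)[OF s g] .
    have "conv_fun N N (?l f) g = (\<Sum>t\<in>{t \<in> fc N. p t = p g}. f (gmult G (ginv G (gmult G t ?b)) g))"
      unfolding conv_fun_eq[OF g]
    proof (rule sum.cong)
      fix t assume t: "t \<in> {t \<in> fc N. p t = p g}"
      hence ta: "t \<in> arrows G" "p t = p g" using fcD by auto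
      have c: "p (gmult G (ginv G t) g) = p g"
        using ta inv_closed[of t] mult_closed(2)[of "ginv G t" g] g by auto
      have "weight B (gmult G (ginv G t) g) = 1" using True c by (simp add: weight_def)
      moreover have "left_trans (sec B) (gmult G (ginv G t) g) = gmult G (ginv G (gmult G t ?b)) g"
        unfolding left_trans_def c using div_mult[OF b(1) ta(1) g b(2) ta(2)] .
      ultimately show "?l f (gmult G (ginv G t) g) = f (gmult G (ginv G (gmult G t ?b)) g)" by simp
    qed simp
    also have "\<dots> = (\<Sum>t\<in>{t \<in> fc N. p t = p g}. f (gmult G (ginv G (gmult G ?b t)) g))"
    proof (rule sum.reindex_bij_witness[of _ "\<lambda>t. cj ?b t" "\<lambda>t. cj (ginv G ?b) t"])
      fix t assume t: "t \<in> {t \<in> fc N. p t = p g}"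
      hence ta: "t \<in> arrows G" "p t = p g" using fcD by auto
      have bt: "p ?b = p t" using b ta by simp
      show "cj ?b (cj (ginv G ?b) t) = t" "cj (ginv G ?b) (cj ?b t) = t"
        using cj_inv[OF b(1) ta(1) bt] .
      show "cj ?b t \<in> {t \<in> fc N. p t = p g}"
        using fc_cj[of t N ?b] cj_closed[OF b(1) ta(1) bt] t b ta by auto
      show "cj (ginv G ?b) t \<in> {t \<in> fc N. p t = p g}"
        using fc_cj[of t N "ginv G ?b"] cj_closed[of "ginv G ?b" t] inv_closed[OF b(1)] t b ta by auto
      have "gmult G ?b (cj (ginv G ?b) t) = gmult G t ?b"
        using b ta inv_closed[OF b(1)] mult_closed[of "ginv G ?b" t] mult_closed[of t ?b] inv_inv[OF b(1)]
          inv_mult_cancel(2)[of ?b "gmult G t ?b"] by (simp add: cj_def mult_assoc')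
      thus "f (gmult G (ginv G (gmult G ?b (cj (ginv G ?b) t))) g) = f (gmult G (ginv G (gmult G t ?b)) g)" by simp
    qed
    also have "\<dots> = ?l (conv_fun N N f) g"
    proof -
      have "?l (conv_fun N N f) g = conv_fun N N f (left_trans (sec B) g)" using True by (simp add: weight_def)
      also have "\<dots> = (\<Sum>t\<in>{t \<in> fc N. p t = p g}. f (gmult G (ginv G t) (left_trans (sec B) g)))"
        unfolding conv_fun_eq[OF lt(1)] lt(2) ..
      also have "\<dots> = (\<Sum>t\<in>{t \<in> fc N. p t = p g}. f (gmult G (ginv G (gmult G ?b t)) g))"
        unfolding left_trans_def using fcD(1) b g by (intro sum.cong) (auto simp: div_mult)
      finally show ?thesis ..
    qed
    finally show ?thesis .
  qed
  hence "L2_class M (conv_fun N N (?l f)) = L2_class M (?l (conv_fun N N f))"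
    by (intro L2_class_eqI AE_I2) (simp add: space_M)
  thus ?thesis
    using conv_class[OF f, of N N] conv_class[OF translate_sq[OF B f], of N N]
    by (simp add: lambda_op_class[OF B] f)
qed

lemma conv_central: "conv N N \<in> center M (groupoid_vN G \<mu>)"
proof -
  have "conv N N \<in> commutant M generators"
    using commutant_bounded[OF conv_bicommutant] conv_commutes
    by (intro commutantI) (auto simp: generators_def)
  thus ?thesis using conv_bicommutant by (simp add: center_eq)
qed

lemma conv_fun_\<delta>:
  assumes g: "g \<in> arrows G" shows "conv_fun N N \<delta> g = indicator (fc N) g"
proof -
  \<comment> \<open>Finiteness matters here: a sum over an infinite index set would be 0 by
    convention.\<close>
  have fin: "finite {t \<in> fc N. p t = p g}"
    by (rule finite_subset[OF _ finite_parts_fibre[of N "p g"]]) (auto elim: fc_part)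
  have "conv_fun N N \<delta> g = (\<Sum>t\<in>{t \<in> fc N. p t = p g}. if t = g then 1 else 0)"
    unfolding conv_fun_eq[OF g] using fcD(1) g
    by (intro sum.cong) (auto simp: \<delta>_def div_in_units_iff indicator_def)
  also have "\<dots> = indicator (fc N) g" using fin by (simp add: indicator_def)
  finally show ?thesis .
qed

lemma center_eq_Linf_imp_icc:
  assumes "center M (groupoid_vN G \<mu>) = Linf_units G \<mu>"
  shows "AE x in \<mu>. icc (\<Gamma> x)"
  unfolding AE_icc_iff
proof
  fix N
  have "conv N N \<in> Linf_units G \<mu>" using conv_central assms by blast
  then obtain f where f: "conv N N = mult_operator M (\<lambda>g. f (tgt G g))" by (auto simp: Linf_units_def)
  have "L2_class M (conv_fun N N \<delta>) = L2_class M (\<lambda>g. f (tgt G g) * \<delta> g)"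
    using conv_class[OF \<delta>_sq, of N N] mult_operator_class[OF \<delta>_sq] f by simp
  from L2_class_AE[OF this] conv_class[OF \<delta>_sq, of N N]
  have "AE g in M. conv_fun N N \<delta> g = f (tgt G g) * \<delta> g" by blast
  moreover have "AE g in M. g \<in> arrows G" using AE_space[of M] by (simp add: space_M)
  ultimately show "AE g in M. g \<notin> fc N"
  proof eventually_elim
    case (elim g)
    show ?case
    proof
      assume "g \<in> fc N"
      hence "f (tgt G g) * \<delta> g = 1" using elim conv_fun_\<delta>[of g N] by simp
      thus False using fcD(2)[OF \<open>g \<in> fc N\<close>] by (simp add: \<delta>_def)
    qed
  qed
qed


subsection \<open>Central operators in the icc case\<close>

text \<open>Chebyshev's inequality: the superlevel set has finite measure, so its fibre count is
  integrable over the units and therefore finite almost everywhere.\<close>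

lemma AE_finite_superlevel:
  assumes \<zeta>: "\<zeta> \<in> square_integrable M" and r: "0 < r"
  shows "AE x in \<mu>. finite {g \<in> arrows G. r \<le> (cmod (\<zeta> g))\<^sup>2 \<and> p g = x}"
proof -
  let ?E = "{g \<in> arrows G. r \<le> (cmod (\<zeta> g))\<^sup>2}"
  have \<zeta>M: "\<zeta> \<in> borel_measurable M" and i: "integrable M (\<lambda>g. (cmod (\<zeta> g))\<^sup>2)"
    using \<zeta> by (auto simp: square_integrable_def)
  have [measurable]: "\<zeta> \<in> borel_measurable (gborel G)" using \<zeta>M unfolding measurable_M .
  have E: "?E \<in> sets (gborel G)" by measurable
  hence EM: "?E \<in> sets M" using sets_M by simp
  have "integrable M (\<lambda>g. (1 / r) * (cmod (\<zeta> g))\<^sup>2)" using i by simp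
  hence "integrable M (indicator ?E :: 'g \<Rightarrow> real)"
    by (rule Bochner_Integration.integrable_bound)
      (use EM r in \<open>auto simp: indicator_def field_simps\<close>)
  hence "emeasure M ?E < \<infinity>" using EM by (simp add: integrable_indicator_iff)
  hence "(\<integral>\<^sup>+ x. fibre_count ?E x \<partial>\<mu>) \<noteq> \<infinity>" using emeasure_M[OF E] by simp
  hence "AE x in \<mu>. fibre_count ?E x \<noteq> \<infinity>"
    by (rule nn_integral_noteq_infinite[OF fibre_count_measurable[OF E]])
  thus ?thesis
  proof eventually_elim
    case (elim x)
    hence "finite {g \<in> ?E. p g = x}" by (auto simp: emeasure_count_space split: if_splits)
    thus ?case by (rule rev_finite_subset) auto
  qed
qed

text \<open>Left and right translation of \<delta> by a piece give the same vector. As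
  \<open>Z\<close> commutes with both operators, they also agree on \<zeta>. The countably many null
  sets, one for each piece, can be discarded together, and the pieces reach every \<open>h\<close>
  in the remaining fibres.\<close>

lemma central_conj_invariant:
  assumes Z: "Z \<in> center M (groupoid_vN G \<mu>)"
  defines "\<zeta> \<equiv> L2_rep (Z (L2_class M \<delta>))"
  shows "AE x in \<mu>. \<forall>h\<in>arrows G. p h = x \<longrightarrow> (\<forall>g\<in>arrows G. p g = x \<longrightarrow> \<zeta> (cj h g) = \<zeta> g)"
proof -
  have Zc: "Z \<in> commutant M (commutant M generators)" "Z \<in> commutant M generators"
    using Z center_eq by auto
  note \<delta>L = L2_class_in_L2[OF \<delta>_sq]
  note ZL = bounded_operatorsD(1)[OF commutant_bounded[OF Zc(2)] \<delta>L]
  have \<zeta>: "\<zeta> \<in> square_integrable M" "L2_class M \<zeta> = Z (L2_class M \<delta>)"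
    unfolding \<zeta>_def using L2_rep[OF ZL] by auto
  have "AE g in M. weight (part n) g * \<zeta> (left_trans (sec (part n)) g) =
      weight (part n) g * \<zeta> (right_trans (sec (part n)) g)" for n
  proof -
    note b = bisection_part[of n]
    have "lambda_op G \<mu> (part n) \<in> generators" using b by (auto simp: generators_def)
    note 1 = commutantD[OF Zc(2) this \<delta>L]
    note 2 = commutantD[OF Zc(1) rho_op_commutant[OF b] \<delta>L]
    have "lambda_op G \<mu> (part n) (L2_class M \<delta>) = rho_op (part n) (L2_class M \<delta>)"
      unfolding lambda_op_class[OF b \<delta>_sq] rho_op_class[OF b \<delta>_sq]
      by (intro L2_class_eqI AE_I2) (simp add: space_M weight_\<delta>[OF b])
    hence "lambda_op G \<mu> (part n) (L2_class M \<zeta>) = rho_op (part n) (L2_class M \<zeta>)"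
      using 1 2 \<zeta>(2) by simp
    thus ?thesis unfolding lambda_op_class[OF b \<zeta>(1)] rho_op_class[OF b \<zeta>(1)]
      by (rule L2_class_AE) (rule translate_sq[OF b \<zeta>(1)])
  qed
  hence "AE g in M. \<forall>n. weight (part n) g * \<zeta> (left_trans (sec (part n)) g) =
      weight (part n) g * \<zeta> (right_trans (sec (part n)) g)"
    unfolding AE_all_countable by blast
  thus ?thesis unfolding AE_M_iff
  proof eventually_elim
    case (elim x)
    have key: "\<zeta> (gmult G (ginv G h) g) = \<zeta> (gmult G g (ginv G h))"
      if h: "h \<in> arrows G" "p h = x" and g: "g \<in> arrows G" "p g = x" for h g
    proof -
      obtain n where n: "h \<in> part n" using h(1) part(4) by blast
      have s: "sec (part n) (p g) = h" using sec_src[OF part(2) n] h(2) g(2) by simp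
      have "weight (part n) g = 1" using n h(2) g(2) by (auto simp: weight_def)
      moreover have "weight (part n) g * \<zeta> (left_trans (sec (part n)) g) =
          weight (part n) g * \<zeta> (right_trans (sec (part n)) g)"
        using elim g by blast
      ultimately show ?thesis using s by (simp add: left_trans_def right_trans_def)
    qed
    show ?case
    proof (intro ballI impI)
      fix h g assume h: "h \<in> arrows G" "p h = x" and g: "g \<in> arrows G" "p g = x"
      note i = inv_closed[OF h(1)]
      have c: "gmult G g (ginv G h) \<in> arrows G" "p (gmult G g (ginv G h)) = x"
        using mult_closed[OF g(1) i(1)] g h i by auto
      \<comment> \<open>The translation identity \<open>key\<close> is used with the inverse of
        \<open>h\<close> as translating element, at the point g h^-1.\<close>
      have "\<zeta> (cj h g) = \<zeta> (gmult G (ginv G (ginv G h)) (gmult G g (ginv G h)))"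
        using h g i by (simp add: cj_def inv_inv mult_assoc')
      also have "\<dots> = \<zeta> (gmult G (gmult G g (ginv G h)) (ginv G (ginv G h)))"
        using key[OF i(1) _ c] i h by simp
      also have "gmult G (gmult G g (ginv G h)) (ginv G (ginv G h)) = g"
        using inv_mult_cancel(3)[OF i(1) g(1)] i h g by simp
      finally show "\<zeta> (cj h g) = \<zeta> g" .
    qed
  qed
qed

lemma central_supported_on_units:
  assumes Z: "Z \<in> center M (groupoid_vN G \<mu>)" and icc: "AE x in \<mu>. icc (\<Gamma> x)"
  shows "AE g in M. g \<notin> units G \<longrightarrow> L2_rep (Z (L2_class M \<delta>)) g = 0"
proof -
  define \<zeta> where "\<zeta> = L2_rep (Z (L2_class M \<delta>))"
  have "Z \<in> commutant M generators" using Z center_eq by auto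
  from bounded_operatorsD(1)[OF commutant_bounded[OF this] L2_class_in_L2[OF \<delta>_sq]]
  have \<zeta>: "\<zeta> \<in> square_integrable M" unfolding \<zeta>_def by (rule L2_rep)
  \<comment> \<open>The thresholds 1/(k+1) reach below every positive number while causing only
    countably many exceptional sets.\<close>
  have fin: "AE x in \<mu>. \<forall>k::nat. finite {g \<in> arrows G. 1 / real (Suc k) \<le> (cmod (\<zeta> g))\<^sup>2 \<and> p g = x}"
    unfolding AE_all_countable by (intro allI AE_finite_superlevel \<zeta>) simp
  have "AE x in \<mu>. \<forall>g\<in>arrows G. p g = x \<longrightarrow> g \<notin> units G \<longrightarrow> \<zeta> g = 0"
    using icc central_conj_invariant[OF Z, folded \<zeta>_def] fin
  proof eventually_elim
    case (elim x)
    show ?case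
    proof (intro ballI impI, rule ccontr)
      fix g assume g: "g \<in> arrows G" "p g = x" "g \<notin> units G" and ne: "\<zeta> g \<noteq> 0"
      have "0 < (cmod (\<zeta> g))\<^sup>2" using ne by simp
      from reals_Archimedean[OF this] obtain k where k: "1 / real (Suc k) < (cmod (\<zeta> g))\<^sup>2"
        by (auto simp: inverse_eq_divide)
      have "(\<lambda>h. cj h g) ` {h \<in> arrows G. p h = x} \<subseteq>
          {g \<in> arrows G. 1 / real (Suc k) \<le> (cmod (\<zeta> g))\<^sup>2 \<and> p g = x}"
      proof
        fix c assume "c \<in> (\<lambda>h. cj h g) ` {h \<in> arrows G. p h = x}"
        then obtain h where h: "h \<in> arrows G" "p h = x" "c = cj h g" by blast
        thus "c \<in> {g \<in> arrows G. 1 / real (Suc k) \<le> (cmod (\<zeta> g))\<^sup>2 \<and> p g = x}"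
          using cj_closed[OF h(1) g(1)] elim(2) g(1,2) k by simp
      qed
      hence "finite ((\<lambda>h. cj h g) ` {h \<in> arrows G. p h = x})" using elim(3) finite_subset by blast
      moreover have "g \<noteq> x" using g(3) src_in_units[OF g(1)] g(2) by auto
      ultimately show False
        using elim(1) g(1,2) unfolding icc_def conj_class_eq[OF g(1,2), symmetric]
        by (simp add: carrier_\<Gamma> one_\<Gamma>)
    qed
  qed
  thus ?thesis unfolding AE_M_iff \<zeta>_def .
qed

text \<open>The indicator of \<open>B\<close> is the right translate of \<delta>, and
  \<open>Z\<close> commutes with right translations, so the result is the right translate of
  \<zeta>. As \<zeta> lives on the units, this translate can be nonzero at g only for g in
  \<open>B\<close>, where its value is that of \<zeta> at the unit of the fibre.\<close>

lemma central_op_on_bisection: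
  assumes Z: "Z \<in> center M (groupoid_vN G \<mu>)" and icc: "AE x in \<mu>. icc (\<Gamma> x)"
    and B: "borel_bisection G B"
  shows "Z (L2_class M (indicator B)) =
    L2_class M (\<lambda>g. L2_rep (Z (L2_class M \<delta>)) (tgt G g) * indicator B g)"
proof -
  define \<zeta> where "\<zeta> = L2_rep (Z (L2_class M \<delta>))"
  have Zc: "Z \<in> commutant M (commutant M generators)" using Z center_eq by auto
  note \<delta>L = L2_class_in_L2[OF \<delta>_sq]
  note ZL = bounded_operatorsD(1)[OF commutant_bounded[OF Zc] \<delta>L]
  have \<zeta>: "\<zeta> \<in> square_integrable M" "L2_class M \<zeta> = Z (L2_class M \<delta>)"
    unfolding \<zeta>_def using L2_rep[OF ZL] by auto
  have "L2_class M (indicator B) = rho_op B (L2_class M \<delta>)"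
    unfolding rho_op_class[OF B \<delta>_sq] by (intro L2_class_eqI AE_I2) (simp add: space_M weight_\<delta>[OF B])
  hence "Z (L2_class M (indicator B)) = rho_op B (L2_class M \<zeta>)"
    using commutantD[OF Zc rho_op_commutant[OF B] \<delta>L] \<zeta>(2) by simp
  also have "\<dots> = L2_class M (\<lambda>g. weight B g * \<zeta> (right_trans (sec B) g))"
    by (rule rho_op_class[OF B \<zeta>(1)])
  also have "\<dots> = L2_class M (\<lambda>g. \<zeta> (tgt G g) * indicator B g)"
  proof (rule L2_class_eqI, unfold AE_M_iff)
    from central_supported_on_units[OF Z icc, folded \<zeta>_def, unfolded AE_M_iff]
    show "AE x in \<mu>. \<forall>g\<in>arrows G. p g = x \<longrightarrow>
        weight B g * \<zeta> (right_trans (sec B) g) = \<zeta> (tgt G g) * indicator B g"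
    proof eventually_elim
      case (elim x)
      show ?case
      proof (intro ballI impI)
        fix g assume g: "g \<in> arrows G" "p g = x"
        let ?r = "right_trans (sec B) g"
        have r: "?r \<in> arrows G" "p ?r = x" using trans_closed(3,4)[OF borel_section_sec[OF B] g(1)] g(2) by auto
        show "weight B g * \<zeta> ?r = \<zeta> (tgt G g) * indicator B g"
        proof (cases "?r \<in> units G")
          case True
          hence "?r = x" using r(2) src_unit by metis
          moreover have "weight B g = indicator B g"
            using weight_\<delta>(2)[OF B g(1)] True by (simp add: \<delta>_def)
          ultimately show ?thesis using g tgt_eq_src by simp
        next
          case False
          hence "\<zeta> ?r = 0" using elim r by blast
          moreover have "indicator B g = (0 :: complex)"
            using weight_\<delta>(2)[OF B g(1)] False by (simp add: \<delta>_def)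
          ultimately show ?thesis by simp
        qed
      qed
    qed
  qed
  finally show ?thesis unfolding \<zeta>_def .
qed

text \<open>\<open>Z\<close> is tested on the indicator of the set of units where \<zeta> exceeds
  the operator bound. There \<open>Z\<close> acts as multiplication by \<zeta>, so unless the set is
  null the norm estimate fails.\<close>

lemma central_function_bounded:
  assumes Z: "Z \<in> center M (groupoid_vN G \<mu>)" and icc: "AE x in \<mu>. icc (\<Gamma> x)"
  shows "\<exists>K. AE x in \<mu>. cmod (L2_rep (Z (L2_class M \<delta>)) x) \<le> K"
proof -
  define \<zeta> where "\<zeta> = L2_rep (Z (L2_class M \<delta>))"
  have Zb: "Z \<in> bounded_operators M" using Z center_eq commutant_bounded by auto
  have \<zeta>: "\<zeta> \<in> square_integrable M"
    unfolding \<zeta>_def using bounded_operatorsD(1)[OF Zb L2_class_in_L2[OF \<delta>_sq]] by (rule L2_rep)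
  obtain K where K: "\<And>\<xi>. \<xi> \<in> L2 M \<Longrightarrow> L2_norm M (Z \<xi>) \<le> K * L2_norm M \<xi>"
    using bounded_operatorsD(4)[OF Zb] by blast
  have \<zeta>M: "\<zeta> \<in> borel_measurable M" and \<zeta>i: "integrable M (\<lambda>g. (cmod (\<zeta> g))\<^sup>2)"
    using \<zeta> by (auto simp: square_integrable_def)
  have \<zeta>B[measurable]: "\<zeta> \<in> borel_measurable (gborel G)" using \<zeta>M unfolding measurable_M .
  \<comment> \<open>The constant \<open>K\<close> is not known to be nonnegative; only its square
    enters the estimate, so the threshold is its absolute value.\<close>
  define B where "B = units G \<inter> {g \<in> arrows G. \<bar>K\<bar> < cmod (\<zeta> g)}"
  have "{g \<in> arrows G. \<bar>K\<bar> < cmod (\<zeta> g)} \<in> sets (gborel G)" by measurable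
  hence B: "B \<in> sets (gborel G)" "B \<subseteq> units G" using units_borel by (auto simp: B_def)
  have bis: "borel_bisection G B"
    by (rule bisectionI[OF B(1)]) (use B(2) src_unit in \<open>auto simp: inj_on_def subset_iff\<close>)
  let ?i = "indicator B :: 'g \<Rightarrow> complex"
  have i: "?i \<in> square_integrable M"
    using B emeasure_M_units[OF B] sets_M by (intro indicator_square_integrable) auto
  have "Z (L2_class M ?i) = L2_class M (\<lambda>g. \<zeta> (tgt G g) * ?i g)"
    using central_op_on_bisection[OF Z icc bis] by (simp add: \<zeta>_def)
  also have "\<dots> = L2_class M (\<lambda>g. ?i g * \<zeta> g)"
    using B(2) tgt_unit by (intro L2_class_eqI AE_I2) (auto simp: indicator_def)
  finally have Zi: "Z (L2_class M ?i) = L2_class M (\<lambda>g. ?i g * \<zeta> g)" .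
  have iM: "?i \<in> borel_measurable M" using B(1) sets_M by (intro borel_measurable_indicator) simp
  have sq: "(\<lambda>g. ?i g * \<zeta> g) \<in> square_integrable M"
    by (rule square_integrable_mult[OF \<zeta> iM, of 1]) (simp add: indicator_def)
  have I: "integrable M (\<lambda>g. (cmod (?i g * \<zeta> g))\<^sup>2)" "integrable M (\<lambda>g. (cmod (?i g))\<^sup>2)"
    using sq i by (auto simp: square_integrable_def)
  have "(L2_norm M (Z (L2_class M ?i)))\<^sup>2 \<le> (K * L2_norm M (L2_class M ?i))\<^sup>2"
    by (intro power_mono K L2_class_in_L2 i) (simp add: L2_norm_def)
  hence le: "(\<integral>g. (cmod (?i g * \<zeta> g))\<^sup>2 \<partial>M) \<le> K\<^sup>2 * (\<integral>g. (cmod (?i g))\<^sup>2 \<partial>M)"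
    unfolding Zi L2_norm_class[OF sq] L2_norm_class[OF i] by (simp add: power_mult_distrib)
  \<comment> \<open>The difference of the integrands is positive on \<open>B\<close> and zero
    elsewhere, while its integral is at most 0; hence \<open>B\<close> is null.\<close>
  let ?h = "\<lambda>g. (cmod (?i g * \<zeta> g))\<^sup>2 - K\<^sup>2 * (cmod (?i g))\<^sup>2"
  have hi: "integrable M ?h" using I by simp
  have "(\<integral>g. ?h g \<partial>M) \<le> 0" using le I by simp
  moreover have pos: "0 < ?h g" if "g \<in> B" for g
  proof -
    have "\<bar>K\<bar>\<^sup>2 < (cmod (\<zeta> g))\<^sup>2" using that by (intro power_strict_mono) (auto simp: B_def)
    thus ?thesis using that by simp
  qed
  have nn: "0 \<le> ?h g" for g using pos[of g] by (cases "g \<in> B") auto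
  ultimately have "(\<integral>g. ?h g \<partial>M) = 0" using nn by (intro antisym integral_nonneg_AE) auto
  hence "AE g in M. ?h g = 0" using integral_nonneg_eq_0_iff_AE[OF hi] nn by simp
  hence "AE g in M. g \<notin> B" by eventually_elim (use pos in fastforce)
  hence "AE x in \<mu>. \<forall>g\<in>arrows G. p g = x \<longrightarrow> g \<notin> B" unfolding AE_M_iff .
  moreover have "AE x in \<mu>. x \<in> units G"
    using AE_space[of \<mu>] sets_eq_imp_space_eq[OF sets_mu] space_unit by simp
  ultimately have "AE x in \<mu>. cmod (\<zeta> x) \<le> \<bar>K\<bar>"
  proof eventually_elim
    case (elim x)
    hence "x \<notin> B" using units_subset src_unit by blast
    thus ?case using elim(2) units_subset by (auto simp: B_def not_less)
  qed
  thus ?thesis unfolding \<zeta>_def by blast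
qed

text \<open>On indicators of bisections both operators multiply by the same function. The indicator
  of a set of finite measure is the dominated limit of its traces on the first \<open>n\<close>
  pieces, which are finite sums of such indicators, and bounded operators are determined by these
  vectors.\<close>

lemma icc_imp_center_subset:
  assumes icc: "AE x in \<mu>. icc (\<Gamma> x)"
  shows "center M (groupoid_vN G \<mu>) \<subseteq> Linf_units G \<mu>"
proof
  fix Z assume Z: "Z \<in> center M (groupoid_vN G \<mu>)"
  let ?f = "L2_rep (Z (L2_class M \<delta>))"
  let ?T = "mult_operator M (\<lambda>g. ?f (tgt G g))"
  have Zb: "Z \<in> bounded_operators M" using Z center_eq commutant_bounded by auto
  have "?f \<in> square_integrable M"
    using bounded_operatorsD(1)[OF Zb L2_class_in_L2[OF \<delta>_sq]] by (rule L2_rep)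
  hence "?f \<in> borel_measurable (gborel G)" using measurable_M square_integrable_measurable by blast
  hence "?f \<in> borel_measurable (unit_space G)" unfolding unit_space_def by (rule measurable_restrict_space1)
  hence f: "?f \<in> borel_measurable \<mu>" using measurable_cong_sets[OF sets_mu refl] by blast
  obtain K where K: "AE x in \<mu>. cmod (?f x) \<le> K" using central_function_bounded[OF Z icc] by blast
  have Tb: "?T \<in> bounded_operators M"
    using mult_operator_bounded[OF tgt_measurable[OF f] AE_M_tgt[OF K]] .
  have "Z = ?T"
  proof (rule bounded_operators_eqI[OF Zb Tb])
    fix E assume E: "E \<in> sets M" "emeasure M E < \<infinity>"
    have EG: "E \<in> sets (gborel G)" using E(1) sets_M by simp
    let ?u = "\<lambda>n g. \<Sum>i<n. indicator (E \<inter> part i) g :: complex"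
    have bis: "borel_bisection G (E \<inter> part i)" for i
      using EG part(1,2)[of i] by (intro bisectionI) (auto intro: inj_on_subset)
    have isq: "(indicator (E \<inter> part i) :: 'g \<Rightarrow> complex) \<in> square_integrable M" for i
    proof (rule indicator_square_integrable)
      show s: "E \<inter> part i \<in> sets M" using bisectionD(1)[OF bis] sets_M by simp
      show "emeasure M (E \<inter> part i) < \<infinity>"
        using emeasure_mono[of "E \<inter> part i" E M] E by (auto intro: order.strict_trans1)
    qed
    have Esq: "(indicator E :: 'g \<Rightarrow> complex) \<in> square_integrable M"
      using E by (rule indicator_square_integrable)
    have k: "(\<lambda>g. ?f (tgt G g) * indicator (E \<inter> part i) g) \<in> square_integrable M" for i
      using isq tgt_measurable[OF f] AE_M_tgt[OF K] by (rule square_integrable_mult)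
    have u_eq: "?u n g = indicator (E \<inter> (\<Union>i<n. part i)) g" for n g
    proof (induction n)
      case (Suc n)
      have "g \<notin> (\<Union>i<n. part i)" if "g \<in> part n"
      proof
        assume "g \<in> (\<Union>i<n. part i)"
        then obtain i where "i < n" "g \<in> part i" by blast
        hence i: "i \<noteq> n" "g \<in> part i" by auto
        have "part i \<inter> part n = {}" using part(3) i(1) by (simp add: disjoint_family_on_def)
        thus False using i(2) that by blast
      qed
      hence "indicator (E \<inter> (\<Union>i<n. part i)) g + indicator (E \<inter> part n) g =
          (indicator (E \<inter> (\<Union>i<Suc n. part i)) g :: complex)"
        by (auto simp: indicator_def lessThan_Suc)
      thus ?case by (simp only: sum.lessThan_Suc Suc)
    qed simp
    have usq: "?u n \<in> square_integrable M" for n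
      unfolding u_eq
    proof (rule indicator_square_integrable)
      show "E \<inter> (\<Union>i<n. part i) \<in> sets M" using E(1) part(1) sets_M by (auto intro!: sets.finite_UN)
      show "emeasure M (E \<inter> (\<Union>i<n. part i)) < \<infinity>"
        using emeasure_mono[of "E \<inter> (\<Union>i<n. part i)" E M] E by (auto intro: order.strict_trans1)
    qed
    show "Z (L2_class M (indicator E)) = ?T (L2_class M (indicator E))"
    proof (rule bounded_operators_eq_limit[OF Zb Tb usq Esq])
      show "L2_tendsto M ?u (indicator E)"
      proof (rule L2_tendsto_dominated[OF _ _ Esq, where C=1])
        fix g assume "g \<in> space M"
        then obtain m where m: "g \<in> part m" using part(4) space_M by blast
        have "?u n g = indicator E g" if "n \<ge> Suc m" for n
          unfolding u_eq using m that by (auto simp: indicator_def)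
        thus "(\<lambda>n. ?u n g) \<longlonglongrightarrow> indicator E g"
          by (intro tendsto_eventually eventually_sequentiallyI)
        show "cmod (?u n g - indicator E g) \<le> 1 * cmod (indicator E g :: complex)" for n
          unfolding u_eq by (simp add: indicator_def)
      qed (use usq Esq square_integrable_measurable in blast)+
      fix n
      have "Z (L2_class M (?u n)) = L2_class M (\<lambda>g. \<Sum>i<n. ?f (tgt G g) * indicator (E \<inter> part i) g)"
        by (rule operator_sum[OF Zb _ isq k central_op_on_bisection[OF Z icc bis]]) simp
      also have "\<dots> = ?T (L2_class M (?u n))"
        by (rule operator_sum[OF Tb _ isq k mult_operator_class[OF isq], symmetric]) simp
      finally show "Z (L2_class M (?u n)) = ?T (L2_class M (?u n))" .
    qed
  qed
  thus "Z \<in> Linf_units G \<mu>" using f K unfolding Linf_units_def by blast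
qed

end

theorem proposition6p1:
  fixes G :: "'g groupoid" and \<mu> :: "'g measure"
  assumes "discrete_measured_groupoid G \<mu>"
    and "arrows G = Iso G"
  shows "measurable_field_of_countable_groups (unit_space G) (gborel G) (isotropy_group G) \<and>
    (center (mu_src G \<mu>) (groupoid_vN G \<mu>) = Linf_units G \<mu> \<longleftrightarrow>
       (AE x in \<mu>. icc (isotropy_group G x)))"
proof -
  interpret isotropy_groupoid G \<mu>
    using assms by (intro isotropy_groupoid.intro isotropy_groupoid_axioms.intro)
  show ?thesis
    using measurable_field center_eq_Linf_imp_icc icc_imp_center_subset Linf_subset_center by blast
qed

end
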